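(* Consider the restless hidden Markov bandit problem with linear rewards and the algorithm (Algorithm 1) described in the context, run with a constant $\alpha>3$ and parameters $\epsilon>0$, $\alpha_\epsilon>1$. Let $\Delta>0$ be the maximal $\delta$ such that the following holds: for all transition matrices $\hat P_S$ on $\mathcal S$ and all probability distributions $\hat P_{\boldsymbol\Theta_{b,s}}$ on $\boldsymbol\Theta_{b,s}$, if $|\hat P_S(\tilde s,\check s)-P_S(\tilde s,\check s)|\le\delta$ for all $\tilde s,\check s\in\mathcal S$ and $|\hat P_{\boldsymbol\Theta_{b,s}}(\boldsymbol\theta)-P_{\boldsymbol\Theta_{b,s}}(\boldsymbol\theta)|\le\delta$ for all $(b,s)\in\mathcal B\times\mathcal S$ and $\boldsymbol\theta\in\boldsymbol\Theta_{b,s}$, then $$\mathcal A^*\big(\hat P_S,\{\hat P_{\boldsymbol\Theta_{b,s}}\}_{(b,s)\in\mathcal B\times\mathcal S},\tilde s\big)=\mathcal A^*\big(P_S,\{P_{\boldsymbol\Theta_{b,s}}\}_{(b,s)\in\mathcal B\times\mathcal S},\tilde s\big)\quad\text{for every }\tilde s\in\mathcal S .$$ Then the expected regret $E[R(T)]$ of the algorithm is $$O\left(C_{\boldsymbol\Theta_{\max}}|\mathcal B||\mathcal S|T_MT_Sr_{\max}\frac{\log\left(4T^{\alpha}C_{\boldsymbol\Theta_{\max}}|\mathcal B||\mathcal S|\right)}{\Delta^2}+C_{\boldsymbol\Theta_{\max}}|\mathcal B|^2|\mathcal S|^2T_MT_Sr_{\max}\log_2\left(\frac{T}{|\mathcal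 S||\mathcal B|}+1\right)\right).$$
   Context: **Model.** $\mathcal S$ (states) and $\mathcal B$ (arms) are finite sets. The action set $\mathcal A\subset\mathbb R^N$ is an $N$-dimensional compact convex polytope with set of extreme points $\boldsymbol V$. For each $(b,s)\in\mathcal B\times\mathcal S$, $\boldsymbol\Theta_{b,s}\subset\mathbb R^N$ is a finite set carrying a probability distribution $P_{\boldsymbol\Theta_{b,s}}$, and $\boldsymbol\Theta_{b,\tilde s}\cap\boldsymbol\Theta_{b,\check s}=\emptyset$ whenever $\tilde s\ne\check s$. (The paper also assumes informally that $|\boldsymbol V|\gg|\boldsymbol\Theta_{b,s}|$.) The state process $(s_t)$ is a time-homogeneous irreducible aperiodic Markov chain on $\mathcal S$ with transition matrix $P_S$, stationary distribution $\mu_S$ and arbitrary initial distribution; it evolves independently of the decision maker's choices. At each time $t$ the decision maker chooses an arm $b_t\in\mathcal B$ and an action $\boldsymbol a_t\in\mathcal A$ and receives the reward $r_t(b_t,\boldsymbol a_t)=\langle\boldsymbol a_t,\boldsymbol\theta_t\rangle$, where, given $b_t$ and $s_t$, $\boldsymbol\theta_t=\boldsymbol\theta(b_t,s_t)$ is drawn from $P_{\boldsymbol\Theta_{b_t,s_t}}$ (independently of the past). The decision maker knows $\mathcal A,\mathcal S,\mathcal B$ and all sets $\boldsymbol\Theta_{b,s}$, and observes only its past choices and rewards; it knows neither $P_S$, nor the $P_{\boldsymbol\Theta_{b,s}}$, nor the realizations $s_t,\boldsymbol\theta_t$. **Regret.** For a map $\pi:\mathcal S\to\mathcal B\times\mathcal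 A$, $\pi(\tilde s)=(b_\pi(\tilde s),\boldsymbol a_\pi(\tilde s))$, let $$\rho(\pi)=\sum_{\tilde s,\check s\in\mathcal S}\mu_S(\tilde s)P_S(\tilde s,\check s)\sum_{\boldsymbol\theta\in\boldsymbol\Theta_{b_\pi(\tilde s),\check s}}P_{\boldsymbol\Theta_{b_\pi(\tilde s),\check s}}(\boldsymbol\theta)\langle\boldsymbol a_\pi(\tilde s),\boldsymbol\theta\rangle ,$$ let $\pi^*$ maximize $\rho$, and let $R(T)=T\rho(\pi^* )-\sum_{t=1}^T r_t(b_t,\boldsymbol a_t)$. **Notation.** For a transition matrix $P_S$, distributions $P_{\boldsymbol\Theta_{b,s}}$ and $\tilde s\in\mathcal S$, $$\mathcal A^*(P_S,\{P_{\boldsymbol\Theta_{b,s}}\},\tilde s)=\arg\max_{(b,\boldsymbol a)\in\mathcal B\times\boldsymbol V}\ \sum_{\check s\in\mathcal S}P_S(\tilde s,\check s)\sum_{\boldsymbol\theta\in\boldsymbol\Theta_{b,\check s}}P_{\boldsymbol\Theta_{b,\check s}}(\boldsymbol\theta)\langle\boldsymbol a,\boldsymbol\theta\rangle$$ (the set of all maximizers). $T_M=\max_{\tilde s,\check s\in\mathcal S}E(T_{\tilde s,\check s})$, where $T_{\tilde s,\check s}$ is the passage time of first arriving at state $\check s$ when starting from $\tilde s$; $T_S=\big(\min\{P_S(\tilde s,\check s):\tilde s,\check s\in\mathcal S,\ P_S(\tilde s,\check s)>0\}\big)^{-1}$; $r_{\max}=\max\{\langle\boldsymbol a,\boldsymbol\theta\rangle-\langle\tilde{\boldsymbol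 a},\tilde{\boldsymbol\theta}\rangle:\boldsymbol a,\tilde{\boldsymbol a}\in\mathcal A,\ \boldsymbol\theta,\tilde{\boldsymbol\theta}\in\bigcup_{(b,s)}\boldsymbol\Theta_{b,s}\}$; $C_{\boldsymbol\Theta_{\max}}=\max_{b,s}|\boldsymbol\Theta_{b,s}|$. $B(\boldsymbol c,r)$ is the Euclidean ball in $\mathbb R^N$ with center $\boldsymbol c$ and radius $r$. **Algorithm 1** (parameters $\alpha>3$, $\epsilon>0$, $\alpha_\epsilon>1$). Let $\epsilon_t=\epsilon\big(10\,t^{\alpha_\epsilon}\max_{\boldsymbol\theta\in\bigcup_{b,s}\boldsymbol\Theta_{b,s}}\|\boldsymbol\theta\|_1\big)^{-1}$, $$\mathrm{conf}_S(t,s)=\min\Big\{1,\sqrt{\tfrac{\log(4(t-1)^\alpha|\mathcal S|^2)}{2N_t(s)}}\Big\},\quad \mathrm{conf}_{\boldsymbol\Theta}(t,b,s)=\min\Big\{1,\sqrt{\tfrac{\log(4(t-1)^\alpha|\boldsymbol\Theta_{b,s}||\mathcal B||\mathcal S|)}{2N_t(b,s)}}\Big\},$$ with value $1$ for $t\in\{0,1\}$ and when the count in the denominator is $0$. All counts $N_0$ are $0$, $\hat s_{-1}\in\mathcal S$ is arbitrary, $t=0$. The algorithm proceeds in rounds $k=0,1,\dots$. *Start of round $k$:* set $t_k=t$. Set $\hat P_{t_k}(\tilde s,\check s)=N_{t_k}(\tilde s,\check s)/N_{t_k}(\tilde s)$ if $N_{t_k}(\tilde s)>0$, else $|\mathcal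 S|^{-1}$; set $\hat P_{t_k,\boldsymbol\Theta_{b,s}}(\boldsymbol\theta)=N_{t_k}(b,s,\boldsymbol\theta)/N_{t_k}(b,s)$ if $N_{t_k}(b,s)>0$, else $|\boldsymbol\Theta_{b,s}|^{-1}$. For every $\tilde s\in\mathcal S$ let $(b^*_{t_k}(\tilde s),\boldsymbol a^*_{t_k}(\tilde s))$ be the $(b,\boldsymbol a)$-part of a maximizer of $\sum_{\check s}\hat P_{t_k}(\tilde s,\check s)\sum_{\boldsymbol\theta\in\boldsymbol\Theta_{b,\check s}}\tilde P_{\boldsymbol\Theta_{b,\check s}}(\boldsymbol\theta)\langle\boldsymbol a,\boldsymbol\theta\rangle$ over $b\in\mathcal B$, $\boldsymbol a\in\mathcal A$ and all families of probability distributions $\tilde P_{\boldsymbol\Theta_{b,\check s}}$ on $\boldsymbol\Theta_{b,\check s}$ with $|\tilde P_{\boldsymbol\Theta_{b,\check s}}(\boldsymbol\theta)-\hat P_{t_k,\boldsymbol\Theta_{b,\check s}}(\boldsymbol\theta)|\le\mathrm{conf}_{\boldsymbol\Theta}(t_k,b,\check s)$ for all $b,\check s,\boldsymbol\theta$. *Execution of round $k$:* while $\mathrm{conf}_S(t,s)>\mathrm{conf}_S(t_k,s)/2$ for every $s$ and $\mathrm{conf}_{\boldsymbol\Theta}(t,b,s)>\mathrm{conf}_{\boldsymbol\Theta}(t_k,b,s)/2$ for every $(b,s)$: play $b_t=b^*_{t_k}(\hat s_{t-1})$ and $\boldsymbol a_t$ chosen uniformly at random from $B(\boldsymbol a^*_{t_k}(\hat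 s_{t-1}),\epsilon_t)\cap\mathcal A$; observe $r_t$; let $\hat{\boldsymbol\theta}_t\in\bigcup_s\boldsymbol\Theta_{b_t,s}$ solve $r_t=\langle\boldsymbol a_t,\hat{\boldsymbol\theta}_t\rangle$ and let $\hat s_t$ be the state with $\hat{\boldsymbol\theta}_t\in\boldsymbol\Theta_{b_t,\hat s_t}$; if $t\ge1$, increase by one each of the counts $N(\hat s_{t-1})$, $N(\hat s_{t-1},\hat s_t)$, $N(b_t,\hat s_t)$, $N(b_t,\hat s_t,\hat{\boldsymbol\theta}_t)$, giving the counts $N_{t+1}$ (at $t=0$ counts are unchanged); set $t\leftarrow t+1$. When the while-condition fails the next round starts. *)

theory Defs
  imports "HOL-Probability.Probability"
begin

section \<open>Finite Markov chains\<close>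

text \<open>A transition matrix on a finite state set is a kernel \<open>P :: 's \<Rightarrow> 's pmf\<close>;
  \<open>path_pmf P n s\<close> is the joint law of the next \<open>n\<close> states of the chain started in \<open>s\<close>.\<close>

primrec path_pmf :: "('s \<Rightarrow> 's pmf) \<Rightarrow> nat \<Rightarrow> 's \<Rightarrow> 's list pmf" where
  "path_pmf P 0 s = return_pmf []"
| "path_pmf P (Suc n) s = bind_pmf (P s) (\<lambda>y. map_pmf (\<lambda>ys. y # ys) (path_pmf P n y))"

primrec nstep_pmf :: "('s \<Rightarrow> 's pmf) \<Rightarrow> nat \<Rightarrow> 's \<Rightarrow> 's pmf" where
  "nstep_pmf P 0 s = return_pmf s"
| "nstep_pmf P (Suc n) s = bind_pmf (P s) (nstep_pmf P n)"

definition transition_matrix_on :: "'s set \<Rightarrow> ('s \<Rightarrow> 's pmf) \<Rightarrow> bool" where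
  "transition_matrix_on S P \<longleftrightarrow> (\<forall>s\<in>S. set_pmf (P s) \<subseteq> S)"

definition irreducible_on :: "'s set \<Rightarrow> ('s \<Rightarrow> 's pmf) \<Rightarrow> bool" where
  "irreducible_on S P \<longleftrightarrow> (\<forall>s\<in>S. \<forall>s'\<in>S. \<exists>n. pmf (nstep_pmf P n s) s' > 0)"

definition aperiodic_on :: "'s set \<Rightarrow> ('s \<Rightarrow> 's pmf) \<Rightarrow> bool" where
  "aperiodic_on S P \<longleftrightarrow> (\<forall>s\<in>S. Gcd {n. n > 0 \<and> pmf (nstep_pmf P n s) s > 0} = 1)"

definition stationary_on :: "'s set \<Rightarrow> ('s \<Rightarrow> 's pmf) \<Rightarrow> 's pmf \<Rightarrow> bool" where
  "stationary_on S P \<mu> \<longleftrightarrow>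
     set_pmf \<mu> \<subseteq> S \<and> (\<forall>s'\<in>S. pmf \<mu> s' = (\<Sum>s\<in>S. pmf \<mu> s * pmf (P s) s'))"

text \<open>The passage time from \<open>s\<close> to \<open>s'\<close> is the least \<open>n \<ge> 1\<close> with the chain in \<open>s'\<close> at time
  \<open>n\<close>; for \<open>s = s'\<close> it is the return time. The series below converges for an irreducible chain on
  a finite set.\<close>

definition passage_time_prob :: "('s \<Rightarrow> 's pmf) \<Rightarrow> 's \<Rightarrow> 's \<Rightarrow> nat \<Rightarrow> real" where
  "passage_time_prob P s s' n =
     measure_pmf.prob (path_pmf P n s) {ys. ys \<noteq> [] \<and> last ys = s' \<and> s' \<notin> set (butlast ys)}"

definition expected_passage_time :: "('s \<Rightarrow> 's pmf) \<Rightarrow> 's \<Rightarrow> 's \<Rightarrow> real" where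
  "expected_passage_time P s s' = (\<Sum>n. real n * passage_time_prob P s s' n)"

definition T_M :: "'s set \<Rightarrow> ('s \<Rightarrow> 's pmf) \<Rightarrow> real" where
  "T_M S P = Max {expected_passage_time P s s' | s s'. s \<in> S \<and> s' \<in> S}"

definition T_S :: "'s set \<Rightarrow> ('s \<Rightarrow> 's pmf) \<Rightarrow> real" where
  "T_S S P = inverse (Min {pmf (P s) s' | s s'. s \<in> S \<and> s' \<in> S \<and> pmf (P s) s' > 0})"


section \<open>Rewards, policies and regret\<close>

definition expected_reward ::
  "'s set \<Rightarrow> ('b \<Rightarrow> 's \<Rightarrow> (real^'n) set) \<Rightarrow> ('s \<Rightarrow> 's \<Rightarrow> real) \<Rightarrow> ('b \<Rightarrow> 's \<Rightarrow> real^'n \<Rightarrow> real)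
     \<Rightarrow> 's \<Rightarrow> 'b \<Rightarrow> real^'n \<Rightarrow> real" where
  "expected_reward S \<Theta> P Q s b a =
     (\<Sum>s'\<in>S. P s s' * (\<Sum>x\<in>\<Theta> b s'. Q b s' x * (a \<bullet> x)))"

definition policy_value ::
  "'s set \<Rightarrow> ('b \<Rightarrow> 's \<Rightarrow> (real^'n) set) \<Rightarrow> ('s \<Rightarrow> 's pmf) \<Rightarrow> ('b \<Rightarrow> 's \<Rightarrow> (real^'n) pmf)
     \<Rightarrow> 's pmf \<Rightarrow> ('s \<Rightarrow> 'b \<times> (real^'n)) \<Rightarrow> real" where
  "policy_value S \<Theta> P Q \<mu> \<pi> =
     (\<Sum>s\<in>S. pmf \<mu> s *
        expected_reward S \<Theta> (\<lambda>s. pmf (P s)) (\<lambda>b s. pmf (Q b s)) s (fst (\<pi> s)) (snd (\<pi> s)))"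

definition optimal_policy ::
  "'s set \<Rightarrow> 'b set \<Rightarrow> (real^'n) set \<Rightarrow> ('b \<Rightarrow> 's \<Rightarrow> (real^'n) set) \<Rightarrow> ('s \<Rightarrow> 's pmf)
     \<Rightarrow> ('b \<Rightarrow> 's \<Rightarrow> (real^'n) pmf) \<Rightarrow> 's pmf \<Rightarrow> ('s \<Rightarrow> 'b \<times> (real^'n)) \<Rightarrow> bool" where
  "optimal_policy S B A \<Theta> P Q \<mu> \<pi> \<longleftrightarrow>
     \<pi> \<in> S \<rightarrow> B \<times> A \<and>
     (\<forall>\<pi>' \<in> S \<rightarrow> B \<times> A. policy_value S \<Theta> P Q \<mu> \<pi>' \<le> policy_value S \<Theta> P Q \<mu> \<pi>)"

definition regret ::
  "real \<Rightarrow> (nat \<Rightarrow> 'w \<Rightarrow> real^'n) \<Rightarrow> (nat \<Rightarrow> 'w \<Rightarrow> real^'n) \<Rightarrow> nat \<Rightarrow> 'w \<Rightarrow> real" where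
  "regret \<rho>_opt act par T \<omega> = real T * \<rho>_opt - (\<Sum>t=1..T. act t \<omega> \<bullet> par t \<omega>)"

definition params :: "'s set \<Rightarrow> 'b set \<Rightarrow> ('b \<Rightarrow> 's \<Rightarrow> 'v set) \<Rightarrow> 'v set" where
  "params S B \<Theta> = (\<Union>b\<in>B. \<Union>s\<in>S. \<Theta> b s)"

definition r_max ::
  "'s set \<Rightarrow> 'b set \<Rightarrow> (real^'n) set \<Rightarrow> ('b \<Rightarrow> 's \<Rightarrow> (real^'n) set) \<Rightarrow> real" where
  "r_max S B A \<Theta> =
     Sup {a \<bullet> x - a' \<bullet> x' | a a' x x'.
            a \<in> A \<and> a' \<in> A \<and> x \<in> params S B \<Theta> \<and> x' \<in> params S B \<Theta>}"

definition C_\<Theta> :: "'s set \<Rightarrow> 'b set \<Rightarrow> ('b \<Rightarrow> 's \<Rightarrow> 'v set) \<Rightarrow> nat" where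
  "C_\<Theta> S B \<Theta> = Max {card (\<Theta> b s) | b s. b \<in> B \<and> s \<in> S}"

definition norm1 :: "real^'n \<Rightarrow> real" where
  "norm1 x = (\<Sum>i\<in>UNIV. \<bar>x $ i\<bar>)"

definition optimal_pairs ::
  "'s set \<Rightarrow> 'b set \<Rightarrow> (real^'n) set \<Rightarrow> ('b \<Rightarrow> 's \<Rightarrow> (real^'n) set) \<Rightarrow> ('s \<Rightarrow> 's pmf)
     \<Rightarrow> ('b \<Rightarrow> 's \<Rightarrow> (real^'n) pmf) \<Rightarrow> 's \<Rightarrow> ('b \<times> (real^'n)) set" where
  "optimal_pairs S B A \<Theta> P Q s =
     {p. is_arg_max
           (\<lambda>(b, a). expected_reward S \<Theta> (\<lambda>s. pmf (P s)) (\<lambda>b s. pmf (Q b s)) s b a)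
           (\<lambda>p. p \<in> B \<times> {v. v extreme_point_of A}) p}"

definition optimal_pairs_stable ::
  "'s set \<Rightarrow> 'b set \<Rightarrow> (real^'n) set \<Rightarrow> ('b \<Rightarrow> 's \<Rightarrow> (real^'n) set) \<Rightarrow> ('s \<Rightarrow> 's pmf)
     \<Rightarrow> ('b \<Rightarrow> 's \<Rightarrow> (real^'n) pmf) \<Rightarrow> real \<Rightarrow> bool" where
  "optimal_pairs_stable S B A \<Theta> P Q \<delta> \<longleftrightarrow>
     (\<forall>P' Q'.
        transition_matrix_on S P' \<and> (\<forall>b\<in>B. \<forall>s\<in>S. set_pmf (Q' b s) \<subseteq> \<Theta> b s) \<and>
        (\<forall>s\<in>S. \<forall>s'\<in>S. \<bar>pmf (P' s) s' - pmf (P s) s'\<bar> \<le> \<delta>) \<and>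
        (\<forall>b\<in>B. \<forall>s\<in>S. \<forall>x\<in>\<Theta> b s. \<bar>pmf (Q' b s) x - pmf (Q b s) x\<bar> \<le> \<delta>)
        \<longrightarrow> (\<forall>s\<in>S. optimal_pairs S B A \<Theta> P' Q' s = optimal_pairs S B A \<Theta> P Q s))"

text \<open>The largest admissible \<open>\<delta>\<close> is read as a supremum: when a further pair becomes optimal at
  distance exactly \<open>\<delta>\<^sub>0\<close>, the admissible \<open>\<delta>\<close> form the half-open interval \<open>[0, \<delta>\<^sub>0)\<close>. Probabilities
  never differ by more than \<open>1\<close>, so all \<open>\<delta> \<ge> 1\<close> are admissible as soon as \<open>1\<close> is, hence the cap.
  Since \<open>0\<close> is always admissible, the supremum is positive exactly if some \<open>\<delta> > 0\<close> is
  admissible.\<close>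

definition stability_radius ::
  "'s set \<Rightarrow> 'b set \<Rightarrow> (real^'n) set \<Rightarrow> ('b \<Rightarrow> 's \<Rightarrow> (real^'n) set) \<Rightarrow> ('s \<Rightarrow> 's pmf)
     \<Rightarrow> ('b \<Rightarrow> 's \<Rightarrow> (real^'n) pmf) \<Rightarrow> real" where
  "stability_radius S B A \<Theta> P Q = Sup {\<delta>. 0 \<le> \<delta> \<and> \<delta> \<le> 1 \<and> optimal_pairs_stable S B A \<Theta> P Q \<delta>}"


section \<open>The model\<close>

locale restless_bandit =
  fixes S :: "'s set" and B :: "'b set" and A :: "(real^'n) set"
    and \<Theta> :: "'b \<Rightarrow> 's \<Rightarrow> (real^'n) set"
    and P :: "'s \<Rightarrow> 's pmf"
    and Q :: "'b \<Rightarrow> 's \<Rightarrow> (real^'n) pmf"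
    and \<mu> :: "'s pmf"
  assumes states: "finite S" "S \<noteq> {}"
    and arms: "finite B" "B \<noteq> {}"
    and actions: "polytope A" "aff_dim A = int CARD('n)"
    and finite_params: "\<And>b s. b \<in> B \<Longrightarrow> s \<in> S \<Longrightarrow> finite (\<Theta> b s)"
    and param_law: "\<And>b s. b \<in> B \<Longrightarrow> s \<in> S \<Longrightarrow> set_pmf (Q b s) \<subseteq> \<Theta> b s"
    and disjoint_params: "\<And>b s s'. b \<in> B \<Longrightarrow> s \<in> S \<Longrightarrow> s' \<in> S \<Longrightarrow> s \<noteq> s' \<Longrightarrow> \<Theta> b s \<inter> \<Theta> b s' = {}"
    and transition: "transition_matrix_on S P"
    and irreducible: "irreducible_on S P"
    and aperiodic: "aperiodic_on S P"
    and stationary: "stationary_on S P \<mu>"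


section \<open>Counts and confidence radii\<close>

text \<open>The counts \<open>N\<^sub>t\<close> as functions of the sequences of estimated states \<open>sh\<close>, played arms \<open>arm\<close> and
  estimated parameters \<open>xh\<close>. Time \<open>0\<close> does not contribute, so that \<open>u - 1\<close> is never truncated.\<close>

definition count_S :: "(nat \<Rightarrow> 's) \<Rightarrow> nat \<Rightarrow> 's \<Rightarrow> nat" where
  "count_S sh t s = card {u \<in> {1..<t}. sh (u - 1) = s}"

definition count_SS :: "(nat \<Rightarrow> 's) \<Rightarrow> nat \<Rightarrow> 's \<Rightarrow> 's \<Rightarrow> nat" where
  "count_SS sh t s s' = card {u \<in> {1..<t}. sh (u - 1) = s \<and> sh u = s'}"

definition count_BS :: "(nat \<Rightarrow> 'b) \<Rightarrow> (nat \<Rightarrow> 's) \<Rightarrow> nat \<Rightarrow> 'b \<Rightarrow> 's \<Rightarrow> nat" where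
  "count_BS arm sh t b s = card {u \<in> {1..<t}. arm u = b \<and> sh u = s}"

definition count_BSX ::
  "(nat \<Rightarrow> 'b) \<Rightarrow> (nat \<Rightarrow> 's) \<Rightarrow> (nat \<Rightarrow> 'v) \<Rightarrow> nat \<Rightarrow> 'b \<Rightarrow> 's \<Rightarrow> 'v \<Rightarrow> nat" where
  "count_BSX arm sh xh t b s x = card {u \<in> {1..<t}. arm u = b \<and> sh u = s \<and> xh u = x}"

definition conf_S :: "real \<Rightarrow> 's set \<Rightarrow> (nat \<Rightarrow> 's) \<Rightarrow> nat \<Rightarrow> 's \<Rightarrow> real" where
  "conf_S \<alpha> S sh t s =
     (if t \<le> 1 \<or> count_S sh t s = 0 then 1
      else min 1 (sqrt (ln (4 * real (t - 1) powr \<alpha> * (real (card S))\<^sup>2)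
                        / (2 * real (count_S sh t s)))))"

definition conf_\<Theta> ::
  "real \<Rightarrow> 's set \<Rightarrow> 'b set \<Rightarrow> ('b \<Rightarrow> 's \<Rightarrow> 'v set) \<Rightarrow> (nat \<Rightarrow> 'b) \<Rightarrow> (nat \<Rightarrow> 's)
     \<Rightarrow> nat \<Rightarrow> 'b \<Rightarrow> 's \<Rightarrow> real" where
  "conf_\<Theta> \<alpha> S B \<Theta> arm sh t b s =
     (if t \<le> 1 \<or> count_BS arm sh t b s = 0 then 1
      else min 1 (sqrt (ln (4 * real (t - 1) powr \<alpha> * real (card (\<Theta> b s))
                              * real (card B) * real (card S))
                        / (2 * real (count_BS arm sh t b s)))))"

definition est_P :: "'s set \<Rightarrow> (nat \<Rightarrow> 's) \<Rightarrow> nat \<Rightarrow> 's \<Rightarrow> 's \<Rightarrow> real" where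
  "est_P S sh t s s' =
     (if count_S sh t s > 0 then real (count_SS sh t s s') / real (count_S sh t s)
      else 1 / real (card S))"

definition est_Q ::
  "('b \<Rightarrow> 's \<Rightarrow> 'v set) \<Rightarrow> (nat \<Rightarrow> 'b) \<Rightarrow> (nat \<Rightarrow> 's) \<Rightarrow> (nat \<Rightarrow> 'v)
     \<Rightarrow> nat \<Rightarrow> 'b \<Rightarrow> 's \<Rightarrow> 'v \<Rightarrow> real" where
  "est_Q \<Theta> arm sh xh t b s x =
     (if count_BS arm sh t b s > 0
      then real (count_BSX arm sh xh t b s x) / real (count_BS arm sh t b s)
      else 1 / real (card (\<Theta> b s)))"


section \<open>The algorithm\<close>

definition plausible ::
  "real \<Rightarrow> 's set \<Rightarrow> 'b set \<Rightarrow> ('b \<Rightarrow> 's \<Rightarrow> 'v set) \<Rightarrow> (nat \<Rightarrow> 'b) \<Rightarrow> (nat \<Rightarrow> 's) \<Rightarrow> (nat \<Rightarrow> 'v)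
     \<Rightarrow> nat \<Rightarrow> ('b \<Rightarrow> 's \<Rightarrow> 'v pmf) \<Rightarrow> bool" where
  "plausible \<alpha> S B \<Theta> arm sh xh t Q' \<longleftrightarrow>
     (\<forall>b\<in>B. \<forall>s\<in>S. set_pmf (Q' b s) \<subseteq> \<Theta> b s \<and>
        (\<forall>x\<in>\<Theta> b s. \<bar>pmf (Q' b s) x - est_Q \<Theta> arm sh xh t b s x\<bar> \<le> conf_\<Theta> \<alpha> S B \<Theta> arm sh t b s))"

text \<open>\<open>optimistic_choice \<dots> t s (b, a)\<close>: at a round starting at time \<open>t\<close>, the pair \<open>(b, a)\<close> is the
  arm-action part of some joint maximiser over arms, actions and plausible parameter laws.\<close>

definition optimistic_choice ::
  "real \<Rightarrow> 's set \<Rightarrow> 'b set \<Rightarrow> (real^'n) set \<Rightarrow> ('b \<Rightarrow> 's \<Rightarrow> (real^'n) set)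
     \<Rightarrow> (nat \<Rightarrow> 'b) \<Rightarrow> (nat \<Rightarrow> 's) \<Rightarrow> (nat \<Rightarrow> real^'n) \<Rightarrow> nat \<Rightarrow> 's \<Rightarrow> 'b \<times> (real^'n) \<Rightarrow> bool" where
  "optimistic_choice \<alpha> S B A \<Theta> arm sh xh t s p \<longleftrightarrow>
     (\<exists>Q'. is_arg_max
             (\<lambda>(b, a, Q'). expected_reward S \<Theta> (est_P S sh t) (\<lambda>b s. pmf (Q' b s)) s b a)
             (\<lambda>(b, a, Q'). b \<in> B \<and> a \<in> A \<and> plausible \<alpha> S B \<Theta> arm sh xh t Q')
             (fst p, snd p, Q'))"

definition round_continues ::
  "real \<Rightarrow> 's set \<Rightarrow> 'b set \<Rightarrow> ('b \<Rightarrow> 's \<Rightarrow> 'v set) \<Rightarrow> (nat \<Rightarrow> 'b) \<Rightarrow> (nat \<Rightarrow> 's)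
     \<Rightarrow> nat \<Rightarrow> nat \<Rightarrow> bool" where
  "round_continues \<alpha> S B \<Theta> arm sh t\<^sub>k t \<longleftrightarrow>
     (\<forall>s\<in>S. conf_S \<alpha> S sh t s > conf_S \<alpha> S sh t\<^sub>k s / 2) \<and>
     (\<forall>b\<in>B. \<forall>s\<in>S. conf_\<Theta> \<alpha> S B \<Theta> arm sh t b s > conf_\<Theta> \<alpha> S B \<Theta> arm sh t\<^sub>k b s / 2)"

text \<open>The starting time \<open>t\<^sub>k\<close> of the round to which time \<open>t\<close> belongs. Confidence radii are positive,
  so every round lasts for at least one time step.\<close>

primrec round_start ::
  "real \<Rightarrow> 's set \<Rightarrow> 'b set \<Rightarrow> ('b \<Rightarrow> 's \<Rightarrow> 'v set) \<Rightarrow> (nat \<Rightarrow> 'b) \<Rightarrow> (nat \<Rightarrow> 's) \<Rightarrow> nat \<Rightarrow> nat" where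
  "round_start \<alpha> S B \<Theta> arm sh 0 = 0"
| "round_start \<alpha> S B \<Theta> arm sh (Suc t) =
     (if round_continues \<alpha> S B \<Theta> arm sh (round_start \<alpha> S B \<Theta> arm sh t) (Suc t)
      then round_start \<alpha> S B \<Theta> arm sh t else Suc t)"

text \<open>The exploration radius is extended-real valued: it is infinite at \<open>t = 0\<close> (and if all
  parameters vanish), in which case the action is uniform on all of \<open>A\<close>.\<close>

definition explore_radius ::
  "real \<Rightarrow> real \<Rightarrow> 's set \<Rightarrow> 'b set \<Rightarrow> ('b \<Rightarrow> 's \<Rightarrow> (real^'n) set) \<Rightarrow> nat \<Rightarrow> ereal" where
  "explore_radius \<epsilon> \<alpha>\<^sub>\<epsilon> S B \<Theta> t =
     ereal \<epsilon> / ereal (10 * real t powr \<alpha>\<^sub>\<epsilon> * Max (norm1 ` params S B \<Theta>))"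

definition explore_region ::
  "real \<Rightarrow> real \<Rightarrow> 's set \<Rightarrow> 'b set \<Rightarrow> (real^'n) set \<Rightarrow> ('b \<Rightarrow> 's \<Rightarrow> (real^'n) set)
     \<Rightarrow> nat \<Rightarrow> real^'n \<Rightarrow> (real^'n) set" where
  "explore_region \<epsilon> \<alpha>\<^sub>\<epsilon> S B A \<Theta> t c =
     {a \<in> A. ereal (dist c a) \<le> explore_radius \<epsilon> \<alpha>\<^sub>\<epsilon> S B \<Theta> t}"

text \<open>A run of the algorithm against the bandit. \<open>F t\<close> is the information generated strictly
  before the step at time \<open>t\<close>; \<open>st\<close>, \<open>par\<close>, \<open>arm\<close>, \<open>act\<close> are the hidden states, hidden parameters,
  arms and actions; \<open>xh\<close>, \<open>sh\<close> are the estimated parameters and states, and \<open>sh_init\<close> is the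
  estimate at time \<open>-1\<close>. If \<open>t\<close> starts a round, \<open>pol t\<close> is the map chosen at its start. The choice
  among several maximisers, or among several solutions of the reward equation, is left open.

  \<open>step_law\<close> is the conditional law given \<open>F t\<close> of action, state and parameter at time \<open>t\<close>: the
  action is uniform on the exploration region, the state makes a transition independently of it,
  and the parameter has the law attached to the arm played and the new state.\<close>

locale algorithm_run = restless_bandit S B A \<Theta> P Q \<mu> + prob_space M
  for S :: "'s set" and B :: "'b set" and A :: "(real^'n) set"
    and \<Theta> :: "'b \<Rightarrow> 's \<Rightarrow> (real^'n) set"
    and P :: "'s \<Rightarrow> 's pmf"
    and Q :: "'b \<Rightarrow> 's \<Rightarrow> (real^'n) pmf"
    and \<mu> :: "'s pmf"
    and M :: "'w measure" +
  fixes \<alpha> \<epsilon> \<alpha>\<^sub>\<epsilon> :: real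
    and init :: "'s pmf" and sh_init :: 's
    and F :: "nat \<Rightarrow> 'w measure"
    and st :: "nat \<Rightarrow> 'w \<Rightarrow> 's" and par :: "nat \<Rightarrow> 'w \<Rightarrow> real^'n"
    and arm :: "nat \<Rightarrow> 'w \<Rightarrow> 'b" and act :: "nat \<Rightarrow> 'w \<Rightarrow> real^'n"
    and sh :: "nat \<Rightarrow> 'w \<Rightarrow> 's" and xh :: "nat \<Rightarrow> 'w \<Rightarrow> real^'n"
    and pol :: "nat \<Rightarrow> 'w \<Rightarrow> 's \<Rightarrow> 'b \<times> (real^'n)"
  assumes init: "set_pmf init \<subseteq> S" "sh_init \<in> S"
    and filtration: "\<And>t. subalgebra M (F t)" "\<And>t. subalgebra (F (Suc t)) (F t)"
    and adapted:
      "\<And>t. st t \<in> F (Suc t) \<rightarrow>\<^sub>M count_space S"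
      "\<And>t. par t \<in> F (Suc t) \<rightarrow>\<^sub>M borel"
      "\<And>t. act t \<in> F (Suc t) \<rightarrow>\<^sub>M borel"
      "\<And>t. sh t \<in> F (Suc t) \<rightarrow>\<^sub>M count_space S"
      "\<And>t. xh t \<in> F (Suc t) \<rightarrow>\<^sub>M borel"
      "\<And>t s. s \<in> S \<Longrightarrow> (\<lambda>\<omega>. pol t \<omega> s) \<in> F t \<rightarrow>\<^sub>M count_space B \<Otimes>\<^sub>M borel"
    and policy_choice:
      "AE \<omega> in M. \<forall>t. round_start \<alpha> S B \<Theta> (\<lambda>u. arm u \<omega>) (\<lambda>u. sh u \<omega>) t = t \<longrightarrow>
         (\<forall>s\<in>S. optimistic_choice \<alpha> S B A \<Theta> (\<lambda>u. arm u \<omega>) (\<lambda>u. sh u \<omega>) (\<lambda>u. xh u \<omega>) t s (pol t \<omega> s))"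
    and arm_choice:
      "\<And>t \<omega>. \<omega> \<in> space M \<Longrightarrow>
         arm t \<omega> = fst (pol (round_start \<alpha> S B \<Theta> (\<lambda>u. arm u \<omega>) (\<lambda>u. sh u \<omega>) t) \<omega>
                           (if t = 0 then sh_init else sh (t - 1) \<omega>))"
    and step_law:
      "\<And>t H X s x. H \<in> sets (F t) \<Longrightarrow> X \<in> sets borel \<Longrightarrow> s \<in> S \<Longrightarrow> x \<in> params S B \<Theta> \<Longrightarrow>
         measure M {\<omega> \<in> H. act t \<omega> \<in> X \<and> st t \<omega> = s \<and> par t \<omega> = x} =
         (LINT \<omega>:H|M.
            measure (uniform_measure lborel (explore_region \<epsilon> \<alpha>\<^sub>\<epsilon> S B A \<Theta> t
              (snd (pol (round_start \<alpha> S B \<Theta> (\<lambda>u. arm u \<omega>) (\<lambda>u. sh u \<omega>) t) \<omega>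
                        (if t = 0 then sh_init else sh (t - 1) \<omega>))))) X
            * pmf (if t = 0 then init else P (st (t - 1) \<omega>)) s
            * pmf (Q (arm t \<omega>) s) x)"
    and estimates:
      "AE \<omega> in M. \<forall>t. act t \<omega> \<bullet> par t \<omega> = act t \<omega> \<bullet> xh t \<omega> \<and> xh t \<omega> \<in> \<Theta> (arm t \<omega>) (sh t \<omega>)"

end

theory Submission
  imports Defs
begin

text \<open>Only finitely much regret in expectation is lost to causes other than poorly estimated parameter
  laws: the exploration radii are summable, the deviation of the chain from stationarity telescopes by the
  Poisson equation, and the rounds started with an estimate outside its confidence bound have summable
  expected length, because failures at time \<open>u\<close> have probability \<open>O(u\<^bsup>1-\<alpha>\<^esup>)\<close>, \<open>\<alpha> > 3\<close>,
  while a round started at \<open>u\<close> ends before \<open>O(u\<^bsup>1+\<eta>\<^esup>)\<close> for every \<open>\<eta> > 0\<close>. In all other rounds optimism makes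
  the chosen pair optimal, unless a confidence radius at \<open>(b, s')\<close> exceeds a quarter of the stability radius for
  the arm \<open>b\<close> played and some possible next state \<open>s'\<close>. Then \<open>(b, s')\<close> has been
  observed only \<open>O(ln T / \<Delta>\<^sup>2)\<close> times, and each such step observes it with probability at least
  \<open>1 / T_S\<close>; this gives the logarithmic term. Since the bound is asymptotic in \<open>T\<close>, the logarithmic term absorbs the constants, and \<open>T_M\<close> enters only through
  \<open>T_M \<ge> 1\<close>.\<close>

section \<open>Concentration for adapted trials\<close>

text \<open>The obstacle is that neither states nor parameters are observed. It disappears almost
  surely: the action is uniform on a set of positive volume, the actions that give two distinct
  parameters the same reward lie on a hyperplane, and the sets \<Theta> b s are disjoint in s, so
  parameter and state can be read off the reward. What remains random is which laws the arm choices
  sample; hence all concentration is done for adapted trials. The policy is frozen during a round,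
  so one bad estimate at its start can spoil the whole round; this is why failures are weighted by
  round length. Origin of 33: the stability radius \<Delta> is a supremum, so the argument works
  with \<delta> = \<Delta>/2. Two laws within a radius of the same estimate differ by at most twice
  that radius, which therefore should be at most \<delta>/2 = \<Delta>/4. A radius above \<Delta>/4
  at the start of a round is above \<Delta>/8 throughout it, which limits the count to 32
  ln(..)/\<Delta>^2. One more unit absorbs all constants that depend on the model.\<close>

lemma bernoulli_exp_moment_le:
  fixes q l :: real
  assumes "0 \<le> q" "q \<le> 1"
  shows "q * exp (l * (1 - q)) + (1 - q) * exp (- l * q) \<le> exp (l\<^sup>2 / 8)"
proof -
  have *: "p * exp (h * (1 - p)) + (1 - p) * exp (- h * p) \<le> exp (h\<^sup>2 / 8)"
    if p: "0 \<le> p" "p \<le> 1" and h: "h \<ge> 0" for p h :: real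
  proof -
    have "1 + p * (exp h - 1) > 0"
      using p h by (intro add_pos_nonneg mult_nonneg_nonneg) auto
    hence pos: "1 - p + p * exp h > 0" by (simp add: algebra_simps)
    have "- h * p + ln (1 - p + p * exp h) \<le> h\<^sup>2 / 8"
      using Hoeffdings_lemma_aux[OF h p(1)] by (simp add: algebra_simps)
    hence "exp (- h * p + ln (1 - p + p * exp h)) \<le> exp (h\<^sup>2 / 8)" by simp
    also have "exp (- h * p + ln (1 - p + p * exp h)) = exp (- h * p) * (1 - p + p * exp h)"
      using pos by (subst exp_add) simp
    also have "\<dots> = p * exp (h * (1 - p)) + (1 - p) * exp (- h * p)"
      by (simp add: algebra_simps flip: exp_add)
    finally show ?thesis .
  qed
  show ?thesis
  proof (cases "l \<ge> 0")
    case True then show ?thesis using *[OF assms] by simp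
  next
    case False
    \<comment> \<open>For negative \<open>l\<close>, exchange success and failure.\<close>
    then show ?thesis using *[of "1 - q" "- l"] assms by (simp add: algebra_simps)
  qed
qed

lemma measurable_card_Collect:
  assumes "finite I" "\<And>u. u \<in> I \<Longrightarrow> Measurable.pred F (V u)"
  shows "(\<lambda>w. card {u \<in> I. V u w}) \<in> F \<rightarrow>\<^sub>M count_space UNIV"
  using assms
proof (induction I rule: finite_induct)
  case (insert i I)
  have [measurable]: "Measurable.pred F (V i)"
    "(\<lambda>w. card {u \<in> I. V u w}) \<in> F \<rightarrow>\<^sub>M count_space UNIV"
    using insert by auto
  have "{u \<in> insert i I. V u w} = (if V i w then insert i {u \<in> I. V u w} else {u \<in> I. V u w})" for w
    by auto
  hence "card {u \<in> insert i I. V u w} = (if V i w then Suc (card {u \<in> I. V u w}) else card {u \<in> I. V u w})" for w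
    using insert.hyps by simp
  then show ?case by simp
qed simp

lemma card_Collect_upt_Suc:
  assumes "t \<ge> 1"
  shows "card {u \<in> {1..<Suc t}. V u} = card {u \<in> {1..<t}. V u} + of_bool (V t)"
proof -
  have "{u \<in> {1..<Suc t}. V u} = {u \<in> {1..<t}. V u} \<union> (if V t then {t} else {})"
    using assms by (auto simp: less_Suc_eq)
  then show ?thesis by auto
qed

lemma (in prob_space) set_integral_of_bool:
  assumes [measurable]: "H \<in> sets M" "Measurable.pred M R"
  shows "(LINT w:H|M. of_bool (R w)) = prob {w \<in> H. R w}"
proof -
  have "(LINT w:H|M. of_bool (R w)) = expectation (indicator {w \<in> H. R w})"
    unfolding set_lebesgue_integral_def by (rule Bochner_Integration.integral_cong) (auto simp: indicator_def)
  also have "\<dots> = prob ({w \<in> H. R w} \<inter> space M)" by (rule Bochner_Integration.integral_indicator)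
  also have "{w \<in> H. R w} \<inter> space M = {w \<in> H. R w}" using sets.sets_into_space[OF assms(1)] by blast
  finally show ?thesis .
qed

text \<open>Equal integrals over all sets of \<open>F\<close> mean equal conditional expectations,
  from which a bounded \<open>F\<close>-measurable weight can be pulled out. Step laws are given on
  events of the past; this turns them into identities with past-dependent weights.\<close>

lemma (in prob_space) expectation_mult_eq_of_set_integral_eq:
  fixes f g Z :: "'a \<Rightarrow> real"
  assumes F: "subalgebra M F"
    and f: "integrable M f" and g: "integrable M g"
    and eq: "\<And>H. H \<in> sets F \<Longrightarrow> (LINT w:H|M. f w) = (LINT w:H|M. g w)"
    and Z: "Z \<in> borel_measurable F" and bd: "AE w in M. \<bar>Z w\<bar> \<le> c"
  shows "expectation (\<lambda>w. Z w * f w) = expectation (\<lambda>w. Z w * g w)"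
proof -
  interpret finite_measure_subalgebra M F by unfold_locales (rule F)
  have ZM: "Z \<in> borel_measurable M" by (rule measurable_from_subalg[OF F Z])
  have intZ: "integrable M (\<lambda>w. Z w * h w)" if "integrable M h" for h :: "'a \<Rightarrow> real"
  proof (rule Bochner_Integration.integrable_bound)
    show "integrable M (\<lambda>w. c * h w)" using that by simp
    show "(\<lambda>w. Z w * h w) \<in> borel_measurable M" using ZM that by measurable
    show "AE w in M. norm (Z w * h w) \<le> norm (c * h w)"
      using bd by eventually_elim (auto simp: abs_mult intro!: mult_right_mono)
  qed
  have "AE w in M. real_cond_exp M F f w = real_cond_exp M F g w"
  proof (rule real_cond_exp_charact)
    fix H assume H: "H \<in> sets F"
    then show "(LINT w:H|M. f w) = (LINT w:H|M. real_cond_exp M F g w)"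
      using eq[OF H] real_cond_exp_intA[OF g H] by simp
  qed (use f real_cond_exp_int(1)[OF g] in auto)
  hence "expectation (\<lambda>w. Z w * real_cond_exp M F f w) = expectation (\<lambda>w. Z w * real_cond_exp M F g w)"
    using ZM by (intro integral_cong_AE) (auto intro!: borel_measurable_times measurable_from_subalg[OF F])
  then show ?thesis
    using real_cond_exp_intg(2)[OF intZ[OF f] Z] real_cond_exp_intg(2)[OF intZ[OF g] Z] f g by auto
qed

text \<open>Since the number of visits \<open>V\<close> is random, the Hoeffding bound for the frequency of successes
  \<open>Y\<close> comes from the exponential supermartingale \<open>exp (l (K\<^sub>t - q N\<^sub>t) - l\<^sup>2 N\<^sub>t / 8)\<close>.\<close>

locale adapted_trials = prob_space M for M :: "'w measure" +
  fixes F :: "nat \<Rightarrow> 'w measure" and V Y :: "nat \<Rightarrow> 'w \<Rightarrow> bool" and q :: real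
  assumes F_sub: "\<And>t. subalgebra M (F t)" and F_mono: "\<And>t. subalgebra (F (Suc t)) (F t)"
    and V_meas: "\<And>t. t \<ge> 1 \<Longrightarrow> Measurable.pred (F (Suc t)) (V t)"
    and Y_meas: "\<And>t. t \<ge> 1 \<Longrightarrow> Measurable.pred (F (Suc t)) (Y t)"
    and success: "\<And>t H. t \<ge> 1 \<Longrightarrow> H \<in> sets (F t) \<Longrightarrow>
       prob {w \<in> H. V t w \<and> Y t w} = q * prob {w \<in> H. V t w}"
    and q: "0 \<le> q" "q \<le> 1"
begin

definition trials :: "nat \<Rightarrow> 'w \<Rightarrow> nat" where
  "trials t w = card {u \<in> {1..<t}. V u w}"

definition successes :: "nat \<Rightarrow> 'w \<Rightarrow> nat" where
  "successes t w = card {u \<in> {1..<t}. V u w \<and> Y u w}"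

lemmas M_meas = measurable_from_subalg[OF F_sub]

lemma F_le: "s \<le> t \<Longrightarrow> subalgebra (F t) (F s)"
proof (induction t rule: nat_induct)
  case (Suc t)
  then show ?case
    using F_mono[of t] by (cases "s = Suc t") (auto simp: subalgebra_def)
qed (auto simp: subalgebra_def)

lemma V_meas': "1 \<le> u \<Longrightarrow> u < t \<Longrightarrow> Measurable.pred (F t) (V u)"
  by (rule measurable_from_subalg[OF F_le V_meas]) auto

lemma Y_meas': "1 \<le> u \<Longrightarrow> u < t \<Longrightarrow> Measurable.pred (F t) (Y u)"
  by (rule measurable_from_subalg[OF F_le Y_meas]) auto

lemma trials_meas: "trials t \<in> F t \<rightarrow>\<^sub>M count_space UNIV"
  unfolding trials_def by (rule measurable_card_Collect) (auto intro: V_meas')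

lemma successes_meas: "successes t \<in> F t \<rightarrow>\<^sub>M count_space UNIV"
  unfolding successes_def by (rule measurable_card_Collect) (auto intro!: V_meas' Y_meas' pred_intros_logic)

definition exp_mart :: "real \<Rightarrow> nat \<Rightarrow> 'w \<Rightarrow> real" where
  "exp_mart l t w = exp (l * (real (successes t w) - q * real (trials t w)) - l\<^sup>2 / 8 * real (trials t w))"

lemma successes_le: "successes t w \<le> trials t w"
  unfolding successes_def trials_def by (rule card_mono) auto

lemma trials_le: "trials t w \<le> t"
proof -
  have "trials t w \<le> card {1..<t}" unfolding trials_def by (rule card_mono) auto
  then show ?thesis by simp
qed

lemma exp_mart_meas: "exp_mart l t \<in> borel_measurable (F t)"
proof -
  have [measurable]: "trials t \<in> F t \<rightarrow>\<^sub>M count_space UNIV" "successes t \<in> F t \<rightarrow>\<^sub>M count_space UNIV"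
    by (rule trials_meas successes_meas)+
  show ?thesis unfolding exp_mart_def by measurable
qed

text \<open>Crude and growing with \<open>t\<close>; it only secures integrability and an admissible
  weight.\<close>

lemma exp_mart_bound: "\<bar>exp_mart l t w\<bar> \<le> exp (\<bar>l\<bar> * t)"
proof -
  define n k where "n = real (trials t w)" and "k = real (successes t w)"
  have nk: "0 \<le> k" "k \<le> n" "n \<le> t" using successes_le[of t w] trials_le[of t w] by (auto simp: n_def k_def)
  have "0 \<le> q * n" "q * n \<le> n" using q nk by (auto intro: mult_left_le_one_le)
  hence "\<bar>k - q * n\<bar> \<le> t" using nk by linarith
  hence "l * (k - q * n) \<le> \<bar>l\<bar> * t"
    by (metis abs_ge_self abs_ge_zero abs_mult mult_left_mono order_trans)
  moreover have "0 \<le> l\<^sup>2 / 8 * n" using nk by simp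
  ultimately show ?thesis unfolding exp_mart_def n_def[symmetric] k_def[symmetric] by simp
qed

lemma exp_mart_integrable: "integrable M (exp_mart l t)"
  by (rule integrable_const_bound[of _ "exp (\<bar>l\<bar> * t)"])
     (use exp_mart_bound M_meas[OF exp_mart_meas] in auto)

text \<open>A trial multiplies the process by a factor of conditional mean at most 1, by Hoeffding's
  lemma; without a trial nothing changes. The process starts at 1 because no trial precedes time
  1.\<close>

lemma exp_mart_le_1: "t \<ge> 1 \<Longrightarrow> expectation (exp_mart l t) \<le> 1"
proof (induction t rule: dec_induct)
  case base
  have "trials 1 w = 0" "successes 1 w = 0" for w
    by (auto simp: trials_def successes_def)
  then show ?case by (simp add: exp_mart_def[abs_def] prob_space)
next
  case (step t)
  \<comment> \<open>The factors contributed by a success and by a failed trial.\<close>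
  define a b where "a = exp (l * (1 - q) - l\<^sup>2 / 8)" and "b = exp (- l * q - l\<^sup>2 / 8)"
  have ab: "q * (a - b) + b - 1 \<le> 0"
  proof -
    have a: "a = exp (l * (1 - q)) * exp (- (l\<^sup>2 / 8))" and b: "b = exp (- l * q) * exp (- (l\<^sup>2 / 8))"
      unfolding a_def b_def exp_add[symmetric] by simp_all
    have "q * (a - b) + b = (q * exp (l * (1 - q)) + (1 - q) * exp (- l * q)) * exp (- (l\<^sup>2 / 8))"
      unfolding a b by (simp add: algebra_simps)
    also have "\<dots> \<le> exp (l\<^sup>2 / 8) * exp (- (l\<^sup>2 / 8))"
      by (rule mult_right_mono[OF bernoulli_exp_moment_le[OF q]]) simp
    finally show ?thesis by (simp add: exp_minus)
  qed
  define W where "W = exp_mart l t"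
  have VM[measurable]: "Measurable.pred M (V t)" and YM[measurable]: "Measurable.pred M (Y t)"
    using M_meas[OF V_meas[OF step(1)]]
      M_meas[OF Y_meas[OF step(1)]] by auto
  have WM[measurable]: "W \<in> borel_measurable M"
    unfolding W_def by (rule M_meas[OF exp_mart_meas])
  have Wb: "\<bar>W w\<bar> \<le> exp (\<bar>l\<bar> * t)" for w unfolding W_def by (rule exp_mart_bound)
  have W0: "W w \<ge> 0" for w unfolding W_def exp_mart_def by simp
  define fV fVY :: "'w \<Rightarrow> real" where "fV w = of_bool (V t w)" and "fVY w = of_bool (V t w \<and> Y t w)" for w
  have [measurable]: "fV \<in> borel_measurable M" "fVY \<in> borel_measurable M"
    unfolding fV_def fVY_def of_bool_def by measurable
  have int1: "integrable M fV" "integrable M fVY"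
    by (rule integrable_const_bound[of _ 1]; auto simp: fV_def fVY_def)+
  have int2: "integrable M (\<lambda>w. W w * fV w)" "integrable M (\<lambda>w. W w * fVY w)"
    by (rule integrable_const_bound[of _ "exp (\<bar>l\<bar> * t)"]; use Wb in \<open>auto simp: fV_def fVY_def\<close>)+
  \<comment> \<open>\<open>V t\<close> may be revealed only in the step at \<open>t\<close>, so only
    \<open>W\<close>, known before, acts as the weight; both indicators stay inside the
    expectation.\<close>
  have "expectation (\<lambda>w. W w * fVY w) = expectation (\<lambda>w. W w * (q * fV w))"
  proof (rule expectation_mult_eq_of_set_integral_eq[OF F_sub])
    fix H assume H: "H \<in> sets (F t)"
    have HM[measurable]: "H \<in> sets M" using H F_sub[of t] by (auto simp: subalgebra_def)
    show "(LINT w:H|M. fVY w) = (LINT w:H|M. q * fV w)"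
      unfolding fV_def fVY_def set_integral_mult_right
      by (subst (1 2) set_integral_of_bool) (auto intro: success[OF step(1) H])
  qed (use int1 Wb exp_mart_meas W_def in auto)
  also have "\<dots> = q * expectation (\<lambda>w. W w * fV w)"
    by (subst Bochner_Integration.integral_mult_right_zero[symmetric]) (simp add: mult_ac)
  finally have key: "expectation (\<lambda>w. W w * fVY w) = q * expectation (\<lambda>w. W w * fV w)" .
  have decomp: "exp_mart l (Suc t) w = W w + (a - b) * (W w * fVY w) + (b - 1) * (W w * fV w)" for w
  proof -
    have N: "trials (Suc t) w = trials t w + of_bool (V t w)"
      "successes (Suc t) w = successes t w + of_bool (V t w \<and> Y t w)"
      unfolding trials_def successes_def by (rule card_Collect_upt_Suc[OF step(1)])+
    consider "\<not> V t w" | "V t w" "Y t w" | "V t w" "\<not> Y t w" by blast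
    then show ?thesis
    proof cases
      case 1 then show ?thesis by (simp add: exp_mart_def N fV_def fVY_def W_def)
    next
      case 2 then have "exp_mart l (Suc t) w = W w * a"
        unfolding W_def exp_mart_def a_def exp_add[symmetric] by (simp add: N algebra_simps)
      with 2 show ?thesis by (simp add: fV_def fVY_def algebra_simps)
    next
      case 3 then have "exp_mart l (Suc t) w = W w * b"
        unfolding W_def exp_mart_def b_def exp_add[symmetric] by (simp add: N algebra_simps)
      with 3 show ?thesis by (simp add: fV_def fVY_def algebra_simps)
    qed
  qed
  have "expectation (exp_mart l (Suc t)) =
      expectation W + (a - b) * expectation (\<lambda>w. W w * fVY w) + (b - 1) * expectation (\<lambda>w. W w * fV w)"
    unfolding decomp[abs_def] using int2 exp_mart_integrable[of l t] by (simp add: W_def)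
  also have "\<dots> = expectation W + expectation (\<lambda>w. W w * fV w) * (q * (a - b) + b - 1)"
    unfolding key by (simp add: algebra_simps)
  also have "\<dots> \<le> expectation W"
  proof -
    have "expectation (\<lambda>w. W w * fV w) \<ge> 0" using W0 by (intro Bochner_Integration.integral_nonneg) (auto simp: fV_def)
    then show ?thesis using ab by (simp add: mult_nonneg_nonpos)
  qed
  finally show ?case using step.IH unfolding W_def by linarith
qed

lemma deviation_event:
  "{w \<in> space M. n0 \<le> real (trials t w) \<and>
      c * real (trials t w) \<le> \<bar>real (successes t w) - q * real (trials t w)\<bar>} \<in> sets M"
proof -
  define f g where "f = (\<lambda>w. real (trials t w))" and "g = (\<lambda>w. real (successes t w))"
  have [measurable]: "f \<in> borel_measurable M" "g \<in> borel_measurable M"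
    unfolding f_def g_def
    using measurable_compose[OF M_meas[OF trials_meas], of real borel]
      measurable_compose[OF M_meas[OF successes_meas], of real borel] by auto
  have "{w \<in> space M. n0 \<le> f w \<and> c * f w \<le> \<bar>g w - q * f w\<bar>} \<in> sets M" by measurable
  then show ?thesis unfolding f_def g_def .
qed

text \<open>The two-sided event forces one of two exponential supermartingales to be large, and
  Markov's inequality applies. The number of trials stays random; it only has to reach
  \<open>n0\<close>.\<close>

lemma deviation_bound:
  assumes t: "t \<ge> 1" and c: "c \<ge> 0"
  shows "prob {w \<in> space M. n0 \<le> real (trials t w) \<and>
      c * real (trials t w) \<le> \<bar>real (successes t w) - q * real (trials t w)\<bar>} \<le> 2 * exp (- 2 * c\<^sup>2 * n0)"
proof -
  define E where "E l = {w \<in> space M. exp (2 * c\<^sup>2 * n0) \<le> exp_mart l t w}" for l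
  have EM: "E l \<in> sets M" for l
  proof -
    have [measurable]: "exp_mart l t \<in> borel_measurable M" using exp_mart_integrable by blast
    show ?thesis unfolding E_def by measurable
  qed
  have P: "prob (E l) \<le> exp (- 2 * c\<^sup>2 * n0)" for l
  proof -
    have "prob (E l) \<le> expectation (exp_mart l t) / exp (2 * c\<^sup>2 * n0)"
      unfolding E_def by (rule integral_Markov_inequality_measure[OF exp_mart_integrable, of "{}"])
        (auto simp: exp_mart_def)
    also have "\<dots> \<le> 1 / exp (2 * c\<^sup>2 * n0)" by (rule divide_right_mono[OF exp_mart_le_1[OF t]]) simp
    finally show ?thesis by (simp add: exp_minus inverse_eq_divide)
  qed
  \<comment> \<open>The slope \<open>4 * c\<close> maximises l c - l^2/8, with value 2 c^2 per
    trial; the two signs treat the two tails.\<close>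
  have "{w \<in> space M. n0 \<le> real (trials t w) \<and>
      c * real (trials t w) \<le> \<bar>real (successes t w) - q * real (trials t w)\<bar>} \<subseteq> E (4 * c) \<union> E (- 4 * c)"
  proof safe
    fix w assume w: "w \<in> space M" "n0 \<le> real (trials t w)" "w \<notin> E (- 4 * c)"
      "c * real (trials t w) \<le> \<bar>real (successes t w) - q * real (trials t w)\<bar>"
    define n d where "n = real (trials t w)" and "d = real (successes t w) - q * real (trials t w)"
    have n: "2 * c\<^sup>2 * n0 \<le> 2 * c\<^sup>2 * n" using w(2) unfolding n_def by (intro mult_left_mono) auto
    have key: "2 * c\<^sup>2 * n0 \<le> 4 * c * e - (4 * c)\<^sup>2 / 8 * n" if "c * n \<le> e" for e
    proof -
      have "4 * c * (c * n) \<le> 4 * c * e" using that c by (intro mult_left_mono) auto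
      then show ?thesis using n by (simp add: power2_eq_square algebra_simps)
    qed
    have "c * n \<le> d \<or> c * n \<le> - d" using w(4) unfolding n_def d_def by linarith
    then show "w \<in> E (4 * c)"
    proof
      assume "c * n \<le> d"
      from key[OF this] show ?thesis using w(1) by (simp add: E_def exp_mart_def n_def d_def)
    next
      assume "c * n \<le> - d"
      from key[OF this] have "w \<in> E (- 4 * c)"
        using w(1) by (simp add: E_def exp_mart_def n_def d_def algebra_simps)
      with w show ?thesis by blast
    qed
  qed
  hence "prob {w \<in> space M. n0 \<le> real (trials t w) \<and>
      c * real (trials t w) \<le> \<bar>real (successes t w) - q * real (trials t w)\<bar>} \<le> prob (E (4 * c) \<union> E (- 4 * c))"
    using EM by (intro finite_measure_mono) auto
  also have "\<dots> \<le> prob (E (4 * c)) + prob (E (- 4 * c))" using EM by (intro measure_Un_le) auto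
  also have "\<dots> \<le> 2 * exp (- 2 * c\<^sup>2 * n0)" using P[of "4 * c"] P[of "- 4 * c"] by linarith
  finally show ?thesis .
qed

end

section \<open>Finite irreducible chains\<close>

locale irreducible_chain =
  fixes S :: "'s set" and P :: "'s \<Rightarrow> 's pmf"
  assumes finite_S: "finite S" and S_nonempty: "S \<noteq> {}"
    and transition_S: "transition_matrix_on S P" and irreducible_S: "irreducible_on S P"
begin

lemma set_pmf_P: "s \<in> S \<Longrightarrow> set_pmf (P s) \<subseteq> S"
  using transition_S by (auto simp: transition_matrix_on_def)

lemma sum_P: "s \<in> S \<Longrightarrow> (\<Sum>z\<in>S. pmf (P s) z) = 1"
  by (rule sum_pmf_eq_1[OF finite_S set_pmf_P])

lemma finite_positive_entries: "finite {pmf (P s) s' | s s'. s \<in> S \<and> s' \<in> S \<and> pmf (P s) s' > 0}"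
  by (rule finite_subset[of _ "(\<lambda>(s, s'). pmf (P s) s') ` (S \<times> S)"]) (use finite_S in auto)

lemma T_S_pos: "T_S S P > 0"
  and pmf_ge_inverse_T_S: "s \<in> S \<Longrightarrow> s' \<in> S \<Longrightarrow> pmf (P s) s' > 0 \<Longrightarrow> inverse (T_S S P) \<le> pmf (P s) s'"
  and T_S_ge_1: "T_S S P \<ge> 1"
proof -
  let ?E = "{pmf (P s) s' | s s'. s \<in> S \<and> s' \<in> S \<and> pmf (P s) s' > 0}"
  obtain s where s: "s \<in> S" using S_nonempty by blast
  obtain s' where s': "s' \<in> set_pmf (P s)" using set_pmf_not_empty[of "P s"] by blast
  have ne: "pmf (P s) s' \<in> ?E" using s s' set_pmf_P[OF s] by (auto intro: pmf_positive)
  have "Min ?E \<in> ?E" using finite_positive_entries ne by (intro Min_in) auto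
  then have m: "0 < Min ?E" "Min ?E \<le> 1" by (auto simp: pmf_le_1)
  show "T_S S P > 0" "T_S S P \<ge> 1" using m by (auto simp: T_S_def one_le_inverse_iff)
  fix s s' assume "s \<in> S" "s' \<in> S" "pmf (P s) s' > 0"
  then show "inverse (T_S S P) \<le> pmf (P s) s'"
    unfolding T_S_def inverse_inverse_eq by (intro Min_le finite_positive_entries) auto
qed

definition step_mean :: "('s \<Rightarrow> real) \<Rightarrow> 's \<Rightarrow> real" where
  "step_mean f y = (\<Sum>z\<in>S. pmf (P y) z * f z)"

lemma step_mean_mono: "(\<And>z. z \<in> S \<Longrightarrow> f z \<le> g z) \<Longrightarrow> step_mean f y \<le> step_mean g y"
  unfolding step_mean_def by (intro sum_mono mult_left_mono) auto

lemma step_mean_cmult: "step_mean (\<lambda>z. c * f z) y = c * step_mean f y"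
  unfolding step_mean_def by (simp add: sum_distrib_left mult_ac)

lemma step_mean_abs: "\<bar>step_mean f y\<bar> \<le> step_mean (\<lambda>z. \<bar>f z\<bar>) y"
  unfolding step_mean_def by (rule order_trans[OF sum_abs]) (simp add: abs_mult)

text \<open>The weight grows with the graph distance to the target, geometrically slower the farther away,
  so that the possible step towards the target outweighs all other steps.\<close>

lemma hitting_lyapunov:
  assumes s0: "s0 \<in> S"
  obtains v :: "'s \<Rightarrow> real" and r :: real
  where "0 < r" "r < 1" "\<And>y. y \<in> S \<Longrightarrow> 1 \<le> v y"
    "\<And>y. y \<in> S \<Longrightarrow> y \<noteq> s0 \<Longrightarrow> step_mean v y \<le> r * v y"
    "exp (- 1) * step_mean v s0 \<le> r * v s0"
proof -
  \<comment> \<open>The least number of steps in which \<open>s0\<close> can be reached; away from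
    \<open>s0\<close>, some possible transition decreases it.\<close>
  define d where "d y = (LEAST n. pmf (nstep_pmf P n y) s0 > 0)" for y
  have dex: "pmf (nstep_pmf P (d y) y) s0 > 0" if "y \<in> S" for y
    unfolding d_def by (rule LeastI_ex) (use irreducible_S that s0 in \<open>auto simp: irreducible_on_def\<close>)
  have step: "\<exists>z\<in>S. pmf (P y) z > 0 \<and> d z < d y" if y: "y \<in> S" "y \<noteq> s0" for y
  proof -
    have "d y \<noteq> 0"
    proof
      assume "d y = 0"
      then show False using dex[OF y(1)] y(2) by simp
    qed
    then obtain n where n: "d y = Suc n" by (metis not0_implies_Suc)
    have "s0 \<in> set_pmf (nstep_pmf P (Suc n) y)" using dex[OF y(1)] unfolding n by (simp only: pmf_positive_iff)
    then obtain z where z: "z \<in> set_pmf (P y)" "s0 \<in> set_pmf (nstep_pmf P n z)" by auto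
    have "d z \<le> n" unfolding d_def using z(2) by (intro Least_le) (simp add: pmf_positive)
    then show ?thesis using z(1) set_pmf_P[OF y(1)] n by (auto intro!: bexI[of _ z] pmf_positive)
  qed
  define D where "D = Max (d ` S)"
  have dD: "d y \<le> D" if "y \<in> S" for y unfolding D_def using that finite_S by (intro Max_ge) auto
  \<comment> \<open>A possible step has probability at least \<open>1 / T_S\<close>, so with this
    base a single step closer to \<open>s0\<close> already contributes
    \<open>2 * R ^ (D - d y)\<close>.\<close>
  define R where "R = 2 * T_S S P"
  have R: "R \<ge> 2" using T_S_ge_1 by (simp add: R_def)
  define H where "H = R ^ D"
  define h where "h y = H - R ^ (D - d y)" for y
  have H1: "H \<ge> 1" unfolding H_def using R by simp
  have h: "0 \<le> h y" "h y \<le> H" for y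
    unfolding h_def H_def using R by (auto intro: power_increasing)
  have Ph: "step_mean h y \<le> h y - 1" if y: "y \<in> S" "y \<noteq> s0" for y
  proof -
    obtain z where z: "z \<in> S" "pmf (P y) z > 0" "d z < d y" using step[OF y] by blast
    have "2 * R ^ (D - d y) = inverse (T_S S P) * R ^ Suc (D - d y)"
      using T_S_pos by (simp add: R_def)
    also have "\<dots> \<le> inverse (T_S S P) * R ^ (D - d z)"
      using R z(3) dD[OF y(1)] T_S_pos by (intro mult_left_mono power_increasing) auto
    also have "\<dots> \<le> pmf (P y) z * R ^ (D - d z)"
      using R by (intro mult_right_mono pmf_ge_inverse_T_S y z) auto
    also have "\<dots> \<le> (\<Sum>z\<in>S. pmf (P y) z * R ^ (D - d z))"
      using z R by (intro member_le_sum finite_S) auto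
    finally have *: "2 * R ^ (D - d y) \<le> (\<Sum>z\<in>S. pmf (P y) z * R ^ (D - d z))" .
    have "step_mean h y = H - (\<Sum>z\<in>S. pmf (P y) z * R ^ (D - d z))"
      unfolding step_mean_def h_def
      by (simp add: right_diff_distrib sum_subtractf sum_distrib_right[symmetric] sum_P[OF y(1)])
    moreover have "R ^ (D - d y) \<ge> 1" using R by simp
    ultimately show ?thesis using * unfolding h_def by linarith
  qed
  \<comment> \<open>As \<open>h\<close> lies in [0, H], this scaling keeps \<open>v\<close> between
    1 and 5/4. The drop of \<open>h\<close> by 1 becomes a drop of e >= (4/5) e v, which explains
    \<open>r\<close>.\<close>
  define e where "e = 1 / (4 * H)"
  have e: "e > 0" "e * H = 1 / 4" using H1 by (auto simp: e_def)
  define r where "r = 1 - 4 / 5 * e"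
  have e4: "e \<le> 1 / 4" using H1 by (simp add: e_def)
  define v where "v y = 1 + e * h y" for y
  have eh: "0 \<le> e * h y" "e * h y \<le> 1 / 4" for y
    using h(1)[of y] e mult_left_mono[OF h(2)[of y], of e] by (simp, linarith)
  have Pv: "step_mean v y = 1 + e * step_mean h y" if "y \<in> S" for y
    unfolding v_def step_mean_def
    by (simp add: distrib_left sum.distrib sum_P[OF that] sum_distrib_left mult_ac)
  show thesis
  proof
    show "0 < r" "r < 1" using e e4 by (auto simp: r_def)
    show "1 \<le> v y" for y using eh by (simp add: v_def)
    show "step_mean v y \<le> r * v y" if y: "y \<in> S" "y \<noteq> s0" for y
    proof -
      have "e * step_mean h y \<le> e * (h y - 1)" using Ph[OF y] e by (intro mult_left_mono) auto
      moreover have "e * (e * h y) \<le> e * (1 / 4)" using eh e by (intro mult_left_mono) auto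
      moreover have "e * (h y - 1) = e * h y - e" by (simp add: algebra_simps)
      moreover have "r * v y = 1 + e * h y - 4 / 5 * e - 4 / 5 * (e * (e * h y))"
        unfolding v_def r_def by (simp add: algebra_simps)
      ultimately show ?thesis unfolding Pv[OF y(1)] by linarith
    qed
    \<comment> \<open>At \<open>s0\<close> nothing forces a decrease; the discount exp(-1) for a
      visit pays instead: (1/2)(5/4) <= 4/5 <= r.\<close>
    have "step_mean h s0 \<le> step_mean (\<lambda>_. H) s0" using h by (intro step_mean_mono) auto
    also have "\<dots> = H" by (simp add: step_mean_def sum_distrib_right[symmetric] sum_P[OF s0])
    finally have "e * step_mean h s0 \<le> e * H" using e by (intro mult_left_mono) auto
    hence "step_mean v s0 \<le> 5 / 4" unfolding Pv[OF s0] using e by simp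
    moreover have "exp (- 1) \<le> (1 / 2 :: real)" using exp_ge_add_one_self[of 1] by (simp add: exp_minus field_simps)
    moreover have "0 \<le> step_mean v s0" unfolding step_mean_def v_def using eh by (intro sum_nonneg mult_nonneg_nonneg) (auto simp: add_nonneg_nonneg)
    ultimately have "exp (- 1) * step_mean v s0 \<le> 1 / 2 * (5 / 4)" by (intro mult_mono) auto
    also have "\<dots> \<le> r" using e4 by (simp add: r_def)
    also have "\<dots> = r * 1" by simp
    also have "\<dots> \<le> r * v s0" using e4 eh[of s0] by (intro mult_left_mono) (auto simp: r_def v_def)
    finally show "exp (- 1) * step_mean v s0 \<le> r * v s0" .
  qed
qed

section \<open>Passage times and their mean\<close>

lemma passage_time_prob_0: "passage_time_prob P y s0 0 = 0"
  by (simp add: passage_time_prob_def)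

text \<open>First-step analysis. A path beginning with \<open>z\<close> is a first passage either
  because z = s0 and nothing follows, or because z \<noteq> s0 and the rest is a first passage from
  \<open>z\<close>.\<close>

lemma passage_time_prob_Suc:
  assumes y: "y \<in> S"
  shows "passage_time_prob P y s0 (Suc n) =
    (\<Sum>z\<in>S. pmf (P y) z * (if z = s0 then of_bool (n = 0) else passage_time_prob P z s0 n))"
proof -
  let ?E = "{ys. ys \<noteq> [] \<and> last ys = s0 \<and> s0 \<notin> set (butlast ys)}"
  have pre: "(\<lambda>ys. z # ys) -` ?E = (if z = s0 then {[]} else ?E)" for z
    by (auto split: if_splits)
  have nil: "measure_pmf.prob (path_pmf P n z) {[]} = of_bool (n = 0)" for z
  proof (cases n)
    case (Suc m)
    have "[] \<notin> set_pmf (path_pmf P n z)" by (auto simp: Suc)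
    then show ?thesis using Suc by (simp add: measure_pmf_single pmf_eq_0_set_pmf)
  qed simp
  have "ennreal (passage_time_prob P y s0 (Suc n)) =
      (\<integral>\<^sup>+z. emeasure (path_pmf P n z) ((\<lambda>ys. z # ys) -` ?E) \<partial>P y)"
    unfolding passage_time_prob_def by (simp add: measure_pmf.emeasure_eq_measure[symmetric])
  also have "\<dots> = (\<integral>\<^sup>+z. ennreal (if z = s0 then of_bool (n = 0) else passage_time_prob P z s0 n) \<partial>P y)"
    unfolding pre by (intro nn_integral_cong)
      (auto simp: measure_pmf.emeasure_eq_measure nil passage_time_prob_def simp del: of_bool_eq_iff)
  also have "\<dots> = ennreal (\<integral>z. (if z = s0 then of_bool (n = 0) else passage_time_prob P z s0 n) \<partial>P y)"
    by (intro nn_integral_eq_integral measure_pmf.integrable_const_bound[where B = 1])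
      (auto simp: passage_time_prob_def)
  also have "(\<integral>z. (if z = s0 then of_bool (n = 0) else passage_time_prob P z s0 n) \<partial>P y) =
      (\<Sum>z\<in>S. (if z = s0 then of_bool (n = 0) else passage_time_prob P z s0 n) * pmf (P y) z)"
    using set_pmf_P[OF y] finite_S by (intro integral_measure_pmf_real) auto
  finally show ?thesis
    by (subst (asm) ennreal_inj) (auto simp: passage_time_prob_def sum_nonneg mult_ac)
qed

text \<open>The mean is an infinite series, so a lower bound needs its convergence and the total
  mass 1 of the passage law. Both follow from a geometric tail, obtained by iterating the weight of
  \<open>hitting_lyapunov\<close> for the chain stopped at \<open>s0\<close>.\<close>

lemma expected_passage_time_ge_1:
  assumes y: "y \<in> S" and s0: "s0 \<in> S"
  shows "1 \<le> expected_passage_time P y s0"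
proof -
  obtain r v where r: "0 < r" "r < 1" and v1: "\<And>y. y \<in> S \<Longrightarrow> 1 \<le> v y"
    and off: "\<And>y. y \<in> S \<Longrightarrow> y \<noteq> s0 \<Longrightarrow> step_mean v y \<le> r * v y"
    and at: "exp (- 1) * step_mean v s0 \<le> r * v s0"
    by (rule hitting_lyapunov[OF s0]) blast
  have e1: "1 \<le> exp (1::real)" by simp
  define c where "c = exp (1::real)"
  have c: "c \<ge> 1" by (simp add: c_def)
  have Pv: "step_mean v y \<le> c * r * v y" if "y \<in> S" for y
  proof (cases "y = s0")
    case True
    then show ?thesis using at by (simp add: exp_minus c_def field_simps)
  next
    case False
    have "1 * (r * v y) \<le> c * (r * v y)" using c v1[OF that] r by (intro mult_right_mono) auto
    then show ?thesis using off[OF that False] by simp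
  qed
  let ?p = "\<lambda>y. passage_time_prob P y s0"
  \<comment> \<open>The probability that the passage takes more than \<open>n\<close> steps.\<close>
  define q where "q n y = 1 - (\<Sum>k\<le>n. ?p y k)" for n y
  have q0: "q 0 y = 1" for y by (simp add: q_def passage_time_prob_0)
  have qS: "q (Suc n) y = (\<Sum>z\<in>S. pmf (P y) z * (if z = s0 then 0 else q n z))" if y: "y \<in> S" for n y
  proof -
    have "(\<Sum>k\<le>Suc n. ?p y k) = (\<Sum>k\<le>n. ?p y (Suc k))"
      by (subst sum.atMost_Suc_shift) (simp add: passage_time_prob_0)
    also have "\<dots> = (\<Sum>k\<le>n. \<Sum>z\<in>S. pmf (P y) z * (if z = s0 then of_bool (k = 0) else ?p z k))"
      by (simp add: passage_time_prob_Suc[OF y])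
    also have "\<dots> = (\<Sum>z\<in>S. pmf (P y) z * (\<Sum>k\<le>n. if z = s0 then of_bool (k = 0) else ?p z k))"
      by (subst sum.swap) (simp add: sum_distrib_left)
    also have "\<dots> = (\<Sum>z\<in>S. pmf (P y) z * (if z = s0 then 1 else 1 - q n z))"
    proof (intro sum.cong refl arg_cong2[where f = "(*)"])
      fix z show "(\<Sum>k\<le>n. if z = s0 then of_bool (k = 0) else ?p z k) = (if z = s0 then 1 else 1 - q n z)"
        by (simp add: q_def of_bool_def sum.delta)
    qed
    also have "\<dots> = (\<Sum>z\<in>S. pmf (P y) z - pmf (P y) z * (if z = s0 then 0 else q n z))"
      by (intro sum.cong) (auto simp: algebra_simps)
    finally show ?thesis by (simp add: q_def[of "Suc n"] sum_subtractf sum_P[OF y])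
  qed
  \<comment> \<open>From \<open>s0\<close> the weight may grow in the first step, by at most the
    factor \<open>c * r\<close>; later visits to \<open>s0\<close> end the passage, so
    \<open>c\<close> enters only once.\<close>
  have qn: "(y \<noteq> s0 \<longrightarrow> q n y \<le> r ^ n * v y) \<and> q n y \<le> c * r ^ n * v y" if "y \<in> S" for n y
    using that
  proof (induction n arbitrary: y)
    case 0
    have "1 * 1 \<le> c * v y" using c v1[OF 0] by (intro mult_mono) auto
    then show ?case using v1[OF 0] by (simp add: q0)
  next
    case (Suc n)
    have *: "q (Suc n) y \<le> r ^ n * step_mean v y"
      unfolding qS[OF Suc.prems] step_mean_cmult[symmetric] unfolding step_mean_def
      using Suc.IH r v1 by (intro sum_mono mult_left_mono) (auto intro!: mult_nonneg_nonneg order_trans[OF zero_le_one v1])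
    have "r ^ n * step_mean v y \<le> r ^ n * (c * r * v y)"
      using Pv[OF Suc.prems] r by (intro mult_left_mono) auto
    moreover have "r ^ n * step_mean v y \<le> r ^ n * (r * v y)" if "y \<noteq> s0"
      using off[OF Suc.prems that] r by (intro mult_left_mono) auto
    ultimately show ?case using * by (auto simp: mult_ac)
  qed
  have qnn: "0 \<le> q n y" if "y \<in> S" for n y
    using that
  proof (induction n arbitrary: y)
    case (Suc n)
    then show ?case unfolding qS[OF Suc.prems] by (intro sum_nonneg mult_nonneg_nonneg) auto
  qed (simp add: q0)
  have p_nn: "0 \<le> ?p y n" for n by (simp add: passage_time_prob_def)
  have "(\<lambda>n. c * r ^ n * v y) \<longlonglongrightarrow> c * 0 * v y"
    using r by (intro tendsto_intros LIMSEQ_power_zero) auto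
  hence "(\<lambda>n. q n y) \<longlonglongrightarrow> 0"
    using qn[OF y] qnn[OF y]
    by (intro tendsto_sandwich[of "\<lambda>_. 0" "\<lambda>n. q n y" sequentially "\<lambda>n. c * r ^ n * v y"]) auto
  hence "(\<lambda>n. 1 - q n y) \<longlonglongrightarrow> 1 - 0" by (intro tendsto_intros)
  hence sums: "?p y sums 1" by (simp add: q_def sums_def_le)
  have summ: "summable (\<lambda>n. real n * ?p y n)"
  proof (subst summable_Suc_iff[symmetric], rule summable_comparison_test)
    show "summable (\<lambda>n. c * v y * (real (Suc n) * r ^ n))"
    proof (rule summable_mult)
      have "summable (\<lambda>n. diffs (\<lambda>_. 1) n * r ^ n)"
        using r by (intro termdiff_converges[where K = 1]) (auto intro: summable_geometric)
      then show "summable (\<lambda>n. real (Suc n) * r ^ n)" by (simp add: diffs_def)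
    qed
    have "?p y (Suc n) \<le> c * r ^ n * v y" for n
    proof -
      have "?p y (Suc n) = q n y - q (Suc n) y" by (simp add: q_def)
      then show ?thesis using qn[OF y, of n] qnn[OF y, of "Suc n"] by linarith
    qed
    hence "real (Suc n) * ?p y (Suc n) \<le> real (Suc n) * (c * r ^ n * v y)" for n
      by (intro mult_left_mono) auto
    then show "\<exists>N. \<forall>n\<ge>N. norm (real (Suc n) * ?p y (Suc n)) \<le> c * v y * (real (Suc n) * r ^ n)"
      using p_nn by (auto simp: abs_mult mult_ac)
  qed
  \<comment> \<open>A passage takes at least one step, so the mean dominates the total mass.\<close>
  have "1 = suminf (?p y)" using sums by (simp add: sums_iff)
  also have "\<dots> \<le> (\<Sum>n. real n * ?p y n)"
  proof (rule suminf_le)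
    show "?p y n \<le> real n * ?p y n" for n
    proof (cases "n = 0")
      case False
      then have "1 * ?p y n \<le> real n * ?p y n" by (intro mult_right_mono p_nn) auto
      then show ?thesis by simp
    qed (simp add: passage_time_prob_0)
  qed (use summ sums in \<open>auto simp: sums_iff\<close>)
  finally show ?thesis by (simp add: expected_passage_time_def)
qed

lemma T_M_ge_1: "T_M S P \<ge> 1"
proof -
  obtain y where y: "y \<in> S" using S_nonempty by blast
  have "expected_passage_time P y y \<le> T_M S P"
    unfolding T_M_def
  proof (rule Max_ge)
    show "finite {expected_passage_time P s s' | s s'. s \<in> S \<and> s' \<in> S}"
      by (rule finite_subset[of _ "(\<lambda>(s, s'). expected_passage_time P s s') ` (S \<times> S)"]) (use finite_S in auto)
  qed (use y in auto)
  with expected_passage_time_ge_1[OF y y] show ?thesis by linarith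
qed

text \<open>The Poisson equation is solved off a state \<open>s0\<close> of positive stationary mass, where the chain killed
  at \<open>s0\<close> is a contraction; stationarity then forces the equation to hold at \<open>s0\<close> too.\<close>

lemma poisson_equation:
  assumes st: "stationary_on S P \<mu>"
  obtains h where "\<And>y. y \<in> S \<Longrightarrow> h y - step_mean h y = f y - (\<Sum>s\<in>S. pmf \<mu> s * f s)"
proof -
  have muS: "set_pmf \<mu> \<subseteq> S" and mu: "\<And>s'. s' \<in> S \<Longrightarrow> pmf \<mu> s' = (\<Sum>s\<in>S. pmf \<mu> s * pmf (P s) s')"
    using st by (auto simp: stationary_on_def)
  obtain s0 where s0: "s0 \<in> S" "pmf \<mu> s0 > 0"
    using muS set_pmf_not_empty[of \<mu>] pmf_positive[of _ \<mu>] by blast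
  obtain r v where r: "0 < r" "r < 1" and v1: "\<And>y. y \<in> S \<Longrightarrow> 1 \<le> v y"
    and off: "\<And>y. y \<in> S \<Longrightarrow> y \<noteq> s0 \<Longrightarrow> step_mean v y \<le> r * v y"
    by (rule hitting_lyapunov[OF s0(1)]) blast
  define m where "m = (\<Sum>s\<in>S. pmf \<mu> s * f s)"
  define f0 where "f0 y = (if y = s0 then 0 else f y - m)" for y
  define C where "C = Max ((\<lambda>y. \<bar>f0 y\<bar>) ` S)"
  have C: "\<bar>f0 y\<bar> \<le> C" if "y \<in> S" for y unfolding C_def using that finite_S by (intro Max_ge) auto
  have C0: "C \<ge> 0" using C[OF s0(1)] by linarith
  \<comment> \<open>The transition operator killed at \<open>s0\<close>, a contraction in the weight
    \<open>v\<close>.\<close>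
  define K where "K u y = (if y = s0 then 0 else step_mean u y)" for u y
  define w where "w n = (K ^^ n) f0" for n
  have w: "\<bar>w n y\<bar> \<le> C * r ^ n * v y" if "y \<in> S" for n y
    using that
  proof (induction n arbitrary: y)
    case 0
    have "C * 1 \<le> C * v y" using v1[OF 0] C0 by (intro mult_left_mono) auto
    then show ?case using C[OF 0] by (simp add: w_def)
  next
    case (Suc n)
    show ?case
    proof (cases "y = s0")
      case True
      then show ?thesis using C0 r v1[OF Suc.prems] by (simp add: w_def K_def)
    next
      case False
      have "\<bar>w (Suc n) y\<bar> = \<bar>step_mean (w n) y\<bar>" using False by (simp add: w_def K_def)
      also have "\<dots> \<le> step_mean (\<lambda>z. \<bar>w n z\<bar>) y" by (rule step_mean_abs)
      also have "\<dots> \<le> step_mean (\<lambda>z. (C * r ^ n) * v z) y" using Suc.IH by (intro step_mean_mono)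
      also have "\<dots> = C * r ^ n * step_mean v y" by (rule step_mean_cmult)
      also have "\<dots> \<le> C * r ^ n * (r * v y)" using off[OF Suc.prems False] C0 r by (intro mult_left_mono) auto
      finally show ?thesis by (simp add: mult_ac)
    qed
  qed
  have sw: "summable (\<lambda>n. w n y)" if "y \<in> S" for y
  proof (rule summable_comparison_test)
    show "summable (\<lambda>n. C * v y * r ^ n)" using r by (intro summable_mult summable_geometric) auto
    show "\<exists>N. \<forall>n\<ge>N. norm (w n y) \<le> C * v y * r ^ n" using w[OF that] by (auto simp: mult_ac)
  qed
  \<comment> \<open>The Neumann series: the expected sum of the centred \<open>f\<close> collected
    before \<open>s0\<close> is reached.\<close>
  define h where "h y = (\<Sum>n. w n y)" for y
  have Ph: "step_mean h y = (\<Sum>n. step_mean (w n) y)" for y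
  proof -
    have "(\<Sum>n. step_mean (w n) y) = (\<Sum>z\<in>S. \<Sum>n. pmf (P y) z * w n z)"
      unfolding step_mean_def by (rule suminf_sum) (auto intro: summable_mult sw)
    also have "\<dots> = step_mean h y" unfolding step_mean_def h_def
      by (intro sum.cong refl suminf_mult sw)
    finally show ?thesis by simp
  qed
  have off_eq: "h y - step_mean h y = f y - m" if y: "y \<in> S" "y \<noteq> s0" for y
  proof -
    have "step_mean h y = (\<Sum>n. w (Suc n) y)" unfolding Ph using y by (simp add: w_def K_def)
    also have "\<dots> = h y - w 0 y" unfolding h_def by (rule suminf_split_head[OF sw[OF y(1)]])
    finally show ?thesis using y by (simp add: w_def f0_def)
  qed
  \<comment> \<open>Integrated against \<mu>, both sides of the equation vanish. The residual lives
    on \<open>s0\<close> alone, where \<mu> has positive mass, so it is zero.\<close>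
  have "(\<Sum>y\<in>S. pmf \<mu> y * step_mean h y) = (\<Sum>z\<in>S. (\<Sum>y\<in>S. pmf \<mu> y * pmf (P y) z) * h z)"
    unfolding step_mean_def sum_distrib_left sum_distrib_right by (subst sum.swap) (simp add: mult_ac)
  also have "\<dots> = (\<Sum>z\<in>S. pmf \<mu> z * h z)" by (intro sum.cong refl) (simp add: mu)
  finally have "(\<Sum>y\<in>S. pmf \<mu> y * (h y - step_mean h y - (f y - m))) = - (\<Sum>y\<in>S. pmf \<mu> y * (f y - m))"
    by (simp add: right_diff_distrib sum_subtractf)
  also have "(\<Sum>y\<in>S. pmf \<mu> y * (f y - m)) = 0"
    by (simp add: right_diff_distrib sum_subtractf sum_distrib_right[symmetric] sum_pmf_eq_1[OF finite_S muS] m_def[symmetric])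
  finally have "(\<Sum>y\<in>S. pmf \<mu> y * (h y - step_mean h y - (f y - m))) = 0" by simp
  also have "(\<Sum>y\<in>S. pmf \<mu> y * (h y - step_mean h y - (f y - m))) =
      (\<Sum>y\<in>S. if y = s0 then pmf \<mu> s0 * (h s0 - step_mean h s0 - (f s0 - m)) else 0)"
    by (intro sum.cong refl) (auto simp: off_eq)
  also have "\<dots> = pmf \<mu> s0 * (h s0 - step_mean h s0 - (f s0 - m))" using finite_S s0 by simp
  finally have "h s0 - step_mean h s0 = f s0 - m" using s0 by simp
  with off_eq have "h y - step_mean h y = f y - m" if "y \<in> S" for y using that by (cases "y = s0") auto
  then show thesis using that unfolding m_def by blast
qed

end

section \<open>Rewards and optimistic choices\<close>

sublocale restless_bandit \<subseteq> irreducible_chain S P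
  by unfold_locales (rule states transition irreducible)+

text \<open>The maximisers of a linear functional form a face; its extreme points are extreme points
  of \<open>A\<close>, and the maximiser \<open>a\<close> lies in their hull. This carries
  information about vertices over to whichever maximiser the algorithm picks.\<close>

lemma inner_eq_on_convex_compact:
  fixes A :: "'a :: euclidean_space set"
  assumes A: "compact A" "convex A" and a: "a \<in> A" "\<And>a'. a' \<in> A \<Longrightarrow> c \<bullet> a' \<le> c \<bullet> a"
    and ext: "\<And>v. v extreme_point_of A \<Longrightarrow> c \<bullet> v = c \<bullet> a \<Longrightarrow> d \<bullet> v = m"
  shows "d \<bullet> a = m"
proof -
  let ?F = "A \<inter> {x. c \<bullet> x = c \<bullet> a}"
  have F: "?F face_of A" by (rule face_of_Int_supporting_hyperplane_le[OF A(2) a(2)])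
  have "compact ?F" "convex ?F"
    using A by (auto intro: compact_Int_closed closed_hyperplane convex_Int convex_hyperplane)
  then have "?F = convex hull {x. x extreme_point_of ?F}" by (rule Krein_Milman_Minkowski)
  also have "\<dots> \<subseteq> {x. d \<bullet> x = m}"
    by (rule hull_minimal) (use ext in \<open>auto simp: extreme_point_of_face[OF F] convex_hyperplane\<close>)
  finally show ?thesis using a by auto
qed

text \<open>Turns an estimated transition row into a \<open>pmf\<close>, the form in which stability
  is stated.\<close>

lemma pmf_on_finite_exists:
  fixes f :: "'a \<Rightarrow> real"
  assumes "finite S" "\<And>x. x \<in> S \<Longrightarrow> 0 \<le> f x" "sum f S = 1"
  shows "\<exists>p. set_pmf p \<subseteq> S \<and> (\<forall>x\<in>S. pmf p x = f x)"
proof -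
  define g where "g x = (if x \<in> S then f x else 0)" for x
  have g0: "\<And>x. 0 \<le> g x" using assms by (auto simp: g_def)
  have "(\<integral>\<^sup>+x. ennreal (g x) \<partial>count_space UNIV) = (\<Sum>x\<in>S. ennreal (g x))"
    using assms by (intro nn_integral_count_space') (auto simp: g_def)
  also have "\<dots> = ennreal (\<Sum>x\<in>S. g x)" by (rule sum_ennreal) (rule g0)
  also have "(\<Sum>x\<in>S. g x) = 1" using assms by (simp add: g_def)
  finally have p: "(\<integral>\<^sup>+x. ennreal (g x) \<partial>count_space UNIV) = 1" by simp
  have "\<forall>x\<in>S. pmf (embed_pmf g) x = f x" using pmf_embed_pmf[OF g0 p] by (simp add: g_def[abs_def])
  moreover have "set_pmf (embed_pmf g) \<subseteq> S"
    unfolding set_embed_pmf[OF g0 p] by (auto simp: g_def)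
  ultimately show ?thesis by blast
qed

context restless_bandit
begin

abbreviation all_params :: "(real^'n) set" where "all_params \<equiv> params S B \<Theta>"

abbreviation rmax :: real where "rmax \<equiv> r_max S B A \<Theta>"

lemma A_compact: "compact A" and A_convex: "convex A"
  using actions polytope_imp_compact polytope_imp_convex by auto


text \<open>Full dimension gives \<open>A\<close> interior points, and by convexity every point of
  \<open>A\<close>, boundary points included, is a limit of them.\<close>

lemma A_closure_interior: "A \<subseteq> closure (interior A)" and A_nonempty: "A \<noteq> {}"
proof -
  have "interior A = rel_interior A"
    using interior_rel_interior_gen[of A] actions by simp
  moreover have ne: "A \<noteq> {}" using actions by auto
  ultimately have "interior A \<noteq> {}" using A_convex by (simp add: rel_interior_eq_empty)
  then have "closure (interior A) = closure A" by (rule convex_closure_interior[OF A_convex])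
  then show "A \<subseteq> closure (interior A)" using closure_subset by auto
  show "A \<noteq> {}" by (rule ne)
qed

lemma finite_all_params: "finite (all_params)"
  unfolding params_def using states arms finite_params by auto

lemma in_params: "b \<in> B \<Longrightarrow> s \<in> S \<Longrightarrow> x \<in> \<Theta> b s \<Longrightarrow> x \<in> all_params"
  unfolding params_def by auto

lemma sum_Q: "b \<in> B \<Longrightarrow> s \<in> S \<Longrightarrow> (\<Sum>x\<in>\<Theta> b s. pmf (Q b s) x) = 1"
  using finite_params param_law by (intro sum_pmf_eq_1) auto

lemma Theta_nonempty: "b \<in> B \<Longrightarrow> s \<in> S \<Longrightarrow> \<Theta> b s \<noteq> {}"
  using param_law[of b s] set_pmf_not_empty[of "Q b s"] by auto

lemma params_nonempty: "all_params \<noteq> {}"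
  using states arms Theta_nonempty unfolding params_def by fastforce

lemma card_Theta_ge_1: "b \<in> B \<Longrightarrow> s \<in> S \<Longrightarrow> 1 \<le> card (\<Theta> b s)"
  using Theta_nonempty finite_params by (simp add: Suc_le_eq card_gt_0_iff)

lemma card_Theta_le: "b \<in> B \<Longrightarrow> s \<in> S \<Longrightarrow> card (\<Theta> b s) \<le> C_\<Theta> S B \<Theta>"
proof -
  have "finite {card (\<Theta> b s) | b s. b \<in> B \<and> s \<in> S}"
    by (rule finite_subset[of _ "(\<lambda>(b, s). card (\<Theta> b s)) ` (B \<times> S)"]) (use states arms in auto)
  then show "b \<in> B \<Longrightarrow> s \<in> S \<Longrightarrow> ?thesis" unfolding C_\<Theta>_def by (intro Max_ge) auto
qed

lemma C_\<Theta>_ge_1: "1 \<le> C_\<Theta> S B \<Theta>"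
proof -
  obtain b s where "b \<in> B" "s \<in> S" using states arms by blast
  with card_Theta_ge_1[of b s] card_Theta_le[of b s] show ?thesis by linarith
qed

lemma card_S_ge_1: "1 \<le> card S" and card_B_ge_1: "1 \<le> card B"
  using states arms by (simp_all add: Suc_le_eq card_gt_0_iff)

section \<open>One-step rewards, their maxima and their stability\<close>

definition true_reward :: "'s \<Rightarrow> 'b \<Rightarrow> real^'n \<Rightarrow> real" where
  "true_reward = expected_reward S \<Theta> (\<lambda>s. pmf (P s)) (\<lambda>b s. pmf (Q b s))"

lemma expected_reward_inner:
  "expected_reward S \<Theta> Pm Qm s b a = (\<Sum>s'\<in>S. Pm s s' *\<^sub>R (\<Sum>x\<in>\<Theta> b s'. Qm b s' x *\<^sub>R x)) \<bullet> a"
  unfolding expected_reward_def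
  by (simp add: inner_sum_left inner_commute[of a])

lemma true_reward_between:
  assumes s: "s \<in> S" and b: "b \<in> B"
  shows "(\<And>x. x \<in> all_params \<Longrightarrow> a \<bullet> x \<le> K) \<Longrightarrow> true_reward s b a \<le> K"
    and "(\<And>x. x \<in> all_params \<Longrightarrow> K \<le> a \<bullet> x) \<Longrightarrow> K \<le> true_reward s b a"
proof -
  have *: "(\<Sum>s'\<in>S. pmf (P s) s' * (\<Sum>x\<in>\<Theta> b s'. pmf (Q b s') x * K)) = K"
    using b by (simp add: sum_distrib_right[symmetric] sum_Q sum_P[OF s])
  show "true_reward s b a \<le> K" if "\<And>x. x \<in> all_params \<Longrightarrow> a \<bullet> x \<le> K"
  proof -
    have "true_reward s b a \<le> (\<Sum>s'\<in>S. pmf (P s) s' * (\<Sum>x\<in>\<Theta> b s'. pmf (Q b s') x * K))"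
      unfolding true_reward_def expected_reward_def
      by (intro sum_mono mult_left_mono that in_params[OF b]) auto
    with * show ?thesis by simp
  qed
  show "K \<le> true_reward s b a" if "\<And>x. x \<in> all_params \<Longrightarrow> K \<le> a \<bullet> x"
  proof -
    have "(\<Sum>s'\<in>S. pmf (P s) s' * (\<Sum>x\<in>\<Theta> b s'. pmf (Q b s') x * K)) \<le> true_reward s b a"
      unfolding true_reward_def expected_reward_def
      by (intro sum_mono mult_left_mono that in_params[OF b]) auto
    with * show ?thesis by simp
  qed
qed

lemma rewards_bounded: "\<exists>K. \<forall>a\<in>A. \<forall>x\<in>all_params. \<bar>a \<bullet> x\<bar> \<le> K"
proof -
  obtain R where R: "\<And>a. a \<in> A \<Longrightarrow> norm a \<le> R"
    using compact_imp_bounded[OF A_compact] by (auto simp: bounded_iff)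
  define R' where "R' = Max (norm ` all_params)"
  have R': "norm x \<le> R'" if "x \<in> all_params" for x
    unfolding R'_def using finite_all_params that by (intro Max_ge) auto
  have "\<bar>a \<bullet> x\<bar> \<le> R * R'" if "a \<in> A" "x \<in> all_params" for a x
  proof -
    have "\<bar>a \<bullet> x\<bar> \<le> norm a * norm x" by (rule Cauchy_Schwarz_ineq2)
    also have "\<dots> \<le> R * R'" using R[OF that(1)] R'[OF that(2)] norm_ge_zero[of a] norm_ge_zero[of x] by (intro mult_mono; linarith)
    finally show ?thesis .
  qed
  then show ?thesis by blast
qed

lemma inner_diff_le_r_max:
  assumes "a \<in> A" "a' \<in> A" "x \<in> all_params" "x' \<in> all_params"
  shows "a \<bullet> x - a' \<bullet> x' \<le> rmax"
proof -
  obtain K where K: "\<And>a x. a \<in> A \<Longrightarrow> x \<in> all_params \<Longrightarrow> \<bar>a \<bullet> x\<bar> \<le> K" using rewards_bounded by blast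
  show ?thesis unfolding r_max_def
  proof (rule cSup_upper)
    show "bdd_above {a \<bullet> x - a' \<bullet> x' | a a' x x'. a \<in> A \<and> a' \<in> A \<and> x \<in> all_params \<and> x' \<in> all_params}"
    proof (rule bdd_aboveI[of _ "2 * K"], safe)
      fix a a' x x' assume "a \<in> A" "a' \<in> A" "x \<in> all_params" "x' \<in> all_params"
      with K[of a x] K[of a' x'] show "a \<bullet> x - a' \<bullet> x' \<le> 2 * K" by linarith
    qed
  qed (use assms in blast)
qed

lemma r_max_nonneg: "0 \<le> rmax"
proof -
  obtain a x where "a \<in> A" "x \<in> all_params" using A_nonempty params_nonempty by blast
  with inner_diff_le_r_max[of a a x x] show ?thesis by simp
qed

lemma true_reward_diff_le:
  assumes s: "s \<in> S" "s' \<in> S" and b: "b \<in> B" "b' \<in> B" and a: "a \<in> A" "a' \<in> A"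
  shows "true_reward s b a - true_reward s' b' a' \<le> rmax"
proof -
  have "true_reward s b a \<le> a' \<bullet> x' + rmax" if "x' \<in> all_params" for x'
    using inner_diff_le_r_max[OF a _ that] by (intro true_reward_between s b) (simp add: algebra_simps)
  then have "true_reward s b a - rmax \<le> true_reward s' b' a'"
    by (intro true_reward_between s b) (simp add: algebra_simps)
  then show ?thesis by simp
qed

definition best_reward :: "'s \<Rightarrow> real" where
  "best_reward s = Sup ((\<lambda>(b, a). true_reward s b a) ` (B \<times> A))"

lemma best_reward_attained:
  obtains b a where "b \<in> B" "a \<in> A" "true_reward s b a = best_reward s"
    "\<And>b' a'. b' \<in> B \<Longrightarrow> a' \<in> A \<Longrightarrow> true_reward s b' a' \<le> best_reward s"
proof -
  have "\<exists>a\<in>A. \<forall>a'\<in>A. true_reward s b a' \<le> true_reward s b a" for b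
    unfolding true_reward_def expected_reward_inner
    by (rule continuous_attains_sup[OF A_compact A_nonempty]) (intro continuous_intros)
  then obtain m where m: "\<And>b. m b \<in> A" "\<And>b a'. a' \<in> A \<Longrightarrow> true_reward s b a' \<le> true_reward s b (m b)"
    by metis
  let ?g = "\<lambda>b. true_reward s b (m b)"
  have "Max (?g ` B) \<in> ?g ` B" using arms by (intro Max_in) auto
  then obtain b where b: "b \<in> B" "?g b = Max (?g ` B)" by auto
  have le: "true_reward s b' a' \<le> ?g b" if "b' \<in> B" "a' \<in> A" for b' a'
  proof -
    have "?g b' \<le> ?g b" unfolding b(2) using that arms by (intro Max_ge) auto
    with m(2)[OF that(2), of b'] show ?thesis by linarith
  qed
  have "best_reward s = ?g b"
    unfolding best_reward_def by (rule cSup_eq_maximum) (use b m le in \<open>auto intro!: image_eqI[of _ _ "(b, m b)"]\<close>)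
  then show thesis using that[of b "m b"] b m le by auto
qed

lemma true_reward_le_best: "b \<in> B \<Longrightarrow> a \<in> A \<Longrightarrow> true_reward s b a \<le> best_reward s"
  using best_reward_attained by metis

text \<open>A policy chooses in each state separately, so statewise maximisers form an admissible
  policy. Only the value is pinned down: states of zero stationary mass leave the choice
  free.\<close>

lemma optimal_policy_value:
  assumes "optimal_policy S B A \<Theta> P Q \<mu> \<pi>"
  shows "policy_value S \<Theta> P Q \<mu> \<pi> = (\<Sum>s\<in>S. pmf \<mu> s * best_reward s)"
proof -
  have pv: "policy_value S \<Theta> P Q \<mu> \<pi>' = (\<Sum>s\<in>S. pmf \<mu> s * true_reward s (fst (\<pi>' s)) (snd (\<pi>' s)))" for \<pi>'
    unfolding policy_value_def true_reward_def ..
  obtain \<pi>' where \<pi>': "\<And>s. fst (\<pi>' s) \<in> B" "\<And>s. snd (\<pi>' s) \<in> A"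
    "\<And>s. true_reward s (fst (\<pi>' s)) (snd (\<pi>' s)) = best_reward s"
  proof -
    have "\<forall>s. \<exists>p. fst p \<in> B \<and> snd p \<in> A \<and> true_reward s (fst p) (snd p) = best_reward s"
      using best_reward_attained by (metis fst_conv snd_conv)
    then show thesis using that by metis
  qed
  have "\<pi>' \<in> S \<rightarrow> B \<times> A" using \<pi>' by (auto simp: mem_Times_iff)
  then have "policy_value S \<Theta> P Q \<mu> \<pi>' \<le> policy_value S \<Theta> P Q \<mu> \<pi>"
    using assms unfolding optimal_policy_def by blast
  moreover have "policy_value S \<Theta> P Q \<mu> \<pi> \<le> (\<Sum>s\<in>S. pmf \<mu> s * best_reward s)"
    unfolding pv using assms unfolding optimal_policy_def
    by (intro sum_mono mult_left_mono true_reward_le_best) (auto simp: Pi_iff mem_Times_iff)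
  ultimately show ?thesis by (simp add: pv[of \<pi>'] \<pi>')
qed

text \<open>Stability compares extreme points only, while \<open>a\<close> may be any maximiser in
  \<open>A\<close>. Every extreme point with the same perturbed value as \<open>a\<close> gives an
  optimal pair of the perturbed model, hence of the true one;
  \<open>inner_eq_on_convex_compact\<close> passes this to \<open>a\<close>.\<close>

lemma stable_argmax_optimal:
  assumes stable: "optimal_pairs_stable S B A \<Theta> P Q \<delta>"
    and P': "transition_matrix_on S P'" "\<And>s s'. s \<in> S \<Longrightarrow> s' \<in> S \<Longrightarrow> \<bar>pmf (P' s) s' - pmf (P s) s'\<bar> \<le> \<delta>"
    and Q': "\<And>b s. b \<in> B \<Longrightarrow> s \<in> S \<Longrightarrow> set_pmf (Q' b s) \<subseteq> \<Theta> b s"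
      "\<And>b s x. b \<in> B \<Longrightarrow> s \<in> S \<Longrightarrow> x \<in> \<Theta> b s \<Longrightarrow> \<bar>pmf (Q' b s) x - pmf (Q b s) x\<bar> \<le> \<delta>"
    and s: "s \<in> S" and ba: "b \<in> B" "a \<in> A"
    and max: "\<And>b' a'. b' \<in> B \<Longrightarrow> a' \<in> A \<Longrightarrow>
      expected_reward S \<Theta> (\<lambda>s. pmf (P' s)) (\<lambda>b s. pmf (Q' b s)) s b' a'
        \<le> expected_reward S \<Theta> (\<lambda>s. pmf (P' s)) (\<lambda>b s. pmf (Q' b s)) s b a"
  shows "true_reward s b a = best_reward s"
proof -
  let ?r' = "expected_reward S \<Theta> (\<lambda>s. pmf (P' s)) (\<lambda>b s. pmf (Q' b s)) s"
  have eq: "optimal_pairs S B A \<Theta> P' Q' s = optimal_pairs S B A \<Theta> P Q s"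
    using stable P' Q' s unfolding optimal_pairs_stable_def by blast
  have "true_reward s b v = best_reward s" if v: "v extreme_point_of A" "?r' b v = ?r' b a" for v
  proof -
    have "(b, v) \<in> optimal_pairs S B A \<Theta> P' Q' s"
      using v ba max unfolding optimal_pairs_def is_arg_max_linorder
      by (auto simp: extreme_point_of_def)
    then have "(b, v) \<in> optimal_pairs S B A \<Theta> P Q s" using eq by simp
    then have opt: "true_reward s b' v' \<le> true_reward s b v" if "b' \<in> B" "v' extreme_point_of A" for b' v'
      using that unfolding optimal_pairs_def is_arg_max_linorder true_reward_def by auto
    \<comment> \<open>A linear bound at the extreme points extends to their hull.\<close>
    have le: "true_reward s b' a' \<le> true_reward s b v" if "b' \<in> B" "a' \<in> A" for b' a'
    proof -
      let ?H = "{x. (\<Sum>s'\<in>S. pmf (P s) s' *\<^sub>R (\<Sum>x\<in>\<Theta> b' s'. pmf (Q b' s') x *\<^sub>R x)) \<bullet> x \<le> true_reward s b v}"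
      have "A = convex hull {x. x extreme_point_of A}"
        by (rule Krein_Milman_Minkowski[OF A_compact A_convex])
      also have "\<dots> \<subseteq> ?H"
        using opt[OF that(1)] unfolding true_reward_def expected_reward_inner
        by (intro hull_minimal convex_halfspace_le) auto
      finally show ?thesis using that(2) unfolding true_reward_def expected_reward_inner by auto
    qed
    obtain b' a' where "b' \<in> B" "a' \<in> A" "true_reward s b' a' = best_reward s"
      using best_reward_attained by metis
    with le[of b' a'] true_reward_le_best[OF ba(1), of v s] v(1) show ?thesis
      by (auto simp: extreme_point_of_def intro: antisym)
  qed
  then show ?thesis
    unfolding true_reward_def expected_reward_inner
    using max[OF ba(1)] unfolding expected_reward_inner
    by (intro inner_eq_on_convex_compact[OF A_compact A_convex ba(2)]) blast+
qed

text \<open>The maximising parameter laws need only be close to the true ones at the chosen arm. Replacing them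
  by the true laws at all other arms keeps the chosen pair optimal, since the family so obtained is still
  plausible.\<close>

lemma optimistic_choice_optimal:
  assumes stable: "optimal_pairs_stable S B A \<Theta> P Q \<delta>" and \<delta>: "0 \<le> \<delta>"
    and sh: "\<And>u. sh u \<in> S"
    and N: "\<And>s. s \<in> S \<Longrightarrow> count_S sh t s > 0"
    and close: "\<And>s s'. s \<in> S \<Longrightarrow> s' \<in> S \<Longrightarrow> \<bar>est_P S sh t s s' - pmf (P s) s'\<bar> \<le> \<delta>"
    and supp: "\<And>s s'. s \<in> S \<Longrightarrow> s' \<in> S \<Longrightarrow> pmf (P s) s' = 0 \<Longrightarrow> est_P S sh t s s' = 0"
    and true_plausible: "plausible \<alpha> S B \<Theta> arm sh xh t Q"
    and choice: "optimistic_choice \<alpha> S B A \<Theta> arm sh xh t s p" and s: "s \<in> S"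
    and conf: "\<And>s'. s' \<in> S \<Longrightarrow> pmf (P s) s' > 0 \<Longrightarrow> conf_\<Theta> \<alpha> S B \<Theta> arm sh t (fst p) s' \<le> \<delta> / 2"
  shows "true_reward s (fst p) (snd p) = best_reward s"
proof -
  obtain b a where p: "p = (b, a)" by fastforce
  obtain Q' where ba: "b \<in> B" "a \<in> A" and Q': "plausible \<alpha> S B \<Theta> arm sh xh t Q'"
    and max: "\<And>b' a' Q''. b' \<in> B \<Longrightarrow> a' \<in> A \<Longrightarrow> plausible \<alpha> S B \<Theta> arm sh xh t Q'' \<Longrightarrow>
        expected_reward S \<Theta> (est_P S sh t) (\<lambda>b s. pmf (Q'' b s)) s b' a'
          \<le> expected_reward S \<Theta> (est_P S sh t) (\<lambda>b s. pmf (Q' b s)) s b a"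
    using choice unfolding optimistic_choice_def is_arg_max_linorder p by auto
  \<comment> \<open>All counts are positive, so no default row occurs; each counted visit leads to
    exactly one next state, so a row sums to 1.\<close>
  have "\<exists>p. set_pmf p \<subseteq> S \<and> (\<forall>s'\<in>S. pmf p s' = est_P S sh t y s')" if y: "y \<in> S" for y
  proof (rule pmf_on_finite_exists[OF states(1)])
    show "0 \<le> est_P S sh t y s'" for s' by (simp add: est_P_def)
    have "(\<Sum>s'\<in>S. count_SS sh t y s') = card (\<Union>s'\<in>S. {u \<in> {1..<t}. sh (u - 1) = y \<and> sh u = s'})"
      unfolding count_SS_def using states by (intro card_UN_disjoint[symmetric]) auto
    also have "(\<Union>s'\<in>S. {u \<in> {1..<t}. sh (u - 1) = y \<and> sh u = s'}) = {u \<in> {1..<t}. sh (u - 1) = y}"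
      using sh by auto
    finally have "(\<Sum>s'\<in>S. real (count_SS sh t y s')) = real (count_S sh t y)"
      unfolding count_S_def by (simp flip: of_nat_sum)
    then show "sum (est_P S sh t y) S = 1"
      using N[OF y] by (simp add: est_P_def flip: sum_divide_distrib)
  qed
  then obtain P' where P': "\<And>y. y \<in> S \<Longrightarrow> set_pmf (P' y) \<subseteq> S"
      "\<And>y s'. y \<in> S \<Longrightarrow> s' \<in> S \<Longrightarrow> pmf (P' y) s' = est_P S sh t y s'" by metis
  \<comment> \<open>At the chosen arm the optimistic laws survive only at possible next states,
    where the radius is controlled. Elsewhere \<open>est_P\<close> vanishes, so the value of the
    chosen pair is unchanged.\<close>
  define Q'' where "Q'' b' s' = (if b' = b \<and> pmf (P s) s' > 0 then Q' b' s' else Q b' s')" for b' s'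
  have er: "expected_reward S \<Theta> (\<lambda>s. pmf (P' s)) R s = expected_reward S \<Theta> (est_P S sh t) R s" for R
    unfolding expected_reward_def using P'(2)[OF s] by (intro ext sum.cong) auto
  have Q''p: "plausible \<alpha> S B \<Theta> arm sh xh t Q''"
    using Q' true_plausible unfolding plausible_def Q''_def by auto
  have QQ: "expected_reward S \<Theta> (est_P S sh t) (\<lambda>b s. pmf (Q'' b s)) s b =
      expected_reward S \<Theta> (est_P S sh t) (\<lambda>b s. pmf (Q' b s)) s b"
    unfolding expected_reward_def
  proof (intro ext sum.cong refl)
    fix a s' assume s': "s' \<in> S"
    show "est_P S sh t s s' * (\<Sum>x\<in>\<Theta> b s'. pmf (Q'' b s') x * (a \<bullet> x)) =
        est_P S sh t s s' * (\<Sum>x\<in>\<Theta> b s'. pmf (Q' b s') x * (a \<bullet> x))"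
      using supp[OF s s'] by (cases "pmf (P s) s' = 0") (simp_all add: Q''_def less_le)
  qed
  have "true_reward s b a = best_reward s"
  proof (rule stable_argmax_optimal[OF stable, of P' Q''])
    show "transition_matrix_on S P'" using P' by (auto simp: transition_matrix_on_def)
    show "\<bar>pmf (P' s) s' - pmf (P s) s'\<bar> \<le> \<delta>" if "s \<in> S" "s' \<in> S" for s s'
      using close[OF that] P'(2)[OF that] by simp
    show "set_pmf (Q'' b s) \<subseteq> \<Theta> b s" if "b \<in> B" "s \<in> S" for b s
      using Q''p that unfolding plausible_def by blast
    show "\<bar>pmf (Q'' b' s') x - pmf (Q b' s') x\<bar> \<le> \<delta>" if b': "b' \<in> B" "s' \<in> S" "x \<in> \<Theta> b' s'" for b' s' x
    proof (cases "b' = b \<and> pmf (P s) s' > 0")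
      case True
      \<comment> \<open>Both laws lie within the radius of the same estimate; hence the bound
        \<delta>/2 on the radius.\<close>
      have "\<bar>pmf (Q' b' s') x - est_Q \<Theta> arm sh xh t b' s' x\<bar> \<le> conf_\<Theta> \<alpha> S B \<Theta> arm sh t b' s'"
        "\<bar>pmf (Q b' s') x - est_Q \<Theta> arm sh xh t b' s' x\<bar> \<le> conf_\<Theta> \<alpha> S B \<Theta> arm sh t b' s'"
        using Q' true_plausible b' unfolding plausible_def by auto
      moreover have "conf_\<Theta> \<alpha> S B \<Theta> arm sh t b' s' \<le> \<delta> / 2" using conf[OF b'(2)] True p by simp
      ultimately show ?thesis using True by (simp add: Q''_def)
    qed (use \<delta> in \<open>auto simp: Q''_def\<close>)
  qed (use s ba max[OF _ _ Q''p] QQ er in auto)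
  then show ?thesis by (simp add: p)
qed

section \<open>Volume and radius of the exploration regions\<close>

lemma A_borel[measurable]: "A \<in> sets borel"
  using A_compact by (simp add: compact_imp_closed)

lemma explore_region_borel: "explore_region \<epsilon> \<alpha>\<^sub>\<epsilon> S B A \<Theta> t c \<in> sets borel"
  unfolding explore_region_def by measurable

text \<open>The centre may sit on the boundary of \<open>A\<close>, but interior points lie
  arbitrarily close, so the region contains a nonempty open set; compactness bounds its volume.
  Hence \<open>uniform_measure\<close> is a probability measure here.\<close>

lemma explore_region_measure:
  assumes c: "c \<in> A" and r: "0 < explore_radius \<epsilon> \<alpha>\<^sub>\<epsilon> S B \<Theta> t"
  shows "emeasure lborel (explore_region \<epsilon> \<alpha>\<^sub>\<epsilon> S B A \<Theta> t c) \<noteq> 0"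
    and "emeasure lborel (explore_region \<epsilon> \<alpha>\<^sub>\<epsilon> S B A \<Theta> t c) \<noteq> \<infinity>"
proof -
  let ?E = "explore_region \<epsilon> \<alpha>\<^sub>\<epsilon> S B A \<Theta> t c"
  have "emeasure lborel ?E \<le> emeasure lborel A"
    by (rule emeasure_mono) (auto simp: explore_region_def)
  also have "\<dots> < \<infinity>" using compact_imp_bounded[OF A_compact] by (intro emeasure_bounded_finite)
  finally show "emeasure lborel ?E \<noteq> \<infinity>" by simp
  obtain e where e: "0 < e" "ereal e < explore_radius \<epsilon> \<alpha>\<^sub>\<epsilon> S B \<Theta> t"
    using ereal_dense2[OF r] by (auto simp: zero_ereal_def)
  have "c \<in> closure (interior A)" using A_closure_interior c by blast
  then obtain y where y: "y \<in> interior A" "dist y c < e" using e(1) unfolding closure_approachable by blast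
  let ?U = "interior A \<inter> ball c e"
  have "open ?U" by auto
  moreover have "y \<in> ?U" using y by (auto simp: dist_commute)
  ultimately have "\<not> negligible ?U" using open_not_negligible by blast
  then have "emeasure lborel ?U \<noteq> 0"
    using null_sets_completion_iff2[of lborel] by (auto simp: negligible_iff_null_sets null_sets_def)
  moreover have "?U \<subseteq> ?E"
  proof
    fix a assume a: "a \<in> ?U"
    then have "dist c a < e" by auto
    then have "ereal (dist c a) \<le> explore_radius \<epsilon> \<alpha>\<^sub>\<epsilon> S B \<Theta> t" using e(2) by (metis ereal_less_eq(3) less_imp_le order_trans)
    with a show "a \<in> ?E" using interior_subset by (auto simp: explore_region_def)
  qed
  then have "emeasure lborel ?U \<le> emeasure lborel ?E" by (intro emeasure_mono) (auto simp: explore_region_borel)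
  ultimately show "emeasure lborel ?E \<noteq> 0" by auto
qed

lemma explore_radius_pos:
  assumes "0 < \<epsilon>"
  shows "0 < explore_radius \<epsilon> \<alpha>\<^sub>\<epsilon> S B \<Theta> t"
proof -
  have "norm1 x \<ge> 0" for x :: "real^'n" unfolding norm1_def by (simp add: sum_nonneg)
  then have "0 \<le> Max (norm1 ` all_params)"
    using finite_all_params params_nonempty by (subst Max_ge_iff) auto
  then have "0 \<le> 10 * real t powr \<alpha>\<^sub>\<epsilon> * Max (norm1 ` all_params)" by simp
  \<comment> \<open>Division by 0 gives infinity in \<open>ereal\<close>, so t = 0 is
    included.\<close>
  moreover have "0 < ereal \<epsilon> / ereal x" if "0 \<le> x" for x
    using that assms by (cases "x = 0") (auto simp: divide_ereal_def)
  ultimately show ?thesis unfolding explore_radius_def by blast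
qed

end

section \<open>Rounds of the algorithm\<close>

lemma round_start_le: "round_start \<alpha> S B \<Theta> arm sh t \<le> t"
  by (induction t) auto

lemma round_start_cases:
  "round_start \<alpha> S B \<Theta> arm sh t = t \<or>
   round_start \<alpha> S B \<Theta> arm sh t < t \<and> round_continues \<alpha> S B \<Theta> arm sh (round_start \<alpha> S B \<Theta> arm sh t) t"
  using round_start_le[of \<alpha> S B \<Theta> arm sh "t - 1"] by (cases t) auto

lemma round_start_idem:
  "round_start \<alpha> S B \<Theta> arm sh (round_start \<alpha> S B \<Theta> arm sh t) = round_start \<alpha> S B \<Theta> arm sh t"
  by (induction t) auto

lemma count_S_le: "count_S sh t s \<le> t - 1"
proof -
  have "count_S sh t s \<le> card {1..<t}" unfolding count_S_def by (rule card_mono) auto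
  then show ?thesis by simp
qed

text \<open>A round ends once a radius has halved: above \<open>d\<close> at the start, it is still
  above d/2 at \<open>t\<close>. Solving for the count gives the bound, with the logarithm enlarged
  to be uniform in \<open>t\<close>, arm and state.\<close>

lemma count_BS_le_of_conf_ge:
  assumes d: "0 < d" and conf: "d < conf_\<Theta> \<alpha> S B \<Theta> arm sh (round_start \<alpha> S B \<Theta> arm sh t) b s"
    and b: "b \<in> B" and s: "s \<in> S" and t: "t \<le> T" and \<alpha>: "0 \<le> \<alpha>"
    and card: "1 \<le> card (\<Theta> b s)" "card (\<Theta> b s) \<le> C" "1 \<le> card B" "1 \<le> card S" and T: "1 \<le> T"
  shows "real (count_BS arm sh t b s) \<le> 2 * ln (4 * real T powr \<alpha> * real C * real (card B) * real (card S)) / d\<^sup>2"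
proof -
  let ?n = "real (count_BS arm sh t b s)"
  let ?X = "4 * real (t - 1) powr \<alpha> * real (card (\<Theta> b s)) * real (card B) * real (card S)"
  let ?Y = "4 * real T powr \<alpha> * real C * real (card B) * real (card S)"
  have ct: "d / 2 < conf_\<Theta> \<alpha> S B \<Theta> arm sh t b s"
  proof (cases "round_start \<alpha> S B \<Theta> arm sh t = t")
    case True
    then show ?thesis using conf d by simp
  next
    case False
    then have "round_continues \<alpha> S B \<Theta> arm sh (round_start \<alpha> S B \<Theta> arm sh t) t"
      using round_start_cases by metis
    then show ?thesis using conf b s unfolding round_continues_def by force
  qed
  have ge1: "1 \<le> 4 * x powr \<alpha> * real c * real (card B) * real (card S)" if "1 \<le> x" "1 \<le> c" for x c
  proof -
    have "1 \<le> x powr \<alpha>" using that \<alpha> by (simp add: ge_one_powr_ge_zero)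
    then have "1 * 1 * 1 * 1 * 1 \<le> 4 * x powr \<alpha> * real c * real (card B) * real (card S)"
      using card that by (intro mult_mono) auto
    then show ?thesis by simp
  qed
  have C1: "1 \<le> C" using card by linarith
  show ?thesis
  proof (cases "t \<le> 1 \<or> count_BS arm sh t b s = 0")
    case True
    then have "?n = 0" by (auto simp: count_BS_def)
    moreover have "0 \<le> ln ?Y" using ge1[OF _ C1, of "real T"] T by simp
    ultimately show ?thesis by simp
  next
    case False
    then have n: "?n > 0" and t1: "1 \<le> real (t - 1)" by auto
    have "d / 2 < sqrt (ln ?X / (2 * ?n))"
      using ct False by (simp add: conf_\<Theta>_def)
    then have "(d / 2)\<^sup>2 < (sqrt (ln ?X / (2 * ?n)))\<^sup>2" using d by (intro power_strict_mono) auto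
    moreover have X: "0 \<le> ln ?X" using ge1[OF t1 card(1)] by simp
    ultimately have "(d / 2)\<^sup>2 < ln ?X / (2 * ?n)" using n by simp
    then have "?n < 2 * ln ?X / d\<^sup>2" using n d by (simp add: field_simps power2_eq_square)
    also have "ln ?X \<le> ln ?Y"
    proof (rule ln_mono)
      have "real (t - 1) powr \<alpha> \<le> real T powr \<alpha>" using t \<alpha> by (intro powr_mono2) auto
      then show "?X \<le> ?Y" using card by (intro mult_mono) auto
    qed (use ge1[OF t1 card(1)] in linarith)+
    finally show ?thesis using d by (simp add: divide_right_mono)
  qed
qed

text \<open>The logarithm is at least ln 4 >= 1 and the count at most \<open>u - 1\<close>, so no
  radius falls below order u^(-1/2), whatever the data. The summand 1 covers u = 0.\<close>

lemma conf_S_lower: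
  assumes \<alpha>: "0 \<le> \<alpha>" and S: "1 \<le> card S"
  shows "sqrt (1 / (2 * (real u + 1))) \<le> conf_S \<alpha> S sh u s"
proof -
  let ?x = "1 / (2 * (real u + 1))"
  have one: "sqrt ?x \<le> 1" by simp
  show ?thesis
  proof (cases "u \<le> 1 \<or> count_S sh u s = 0")
    case True
    then show ?thesis using one by (auto simp: conf_S_def)
  next
    case False
    then have n: "0 < real (count_S sh u s)" "real (count_S sh u s) \<le> real u + 1"
      using count_S_le[of sh u s] by auto
    have "1 * 1 \<le> real (u - 1) powr \<alpha> * (real (card S))\<^sup>2"
      using False \<alpha> S by (intro mult_mono ge_one_powr_ge_zero) (auto simp: one_le_power)
    then have "4 \<le> 4 * real (u - 1) powr \<alpha> * (real (card S))\<^sup>2" by simp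
    then have "ln 4 \<le> ln (4 * real (u - 1) powr \<alpha> * (real (card S))\<^sup>2)" by (intro ln_mono) auto
    moreover have "1 \<le> ln (4::real)" using exp_le by (subst ln_ge_iff) auto
    ultimately have "?x \<le> ln (4 * real (u - 1) powr \<alpha> * (real (card S))\<^sup>2) / (2 * real (count_S sh u s))"
      using n by (intro frac_le) auto
    then show ?thesis using False one by (simp add: conf_S_def)
  qed
qed

text \<open>Some state accounts for at least a fraction \<open>1 / |S|\<close> of all counts, so its confidence radius halves
  before the elapsed time has grown by more than a logarithmic factor.\<close>

lemma round_length_bound:
  assumes S: "finite S" "S \<noteq> {}" and \<alpha>: "0 \<le> \<alpha>" and \<eta>: "0 < \<eta>"
  shows "\<exists>C>0. \<forall>B \<Theta> arm sh t. (\<forall>u. sh u \<in> S) \<longrightarrow>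
    real t \<le> C * (real (round_start \<alpha> S B \<Theta> arm sh t) + 1) powr (1 + \<eta>)"
proof -
  define n where "n = real (card S)"
  have cS: "1 \<le> card S" using S by (simp add: Suc_le_eq card_gt_0_iff)
  have n: "1 \<le> n" using cS by (simp add: n_def)
  \<comment> \<open>Chosen with 1 - \<kappa> = 1 / (1 + \<eta>): the logarithm costs a factor
    \<open>x powr \<kappa>\<close>, and solving for \<open>x\<close> then yields the exponent 1 +
    \<eta>.\<close>
  define \<kappa> where "\<kappa> = \<eta> / (1 + \<eta>)"
  have \<kappa>: "0 < \<kappa>" "1 - \<kappa> = 1 / (1 + \<eta>)" using \<eta> by (auto simp: \<kappa>_def field_simps)
  define C1 where "C1 = ln (4 * n\<^sup>2) + \<alpha> / \<kappa>"
  have ln4: "0 < ln (4 * n\<^sup>2)" using n one_le_power[of n 2] by (intro ln_gt_zero) linarith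
  have C1: "0 < C1" using ln4 \<alpha> \<kappa> by (auto simp: C1_def intro!: add_pos_nonneg)
  have log: "ln (4 * x powr \<alpha> * n\<^sup>2) \<le> C1 * x powr \<kappa>" if x: "1 \<le> x" for x
  proof -
    have "ln (4 * x powr \<alpha> * n\<^sup>2) = ln (4 * n\<^sup>2) + \<alpha> * ln x"
      using x n by (simp add: ln_mult ln_powr)
    also have "\<dots> \<le> ln (4 * n\<^sup>2) * x powr \<kappa> + \<alpha> * (x powr \<kappa> / \<kappa>)"
    proof (intro add_mono mult_left_mono \<alpha>)
      have "ln (4 * n\<^sup>2) * 1 \<le> ln (4 * n\<^sup>2) * x powr \<kappa>"
        using ln4 x \<kappa> by (intro mult_left_mono ge_one_powr_ge_zero) auto
      then show "ln (4 * n\<^sup>2) \<le> ln (4 * n\<^sup>2) * x powr \<kappa>" by simp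
      show "ln x \<le> x powr \<kappa> / \<kappa>" by (rule ln_powr_bound[OF x \<kappa>(1)])
    qed
    finally show ?thesis by (simp add: C1_def algebra_simps)
  qed
  \<comment> \<open>The factor 2 comes from t <= 2 (t - 1), the summand 1 serves the cases t <= 1
    and u = t.\<close>
  define C where "C = 2 * (4 * n * C1) powr (1 + \<eta>) + 1"
  have C: "1 \<le> C" by (simp add: C_def)
  have "real t \<le> C * (real (round_start \<alpha> S B \<Theta> arm sh t) + 1) powr (1 + \<eta>)"
    if sh: "\<forall>u. sh u \<in> S" for B :: "'b set" and \<Theta> :: "'b \<Rightarrow> 'a \<Rightarrow> 'c set" and arm sh t
  proof -
    define u where "u = round_start \<alpha> S B \<Theta> arm sh t"
    have u1: "real u + 1 \<le> (real u + 1) powr (1 + \<eta>)"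
      using powr_mono[of 1 "1 + \<eta>" "real u + 1"] \<eta> by simp
    show ?thesis
    proof (cases "t \<le> 1 \<or> u = t")
      case True
      then have "real t \<le> 1 * (real u + 1)" by auto
      also have "\<dots> \<le> C * (real u + 1) powr (1 + \<eta>)" using C u1 by (intro mult_mono) auto
      finally show ?thesis by (simp add: u_def)
    next
      case False
      then have t: "2 \<le> t" and cont: "round_continues \<alpha> S B \<Theta> arm sh u t"
        using round_start_cases[of \<alpha> S B \<Theta> arm sh t] by (auto simp: u_def)
      define x where "x = real (t - 1)"
      have x: "1 \<le> x" "real t \<le> 2 * x" using t by (auto simp: x_def)
      have "(\<Sum>s\<in>S. count_S sh t s) = card (\<Union>s\<in>S. {v \<in> {1..<t}. sh (v - 1) = s})"
        unfolding count_S_def using S by (intro card_UN_disjoint[symmetric]) auto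
      also have "(\<Union>s\<in>S. {v \<in> {1..<t}. sh (v - 1) = s}) = {1..<t}" using sh by auto
      finally have sum: "(\<Sum>s\<in>S. real (count_S sh t s)) = x" by (simp add: x_def flip: of_nat_sum)
      obtain s where s: "s \<in> S" "x / n \<le> real (count_S sh t s)"
      proof (rule ccontr)
        assume "\<not> thesis"
        then have "(\<Sum>s\<in>S. real (count_S sh t s)) < (\<Sum>s\<in>S. x / n)"
          using that S by (intro sum_strict_mono) force+
        then show False using sum n by (simp add: n_def)
      qed
      let ?N = "real (count_S sh t s)"
      have xn: "0 < x / n" using x n by simp
      have N: "0 < ?N" using s(2) xn by linarith
      let ?L = "ln (4 * x powr \<alpha> * n\<^sup>2)"
      \<comment> \<open>Not halved since the start \<open>u\<close>: this bounds the radius of the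
        frequent state from below, hence its count, and with it \<open>t\<close>, from
        above.\<close>
      have "sqrt (1 / (2 * (real u + 1))) / 2 < conf_S \<alpha> S sh t s"
        using conf_S_lower[OF \<alpha> cS, of u sh s] cont s(1) unfolding round_continues_def by force
      also have "\<dots> \<le> sqrt (?L / (2 * ?N))"
        using t N by (simp add: conf_S_def x_def n_def)
      finally have "(sqrt (1 / (2 * (real u + 1))) / 2)\<^sup>2 < (sqrt (?L / (2 * ?N)))\<^sup>2"
        by (intro power_strict_mono) auto
      moreover have L0: "0 \<le> ?L"
      proof -
        have "1 * 1 * 1 \<le> 4 * x powr \<alpha> * n\<^sup>2"
          using x \<alpha> n by (intro mult_mono) (auto intro: ge_one_powr_ge_zero one_le_power)
        then show ?thesis by simp
      qed
      ultimately have "1 / (8 * (real u + 1)) < ?L / (2 * ?N)"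
        using N by (simp add: power_divide field_simps)
      also have "\<dots> \<le> ?L / (2 * (x / n))" using s(2) xn L0 N by (intro divide_left_mono mult_pos_pos) auto
      also have "\<dots> \<le> C1 * x powr \<kappa> / (2 * (x / n))" using log[OF x(1)] xn by (intro divide_right_mono) auto
      finally have "x < 4 * n * C1 * (real u + 1) * x powr \<kappa>"
        using x n by (simp add: field_simps)
      moreover have "x = x powr \<kappa> * x powr (1 - \<kappa>)" using x by (simp flip: powr_add)
      ultimately have "x powr \<kappa> * x powr (1 - \<kappa>) < x powr \<kappa> * (4 * n * C1 * (real u + 1))" by (simp add: mult_ac)
      then have "x powr (1 / (1 + \<eta>)) < 4 * n * C1 * (real u + 1)" using x \<kappa> by (simp add: mult_less_cancel_left_pos)
      then have "(x powr (1 / (1 + \<eta>))) powr (1 + \<eta>) \<le> (4 * n * C1 * (real u + 1)) powr (1 + \<eta>)"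
        using \<eta> by (intro powr_mono2) auto
      then have "x \<le> (4 * n * C1) powr (1 + \<eta>) * (real u + 1) powr (1 + \<eta>)"
        using x \<eta> n C1 by (simp add: powr_powr powr_mult)
      then have "real t \<le> 2 * (4 * n * C1) powr (1 + \<eta>) * (real u + 1) powr (1 + \<eta>)" using x by simp
      also have "\<dots> \<le> C * (real u + 1) powr (1 + \<eta>)" unfolding C_def by (intro mult_right_mono) auto
      finally show ?thesis by (simp add: u_def)
    qed
  qed
  then show ?thesis using C by (intro exI[of _ C]) auto
qed

section \<open>The run of the algorithm\<close>

lemma measurable_eq_const:
  assumes "f \<in> N \<rightarrow>\<^sub>M count_space X"
  shows "Measurable.pred N (\<lambda>w. f w = c)"
  using measurable_compose[OF assms, of "\<lambda>x. x = c" "count_space UNIV"] by simp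

lemma measurable_count_space_borel:
  assumes "f \<in> N \<rightarrow>\<^sub>M count_space X"
  shows "(\<lambda>w. g (f w)) \<in> borel_measurable N"
  using measurable_compose[OF assms, of g borel] by simp

locale tuned_run = algorithm_run S B A \<Theta> P Q \<mu> M \<alpha> \<epsilon> \<alpha>\<^sub>\<epsilon> init sh_init F st par arm act sh xh pol
  for S :: "'s set" and B :: "'b set" and A :: "(real^'n) set"
    and \<Theta> :: "'b \<Rightarrow> 's \<Rightarrow> (real^'n) set" and P :: "'s \<Rightarrow> 's pmf"
    and Q :: "'b \<Rightarrow> 's \<Rightarrow> (real^'n) pmf" and \<mu> :: "'s pmf" and M :: "'w measure"
    and \<alpha> \<epsilon> \<alpha>\<^sub>\<epsilon> init sh_init F st par arm act sh xh pol +
  assumes \<alpha>_gt: "3 < \<alpha>" and \<epsilon>_pos: "0 < \<epsilon>" and \<alpha>\<^sub>\<epsilon>_gt: "1 < \<alpha>\<^sub>\<epsilon>"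
begin

abbreviation arm_seq :: "'w \<Rightarrow> nat \<Rightarrow> 'b" where "arm_seq w \<equiv> \<lambda>u. arm u w"

abbreviation sh_seq :: "'w \<Rightarrow> nat \<Rightarrow> 's" where "sh_seq w \<equiv> \<lambda>u. sh u w"

abbreviation xh_seq :: "'w \<Rightarrow> nat \<Rightarrow> real^'n" where "xh_seq w \<equiv> \<lambda>u. xh u w"

abbreviation region :: "nat \<Rightarrow> real^'n \<Rightarrow> (real^'n) set" where
  "region t \<equiv> explore_region \<epsilon> \<alpha>\<^sub>\<epsilon> S B A \<Theta> t"

definition rstart :: "nat \<Rightarrow> 'w \<Rightarrow> nat" where
  "rstart t w = round_start \<alpha> S B \<Theta> (arm_seq w) (sh_seq w) t"

definition prev :: "nat \<Rightarrow> 'w \<Rightarrow> 's" where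
  "prev t w = (if t = 0 then sh_init else sh (t - 1) w)"

definition choice :: "nat \<Rightarrow> 'w \<Rightarrow> 'b \<times> (real^'n)" where
  "choice t w = pol (rstart t w) w (prev t w)"

definition center :: "nat \<Rightarrow> 'w \<Rightarrow> real^'n" where
  "center t w = snd (choice t w)"

definition kern :: "nat \<Rightarrow> 'w \<Rightarrow> 's pmf" where
  "kern t w = (if t = 0 then init else P (st (t - 1) w))"

lemma arm_eq: "w \<in> space M \<Longrightarrow> arm t w = fst (choice t w)"
  using arm_choice[of w t] by (simp add: choice_def rstart_def prev_def)

section \<open>Measurability with respect to the past\<close>

lemma F_sub: "subalgebra M (F t)" by (rule filtration)

lemmas M_meas = measurable_from_subalg[OF F_sub]

lemma F_sets: "H \<in> sets (F t) \<Longrightarrow> H \<in> sets M"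
  using F_sub[of t] by (auto simp: subalgebra_def)

lemma space_F: "space (F t) = space M" using F_sub[of t] by (simp add: subalgebra_def)

lemma F_le: "s \<le> t \<Longrightarrow> subalgebra (F t) (F s)"
proof (induction t rule: nat_induct)
  case (Suc t)
  then show ?case
    using filtration(2)[of t] by (cases "s = Suc t") (auto simp: subalgebra_def)
qed (auto simp: subalgebra_def)

lemma st_meas: "u < t \<Longrightarrow> st u \<in> F t \<rightarrow>\<^sub>M count_space S"
  by (rule measurable_from_subalg[OF F_le adapted(1)]) auto

lemma sh_meas: "u < t \<Longrightarrow> sh u \<in> F t \<rightarrow>\<^sub>M count_space S"
  by (rule measurable_from_subalg[OF F_le adapted(4)]) auto

lemma st_meas_M: "st t \<in> M \<rightarrow>\<^sub>M count_space S"
  using M_meas[OF adapted(1)] .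

lemma st_pred[measurable]: "Measurable.pred M (\<lambda>w. st t w = s)"
  by (rule measurable_eq_const[OF st_meas_M])

lemma par_meas[measurable]: "par t \<in> borel_measurable M"
  using M_meas[OF adapted(2)] .

lemma act_meas[measurable]: "act t \<in> borel_measurable M"
  using M_meas[OF adapted(3)] .

lemma sh_pred[measurable]: "Measurable.pred M (\<lambda>w. sh t w = s)"
  using measurable_eq_const[OF M_meas[OF adapted(4)]] .

lemma xh_meas_M[measurable]: "xh t \<in> borel_measurable M"
  using M_meas[OF adapted(5)] .

lemma st_in: "w \<in> space M \<Longrightarrow> st t w \<in> S"
  using measurable_space[OF adapted(1)] space_F by auto

lemma sh_in: "w \<in> space M \<Longrightarrow> sh t w \<in> S"
  using measurable_space[OF adapted(4)] space_F by auto

lemma prev_in: "w \<in> space M \<Longrightarrow> prev t w \<in> S"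
  using sh_in init by (auto simp: prev_def)

lemma prev_meas: "prev t \<in> F t \<rightarrow>\<^sub>M count_space S"
  unfolding prev_def using init sh_meas[of "t - 1" t] by (cases "t = 0") auto

lemma count_S_meas: "k \<le> t \<Longrightarrow> (\<lambda>w. count_S (sh_seq w) k s) \<in> F t \<rightarrow>\<^sub>M count_space UNIV"
  unfolding count_S_def by (rule measurable_card_Collect) (auto intro!: measurable_eq_const sh_meas)

lemma rstart_le: "rstart t w \<le> t"
  unfolding rstart_def by (rule round_start_le)

text \<open>The arm at time \<open>t\<close> depends on the start of the current round, which in turn depends on the arms
  played before \<open>t\<close>.\<close>

lemma arm_rstart_choice_meas:
  "arm t \<in> F t \<rightarrow>\<^sub>M count_space B \<and> rstart t \<in> F t \<rightarrow>\<^sub>M count_space UNIV \<and>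
   choice t \<in> F t \<rightarrow>\<^sub>M count_space B \<Otimes>\<^sub>M borel"
proof (induction t rule: less_induct)
  case (less t)
  have armF: "arm u \<in> F t \<rightarrow>\<^sub>M count_space B" if "u < t" for u
    using that by (intro measurable_from_subalg[OF F_le[of u] less[OF that, THEN conjunct1]]) auto
  have BS: "(\<lambda>w. count_BS (arm_seq w) (sh_seq w) k b s) \<in> F t \<rightarrow>\<^sub>M count_space UNIV" if "k \<le> t" for k b s
    unfolding count_BS_def using that
    by (intro measurable_card_Collect pred_intros_logic)
      (auto intro!: measurable_eq_const[OF armF] measurable_eq_const[OF sh_meas])
  have cS: "(\<lambda>w. conf_S \<alpha> S (sh_seq w) k s) \<in> borel_measurable (F t)" if "k \<le> t" for k s
    unfolding conf_S_def
    by (rule measurable_count_space_borel[OF count_S_meas[OF that, of s], where g =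
      "\<lambda>n. if k \<le> 1 \<or> n = 0 then 1 else min 1 (sqrt (ln (4 * real (k - 1) powr \<alpha> * (real (card S))\<^sup>2) / (2 * real n)))"])
  have cT: "(\<lambda>w. conf_\<Theta> \<alpha> S B \<Theta> (arm_seq w) (sh_seq w) k b s) \<in> borel_measurable (F t)" if "k \<le> t" for k b s
    unfolding conf_\<Theta>_def
    by (rule measurable_count_space_borel[OF BS[OF that, of b s], where g =
      "\<lambda>n. if k \<le> 1 \<or> n = 0 then 1 else min 1 (sqrt (ln (4 * real (k - 1) powr \<alpha> * real (card (\<Theta> b s)) * real (card B) * real (card S)) / (2 * real n)))"])
  have cont: "Measurable.pred (F t) (\<lambda>w. round_continues \<alpha> S B \<Theta> (arm_seq w) (sh_seq w) j k)"
    if jk: "j \<le> t" "k \<le> t" for j k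
  proof -
    note [measurable] = cS[OF jk(1)] cS[OF jk(2)] cT[OF jk(1)] cT[OF jk(2)]
    show ?thesis unfolding round_continues_def
      by (intro pred_intros_logic pred_intros_finite states arms) measurable
  qed
  have rs: "rstart k \<in> F t \<rightarrow>\<^sub>M count_space UNIV" if "k \<le> t" for k
    using that
  proof (induction k)
    case 0
    then show ?case by (simp add: rstart_def[abs_def])
  next
    case (Suc k)
    then have IH[measurable]: "rstart k \<in> F t \<rightarrow>\<^sub>M count_space UNIV" by simp
    \<comment> \<open>The round start is itself random; the condition is split over its finitely
      many values.\<close>
    have [measurable]: "Measurable.pred (F t) (\<lambda>w. \<exists>j\<in>{..k}. rstart k w = j \<and>
        round_continues \<alpha> S B \<Theta> (arm_seq w) (sh_seq w) j (Suc k))"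
      using Suc.prems by (intro pred_intros_finite pred_intros_logic measurable_eq_const[OF IH] cont) auto
    have eq: "rstart (Suc k) = (\<lambda>w. if \<exists>j\<in>{..k}. rstart k w = j \<and>
        round_continues \<alpha> S B \<Theta> (arm_seq w) (sh_seq w) j (Suc k) then rstart k w else Suc k)"
      by (intro ext) (auto simp: rstart_def round_start_le)
    show ?case unfolding eq by measurable
  qed
  have rs': "rstart t \<in> F t \<rightarrow>\<^sub>M count_space {..t}"
    using measurable_space[OF rs[of t]] rs[of t] rstart_le
    by (auto simp: measurable_count_space_eq2_countable intro: measurable_sets_Collect)
  have "(\<lambda>w. pol (rstart t w) w (prev t w)) \<in> F t \<rightarrow>\<^sub>M count_space B \<Otimes>\<^sub>M borel"
  proof (rule measurable_compose_countable'[OF _ rs'])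
    fix k assume k: "k \<in> {..t}"
    show "(\<lambda>w. pol k w (prev t w)) \<in> F t \<rightarrow>\<^sub>M count_space B \<Otimes>\<^sub>M borel"
    proof (rule measurable_compose_countable'[OF _ prev_meas])
      fix s assume "s \<in> S"
      then show "(\<lambda>w. pol k w s) \<in> F t \<rightarrow>\<^sub>M count_space B \<Otimes>\<^sub>M borel"
        using k by (intro measurable_from_subalg[OF F_le[of k] adapted(6)]) auto
    qed (use states in \<open>auto intro: countable_finite\<close>)
  qed auto
  then have ch: "choice t \<in> F t \<rightarrow>\<^sub>M count_space B \<Otimes>\<^sub>M borel" unfolding choice_def[abs_def] .
  have "(\<lambda>w. fst (choice t w)) \<in> F t \<rightarrow>\<^sub>M count_space B"
    by (rule measurable_compose[OF ch measurable_fst])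
  then have "arm t \<in> F t \<rightarrow>\<^sub>M count_space B"
    by (rule measurable_cong[THEN iffD1, rotated]) (simp add: arm_eq space_F)
  with ch rs show ?case by simp
qed

lemma arm_meas: "u \<le> t \<Longrightarrow> arm u \<in> F t \<rightarrow>\<^sub>M count_space B"
  using arm_rstart_choice_meas[of u] by (blast intro: measurable_from_subalg[OF F_le])

lemma rstart_meas: "rstart t \<in> F t \<rightarrow>\<^sub>M count_space UNIV"
  using arm_rstart_choice_meas by auto

lemma center_meas: "center t \<in> borel_measurable (F t)"
  using measurable_compose[OF _ measurable_snd] arm_rstart_choice_meas
  unfolding center_def[abs_def] by blast

lemma arm_in: "w \<in> space M \<Longrightarrow> arm t w \<in> B"
  using measurable_space[OF arm_meas[of t t]] space_F by auto

lemma count_BS_meas: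
  "k \<le> t \<Longrightarrow> (\<lambda>w. count_BS (arm_seq w) (sh_seq w) k b s) \<in> F t \<rightarrow>\<^sub>M count_space UNIV"
  unfolding count_BS_def
  by (intro measurable_card_Collect pred_intros_logic)
    (auto intro!: measurable_eq_const[OF arm_meas] measurable_eq_const[OF sh_meas])

lemma center_in_AE: "AE w in M. \<forall>t. center t w \<in> A"
  using policy_choice AE_space
proof eventually_elim
  case (elim w)
  show ?case
  proof
    fix t
    \<comment> \<open>The policy in use was chosen at \<open>rstart t w\<close>, which starts its
      own round by \<open>round_start_idem\<close>; there \<open>policy_choice\<close>
      applies.\<close>
    have "optimistic_choice \<alpha> S B A \<Theta> (arm_seq w) (sh_seq w) (xh_seq w) (rstart t w) (prev t w) (choice t w)"
      using elim(1) prev_in[OF elim(2)] unfolding choice_def rstart_def by (simp add: round_start_idem)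
    then show "center t w \<in> A" unfolding center_def optimistic_choice_def is_arg_max_def by auto
  qed
qed

section \<open>Conditional law of state and parameter in one step\<close>

definition step_prob :: "nat \<Rightarrow> 's \<Rightarrow> real^'n \<Rightarrow> 'w \<Rightarrow> real" where
  "step_prob t s x w = pmf (kern t w) s * pmf (Q (arm t w) s) x"

lemma kern_pmf_meas: "(\<lambda>w. g (pmf (kern t w) s)) \<in> borel_measurable (F t)"
  using measurable_count_space_borel[OF st_meas[of "t - 1" t], of "\<lambda>y. g (pmf (P y) s)"]
  by (cases "t = 0") (simp_all add: kern_def)

lemma step_prob_meas: "step_prob t s x \<in> borel_measurable (F t)"
  unfolding step_prob_def[abs_def]
  by (intro borel_measurable_times kern_pmf_meas[of "\<lambda>x. x"] measurable_count_space_borel[OF arm_meas]) simp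

lemma step_prob_bounds: "0 \<le> step_prob t s x w" "\<bar>step_prob t s x w\<bar> \<le> 1"
proof -
  show "0 \<le> step_prob t s x w" by (simp add: step_prob_def)
  have "step_prob t s x w \<le> 1 * 1" unfolding step_prob_def by (intro mult_mono) (auto simp: pmf_le_1)
  then show "\<bar>step_prob t s x w\<bar> \<le> 1" by (simp add: step_prob_def)
qed

lemma bounded_integrable: "f \<in> borel_measurable (F t) \<Longrightarrow> (\<And>w. w \<in> space M \<Longrightarrow> \<bar>f w\<bar> \<le> c) \<Longrightarrow> integrable M f"
  for f :: "'w \<Rightarrow> real"
  by (rule integrable_const_bound[of _ c]) (auto intro: M_meas)

lemma set_kern: "w \<in> space M \<Longrightarrow> set_pmf (kern t w) \<subseteq> S"
  using init st_in set_pmf_P by (auto simp: kern_def)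

lemma sum_step_prob_x: "w \<in> space M \<Longrightarrow> s \<in> S \<Longrightarrow> (\<Sum>x\<in>all_params. step_prob t s x w) = pmf (kern t w) s"
proof -
  assume w: "w \<in> space M" and s: "s \<in> S"
  have "(\<Sum>x\<in>all_params. pmf (Q (arm t w) s) x) = 1"
    using param_law[OF arm_in[OF w] s] in_params[OF arm_in[OF w] s]
    by (intro sum_pmf_eq_1 finite_all_params) blast
  then show ?thesis by (simp add: step_prob_def flip: sum_distrib_left)
qed

text \<open>This mass is known to be 1 only for centres in \<open>A\<close>, hence almost surely
  along the run. Discarding it under an integral requires measurability in the centre, which holds
  because the regions are the sections of a measurable product set.\<close>

lemma explore_mass_meas:
  "(\<lambda>c. measure (uniform_measure lborel (region t c)) UNIV) \<in> borel_measurable borel"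
proof -
  let ?E = "region t" and ?R = "explore_radius \<epsilon> \<alpha>\<^sub>\<epsilon> S B \<Theta> t"
  define G where "G = {p \<in> space (borel \<Otimes>\<^sub>M lborel). snd p \<in> A \<and> ereal (dist (fst p) (snd p)) \<le> ?R}"
  have G: "G \<in> sets (borel \<Otimes>\<^sub>M lborel)" unfolding G_def by measurable
  have E: "?E c = Pair c -` G" for c by (auto simp: explore_region_def G_def space_pair_measure)
  have Es: "?E c \<in> sets lborel" for c by (simp add: explore_region_borel)
  have [measurable]: "(\<lambda>c. emeasure lborel (?E c)) \<in> borel_measurable borel"
    unfolding E by (rule lborel.measurable_emeasure_Pair[OF G])
  have "measure (uniform_measure lborel (?E c)) UNIV = enn2real (emeasure lborel (?E c) / emeasure lborel (?E c))" for c
    using emeasure_uniform_measure[OF Es, of UNIV c] by (simp add: measure_def)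
  then show ?thesis by simp
qed

lemma prob_step:
  assumes H: "H \<in> sets (F t)" and s: "s \<in> S" and x: "x \<in> all_params"
  shows "prob {w \<in> H. st t w = s \<and> par t w = x} = (LINT w:H|M. step_prob t s x w)"
proof -
  let ?m = "\<lambda>w. measure (uniform_measure lborel (region t (center t w))) UNIV"
  have HM[measurable]: "H \<in> sets M" by (rule F_sets[OF H])
  have [measurable]: "step_prob t s x \<in> borel_measurable M" "center t \<in> borel_measurable M"
    using M_meas[OF step_prob_meas] M_meas[OF center_meas] by auto
  have mM[measurable]: "?m \<in> borel_measurable M"
    by (rule measurable_compose[OF _ explore_mass_meas]) measurable
  have "prob {w \<in> H. st t w = s \<and> par t w = x} = (LINT w:H|M. ?m w * step_prob t s x w)"
    using step_law[OF H _ s x, of UNIV]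
    by (simp add: step_prob_def kern_def center_def choice_def rstart_def prev_def mult.assoc)
  also have "\<dots> = (LINT w:H|M. step_prob t s x w)"
  proof (rule set_lebesgue_integral_cong_AE)
    show "AE w\<in>H in M. ?m w * step_prob t s x w = step_prob t s x w"
      using center_in_AE
    proof eventually_elim
      case (elim w)
      note m = explore_region_measure[OF elim[rule_format, of t] explore_radius_pos[OF \<epsilon>_pos, of \<alpha>\<^sub>\<epsilon> t]]
      interpret U: prob_space "uniform_measure lborel (region t (center t w))"
        by (rule prob_space_uniform_measure) (use m in auto)
      show ?case using U.prob_space by simp
    qed
  qed measurable
  finally show ?thesis .
qed

lemma expectation_step:
  assumes s: "s \<in> S" and x: "x \<in> all_params"
    and Z: "Z \<in> borel_measurable (F t)" "AE w in M. \<bar>Z w\<bar> \<le> c"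
  shows "expectation (\<lambda>w. Z w * of_bool (st t w = s \<and> par t w = x)) = expectation (\<lambda>w. Z w * step_prob t s x w)"
proof -
  have e[measurable]: "Measurable.pred M (\<lambda>w. st t w = s \<and> par t w = x)" by measurable
  show ?thesis
  proof (rule expectation_mult_eq_of_set_integral_eq[OF F_sub _ _ _ Z])
    show "integrable M (\<lambda>w. of_bool (st t w = s \<and> par t w = x) :: real)"
      by (rule integrable_const_bound[of _ 1]) auto
    show "integrable M (step_prob t s x)" by (rule bounded_integrable[OF step_prob_meas step_prob_bounds(2)])
    fix H assume H: "H \<in> sets (F t)"
    then have "H \<in> sets M" by (rule F_sets)
    from set_integral_of_bool[OF this e] prob_step[OF H s x]
    show "(LINT w:H|M. of_bool (st t w = s \<and> par t w = x)) = (LINT w:H|M. step_prob t s x w)" by simp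
  qed
qed

text \<open>The step law covers only pairs from \<open>S\<close> and \<open>all_params\<close>.
  Their conditional probabilities add up to 1, which leaves no mass for other values.\<close>

lemma par_in_params_AE: "AE w in M. par t w \<in> all_params"
proof -
  let ?E = "\<lambda>(s, x). {w \<in> space M. st t w = s \<and> par t w = x}"
  let ?I = "S \<times> all_params"
  have fin: "finite ?I" using states finite_all_params by simp
  have "prob (\<Union>i\<in>?I. ?E i) = (\<Sum>i\<in>?I. prob (?E i))"
    by (rule finite_measure_finite_Union[OF fin]) (auto simp: disjoint_family_on_def)
  also have "\<dots> = (\<Sum>i\<in>?I. expectation (step_prob t (fst i) (snd i)))"
  proof (intro sum.cong refl)
    fix i assume i: "i \<in> ?I"
    have "space M \<in> sets (F t)" using space_F[of t] sets.top[of "F t"] by simp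
    from prob_step[OF this, of "fst i" "snd i"] i
    show "prob (?E i) = expectation (step_prob t (fst i) (snd i))"
      by (auto simp: set_lebesgue_integral_def split_beta cong: Bochner_Integration.integral_cong)
  qed
  also have "\<dots> = expectation (\<lambda>w. \<Sum>i\<in>?I. step_prob t (fst i) (snd i) w)"
    by (rule Bochner_Integration.integral_sum[symmetric])
      (rule bounded_integrable[OF step_prob_meas step_prob_bounds(2)])
  also have "\<dots> = expectation (\<lambda>w. 1)"
  proof (rule Bochner_Integration.integral_cong[OF refl])
    fix w assume w: "w \<in> space M"
    have "(\<Sum>i\<in>?I. step_prob t (fst i) (snd i) w) = (\<Sum>s\<in>S. \<Sum>x\<in>all_params. step_prob t s x w)"
      by (simp add: sum.cartesian_product split_beta)
    also have "\<dots> = 1" using set_kern[OF w, of t] states by (simp add: sum_step_prob_x[OF w] sum_pmf_eq_1)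
    finally show "(\<Sum>i\<in>?I. step_prob t (fst i) (snd i) w) = 1" .
  qed
  finally have "prob (\<Union>i\<in>?I. ?E i) = 1" by (simp add: prob_space)
  then have "AE w in M. w \<in> (\<Union>i\<in>?I. ?E i)" by (rule AE_prob_1)
  then show ?thesis by eventually_elim auto
qed

lemma AE_by_state_param:
  assumes "\<And>s x. s \<in> S \<Longrightarrow> x \<in> all_params \<Longrightarrow> AE w in M. st t w = s \<and> par t w = x \<longrightarrow> R w"
  shows "AE w in M. R w"
proof -
  have "AE w in M. \<forall>i\<in>S \<times> all_params. st t w = fst i \<and> par t w = snd i \<longrightarrow> R w"
    using assms states finite_all_params by (intro AE_finite_allI) auto
  with par_in_params_AE[of t] AE_space show ?thesis
    by eventually_elim (use st_in in auto)
qed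

text \<open>For each of the finitely many pairs, the event that its conditional probability vanishes
  belongs to \<open>F t\<close>, and on it the step law gives the pair probability zero.\<close>

lemma step_prob_pos_AE: "AE w in M. step_prob t (st t w) (par t w) w > 0"
proof (rule AE_by_state_param)
  fix s x assume sx: "s \<in> S" "x \<in> all_params"
  let ?H = "{w \<in> space (F t). step_prob t s x w = 0}"
  have H: "?H \<in> sets (F t)" using step_prob_meas[of t s x] by measurable
  then have [measurable]: "?H \<in> sets M" by (rule F_sets)
  have "prob {w \<in> ?H. st t w = s \<and> par t w = x} = (LINT w:?H|M. step_prob t s x w)"
    by (rule prob_step[OF H sx])
  also have "\<dots> = 0"
    unfolding set_lebesgue_integral_def by (rule integral_eq_zero_AE) (auto simp: indicator_def)
  finally have "AE w in M. w \<notin> {w \<in> ?H. st t w = s \<and> par t w = x}"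
    by (subst (asm) prob_eq_0) measurable
  then show "AE w in M. st t w = s \<and> par t w = x \<longrightarrow> step_prob t (st t w) (par t w) w > 0"
    using AE_space by eventually_elim (use step_prob_bounds(1)[of t s x] in \<open>auto simp: space_F less_le\<close>)
qed


section \<open>Law of the action; identification of hidden parameter and state\<close>

lemma explore_null:
  assumes X: "X \<in> sets borel" and null: "region t c \<inter> X \<in> null_sets lborel"
  shows "measure (uniform_measure lborel (region t c)) X = 0"
proof -
  have "region t c \<in> sets lborel" by (simp add: explore_region_borel)
  from emeasure_uniform_measure[OF this, of X] X null show ?thesis by (simp add: measure_def null_setsD1)
qed

text \<open>The region moves with the random centre while \<open>X\<close> is fixed;
  \<open>H\<close> is an event of the past on which the region meets \<open>X\<close> in a null
  set.\<close>

lemma act_avoid_AE: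
  assumes X: "X \<in> sets borel" and H: "H \<in> sets (F t)"
    and null: "\<And>w. w \<in> H \<Longrightarrow> region t (center t w) \<inter> X \<in> null_sets lborel"
  shows "AE w in M. w \<in> H \<longrightarrow> act t w \<notin> X"
proof (rule AE_by_state_param)
  fix s x assume sx: "s \<in> S" "x \<in> all_params"
  have [measurable]: "X \<in> sets borel" "H \<in> sets M"
    using X F_sets[OF H] by auto
  have "prob {w \<in> H. act t w \<in> X \<and> st t w = s \<and> par t w = x} = 0"
    unfolding step_law[OF H X sx] set_lebesgue_integral_def
    by (rule integral_eq_zero_AE, rule AE_I2)
      (use explore_null[OF X null] in \<open>auto simp: indicator_def center_def choice_def rstart_def prev_def\<close>)
  then have "AE w in M. w \<notin> {w \<in> H. act t w \<in> X \<and> st t w = s \<and> par t w = x}"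
    by (subst (asm) prob_eq_0) measurable
  then show "AE w in M. st t w = s \<and> par t w = x \<longrightarrow> (w \<in> H \<longrightarrow> act t w \<notin> X)"
    by eventually_elim auto
qed

lemma space_in_F: "space M \<in> sets (F t)"
  using space_F[of t] sets.top[of "F t"] by simp

lemma act_in_AE: "AE w in M. act t w \<in> A"
proof -
  have "AE w in M. w \<in> space M \<longrightarrow> act t w \<notin> - A"
  proof (rule act_avoid_AE[OF _ space_in_F])
    show "- A \<in> sets borel" using A_compact by (simp add: compact_imp_closed borel_open open_Compl)
    have "region t c \<inter> - A = {}" for c by (auto simp: explore_region_def)
    then show "region t (center t w) \<inter> - A \<in> null_sets lborel" for w by simp
  qed
  with AE_space show ?thesis by eventually_elim auto
qed

text \<open>The actions confusing two given parameters form a hyperplane, of zero volume, and there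
  are finitely many pairs. This is what the exploration achieves: the reward determines the
  parameter.\<close>

lemma act_separates_AE:
  "AE w in M. \<forall>x\<in>all_params. \<forall>x'\<in>all_params. act t w \<bullet> x = act t w \<bullet> x' \<longrightarrow> x = x'"
proof (intro AE_finite_allI finite_all_params)
  fix x x' :: "real^'n"
  show "AE w in M. act t w \<bullet> x = act t w \<bullet> x' \<longrightarrow> x = x'"
  proof (cases "x = x'")
    case False
    let ?X = "{a. (x - x') \<bullet> a = 0}"
    have "negligible ?X" using False by (intro negligible_hyperplane) auto
    moreover have X: "?X \<in> sets borel" by (intro borel_closed closed_hyperplane)
    ultimately have null: "?X \<in> null_sets lborel"
      using null_sets_completion_iff2[of lborel] by (auto simp: negligible_iff_null_sets null_sets_def)
    have "AE w in M. w \<in> space M \<longrightarrow> act t w \<notin> ?X"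
    proof (rule act_avoid_AE[OF X space_in_F])
      fix w
      have "region t (center t w) \<in> sets lborel" by (simp add: explore_region_borel)
      from null_set_Int1[OF null this]
      show "region t (center t w) \<inter> ?X \<in> null_sets lborel" by (simp add: Int_commute)
    qed
    with AE_space show ?thesis by eventually_elim (auto simp: inner_diff_left inner_commute)
  qed simp
qed

text \<open>\<open>act_avoid_AE\<close> excludes fixed sets only, but the ball has a random centre.
  Centres are therefore localised near points of a countable dense set, with margins 1 / (k +
  1).\<close>

lemma act_near_center_AE:
  assumes r: "explore_radius \<epsilon> \<alpha>\<^sub>\<epsilon> S B \<Theta> t = ereal r"
  shows "AE w in M. dist (center t w) (act t w) \<le> r"
proof -
  obtain D :: "(real^'n) set" where D: "countable D" "\<And>X. open X \<Longrightarrow> X \<noteq> {} \<Longrightarrow> \<exists>d\<in>D. d \<in> X"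
    by (rule countable_dense_setE) blast
  define H where "H q k = {w \<in> space (F t). dist (center t w) q < 1 / real (Suc k)}" for q and k :: nat
  define X :: "real^'n \<Rightarrow> nat \<Rightarrow> (real^'n) set" where "X q k = {a. r + 1 / real (Suc k) < dist a q}" for q k
  have "AE w in M. \<forall>q\<in>D. \<forall>k. w \<in> H q k \<longrightarrow> act t w \<notin> X q k"
  proof (intro AE_ball_countable'[OF _ D(1)] AE_all_countable[THEN iffD2] allI)
    fix q k
    show "AE w in M. w \<in> H q k \<longrightarrow> act t w \<notin> X q k"
    proof (rule act_avoid_AE)
      show "X q k \<in> sets borel" unfolding X_def by measurable
      show "H q k \<in> sets (F t)" using center_meas[of t] unfolding H_def by measurable
      fix w assume "w \<in> H q k"
      then have c: "dist (center t w) q < 1 / real (Suc k)" by (simp add: H_def)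
      have "region t (center t w) \<inter> X q k = {}"
      proof (rule equals0I)
        fix a assume a: "a \<in> region t (center t w) \<inter> X q k"
        then have "dist (center t w) a \<le> r" "r + 1 / real (Suc k) < dist a q"
          by (auto simp: explore_region_def r X_def)
        with c dist_triangle3[of a q "center t w"] show False by linarith
      qed
      then show "region t (center t w) \<inter> X q k \<in> null_sets lborel" by simp
    qed
  qed
  with AE_space show ?thesis
  proof eventually_elim
    case (elim w)
    show ?case
    proof (rule ccontr)
      assume "\<not> ?case"
      then have pos: "0 < (dist (center t w) (act t w) - r) / 2" by simp
      \<comment> \<open>The localisation error enters twice: in the centre and in the excluded
        set.\<close>
      obtain k where k: "2 * (1 / real (Suc k)) < dist (center t w) (act t w) - r"
        using reals_Archimedean[OF pos] by (auto simp: inverse_eq_divide field_simps)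
      obtain q where q: "q \<in> D" "q \<in> ball (center t w) (1 / real (Suc k))"
        using D(2)[of "ball (center t w) (1 / real (Suc k))"] by auto
      then have "w \<in> H q k" using elim by (simp add: H_def space_F)
      then have "act t w \<notin> X q k" using elim q by blast
      then have "dist (act t w) q \<le> r + 1 / real (Suc k)" by (simp add: X_def)
      moreover have "dist (center t w) q < 1 / real (Suc k)" using q by simp
      moreover have "dist (center t w) (act t w) \<le> dist (center t w) q + dist (act t w) q" by (rule dist_triangle2)
      moreover define e where "e = 1 / real (Suc k)"
      ultimately show False using k unfolding e_def[symmetric] by linarith
    qed
  qed
qed

text \<open>The Euclidean norm is at most \<open>norm1\<close>, whose maximum stands in the
  denominator of the radius. If all parameters vanish, the radius is infinite but the rewards are
  zero.\<close>

lemma reward_error_AE: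
  assumes t: "1 \<le> t"
  shows "AE w in M. \<bar>act t w \<bullet> par t w - center t w \<bullet> par t w\<bar> \<le> \<epsilon> * real t powr (- \<alpha>\<^sub>\<epsilon>)"
proof -
  define m where "m = Max (norm1 ` all_params)"
  have nm: "norm x \<le> m" if "x \<in> all_params" for x
  proof -
    have "norm x \<le> norm1 x" unfolding norm1_def by (rule norm_le_l1_cart)
    also have "\<dots> \<le> m" unfolding m_def using finite_all_params that by (intro Max_ge) auto
    finally show ?thesis .
  qed
  have tp: "0 < real t powr \<alpha>\<^sub>\<epsilon>" using t by simp
  have m0: "0 \<le> m" using nm params_nonempty norm_ge_zero order_trans by blast
  have "AE w in M. m > 0 \<longrightarrow> dist (center t w) (act t w) \<le> \<epsilon> / (10 * real t powr \<alpha>\<^sub>\<epsilon> * m)"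
  proof (cases "m > 0")
    case True
    then have "explore_radius \<epsilon> \<alpha>\<^sub>\<epsilon> S B \<Theta> t = ereal (\<epsilon> / (10 * real t powr \<alpha>\<^sub>\<epsilon> * m))"
      using tp unfolding explore_radius_def m_def[symmetric] by simp
    from act_near_center_AE[OF this] show ?thesis by simp
  qed simp
  with par_in_params_AE[of t] show ?thesis
  proof eventually_elim
    case (elim w)
    have "\<bar>act t w \<bullet> par t w - center t w \<bullet> par t w\<bar> = \<bar>(act t w - center t w) \<bullet> par t w\<bar>"
      by (simp add: inner_diff_left)
    also have "\<dots> \<le> norm (act t w - center t w) * norm (par t w)" by (rule Cauchy_Schwarz_ineq2)
    also have "\<dots> \<le> norm (act t w - center t w) * m" by (intro mult_left_mono nm elim) simp
    also have "\<dots> \<le> \<epsilon> * real t powr (- \<alpha>\<^sub>\<epsilon>)"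
    proof (cases "m > 0")
      case True
      then have "dist (center t w) (act t w) * m \<le> \<epsilon> / (10 * real t powr \<alpha>\<^sub>\<epsilon> * m) * m"
        using elim by (intro mult_right_mono) auto
      also have "\<dots> = \<epsilon> / real t powr \<alpha>\<^sub>\<epsilon> / 10" using True by simp
      also have "\<dots> \<le> \<epsilon> / real t powr \<alpha>\<^sub>\<epsilon>"
      proof -
        have "y / 10 \<le> y" if "0 < y" for y :: real using that by simp
        from this[OF divide_pos_pos[OF \<epsilon>_pos tp]] show ?thesis .
      qed
      finally show ?thesis by (simp add: dist_norm norm_minus_commute powr_minus_divide)
    next
      case False
      then show ?thesis using m0 \<epsilon>_pos by simp
    qed
    finally show ?case .
  qed
qed

text \<open>\<open>xh\<close> solves the reward equation, so separation makes it equal to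
  \<open>par\<close>. As \<open>par\<close> lies in the set of the true state, and the sets of one
  arm are disjoint, the state is identified too.\<close>

lemma estimates_exact_AE: "AE w in M. \<forall>t. sh t w = st t w \<and> xh t w = par t w \<and> par t w \<in> \<Theta> (arm t w) (st t w)"
proof (intro AE_all_countable[THEN iffD2] allI)
  fix t
  show "AE w in M. sh t w = st t w \<and> xh t w = par t w \<and> par t w \<in> \<Theta> (arm t w) (st t w)"
    using act_separates_AE[of t] step_prob_pos_AE[of t] estimates par_in_params_AE[of t] AE_space
  proof eventually_elim
    case (elim w)
    have B: "arm t w \<in> B" and s: "st t w \<in> S" "sh t w \<in> S"
      using elim arm_in st_in sh_in by auto
    have "pmf (Q (arm t w) (st t w)) (par t w) > 0"
      using elim(2) by (simp add: step_prob_def zero_less_mult_iff)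
    then have p: "par t w \<in> \<Theta> (arm t w) (st t w)" using param_law[OF B s(1)] by (auto simp: pmf_positive_iff)
    have x: "xh t w \<in> \<Theta> (arm t w) (sh t w)" and e: "act t w \<bullet> par t w = act t w \<bullet> xh t w"
      using elim(3) by auto
    have "xh t w = par t w" using elim(1,4) in_params[OF B s(2) x] e by auto
    moreover have "sh t w = st t w" using disjoint_params[OF B s(2) s(1)] x p \<open>xh t w = par t w\<close> by auto
    ultimately show ?case using p by simp
  qed
qed

lemma transition_pos_AE: "AE w in M. \<forall>t\<ge>1. pmf (P (st (t - 1) w)) (st t w) > 0"
proof (intro AE_all_countable[THEN iffD2] allI)
  fix t
  show "AE w in M. t \<ge> 1 \<longrightarrow> pmf (P (st (t - 1) w)) (st t w) > 0"
    using step_prob_pos_AE[of t]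
    by eventually_elim (auto simp: step_prob_def kern_def zero_less_mult_iff)
qed

end

section \<open>Conditional expectations along the run\<close>

lemma summable_powr_geometric:
  fixes r p :: real
  assumes r: "0 < r" "r < 1"
  shows "summable (\<lambda>n. (real n + 1) powr p * r ^ n)"
proof -
  define c where "c = (1 + r) / 2"
  have c: "r < c" "c < 1" using r by (auto simp: c_def)
  have "(\<lambda>n. (1 + inverse (real (Suc n))) powr p * r) \<longlonglongrightarrow> 1 powr p * r"
    by (intro tendsto_intros tendsto_powr LIMSEQ_inverse_real_of_nat_add) auto
  then have "(\<lambda>n. (1 + inverse (real (Suc n))) powr p * r) \<longlonglongrightarrow> r" by simp
  then have "eventually (\<lambda>n. (1 + inverse (real (Suc n))) powr p * r < c) sequentially"
    using c(1) by (rule order_tendstoD)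
  then obtain N where N: "\<And>n. n \<ge> N \<Longrightarrow> (1 + inverse (real (Suc n))) powr p * r < c"
    by (auto simp: eventually_sequentially)
  show ?thesis
  proof (rule summable_ratio_test[OF c(2)])
    fix n assume "n \<ge> N"
    have "real (Suc n) + 1 = (1 + inverse (real (Suc n))) * (real n + 1)" by (simp add: field_simps)
    then have "(real (Suc n) + 1) powr p = (1 + inverse (real (Suc n))) powr p * (real n + 1) powr p"
      by (simp add: powr_mult)
    then have "norm ((real (Suc n) + 1) powr p * r ^ Suc n) =
        ((1 + inverse (real (Suc n))) powr p * r) * ((real n + 1) powr p * r ^ n)"
      using r by (simp add: mult_ac)
    also have "\<dots> \<le> c * ((real n + 1) powr p * r ^ n)"
      using N[OF \<open>n \<ge> N\<close>] r by (intro mult_right_mono) auto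
    finally show "norm ((real (Suc n) + 1) powr p * r ^ Suc n) \<le> c * norm ((real n + 1) powr p * r ^ n)"
      using r by simp
  qed
qed

context tuned_run
begin

lemma bounded_integrable_AE: "f \<in> borel_measurable M \<Longrightarrow> (AE w in M. \<bar>f w\<bar> \<le> c) \<Longrightarrow> integrable M f"
  for f :: "'w \<Rightarrow> real"
  by (rule integrable_const_bound[of _ c]) auto

lemma finite_state_bound:
  obtains c where "\<And>s. s \<in> S \<Longrightarrow> \<bar>g s\<bar> \<le> (c::real)"
  using that[of "Max ((\<lambda>s. \<bar>g s\<bar>) ` S)"] states by auto

text \<open>State and parameter take finitely many values, so the integrand is a finite sum of
  coefficients known before the step times indicators; \<open>expectation_step\<close> averages each
  term.\<close>

lemma expectation_state_param:
  assumes meas: "\<And>s x. s \<in> S \<Longrightarrow> x \<in> all_params \<Longrightarrow> G s x \<in> borel_measurable (F t)"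
    and bound: "\<And>s x. s \<in> S \<Longrightarrow> x \<in> all_params \<Longrightarrow> AE w in M. \<bar>G s x w\<bar> \<le> c"
    and GM: "(\<lambda>w. G (st t w) (par t w) w) \<in> borel_measurable M"
  shows "expectation (\<lambda>w. G (st t w) (par t w) w) =
    expectation (\<lambda>w. \<Sum>s\<in>S. \<Sum>x\<in>all_params. G s x w * step_prob t s x w)"
proof -
  let ?I = "S \<times> all_params"
  let ?f = "\<lambda>i w. G (fst i) (snd i) w * of_bool (st t w = fst i \<and> par t w = snd i)"
  let ?g = "\<lambda>i w. G (fst i) (snd i) w * step_prob t (fst i) (snd i) w"
  have fin: "finite ?I" using states finite_all_params by simp
  have int: "integrable M (?f i)" "integrable M (?g i)" if "i \<in> ?I" for i
  proof -
    have i: "fst i \<in> S" "snd i \<in> all_params" using that by auto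
    have [measurable]: "G (fst i) (snd i) \<in> borel_measurable M" "step_prob t (fst i) (snd i) \<in> borel_measurable M"
      using M_meas[OF meas[OF i]] M_meas[OF step_prob_meas] by auto
    have "AE w in M. \<bar>?f i w\<bar> \<le> c"
      using bound[OF i] by eventually_elim (auto simp: of_bool_def intro: order_trans[OF abs_ge_zero])
    moreover have "?f i \<in> borel_measurable M" unfolding of_bool_def by measurable
    ultimately show "integrable M (?f i)" by (intro bounded_integrable_AE)
    have "AE w in M. \<bar>?g i w\<bar> \<le> c"
      using bound[OF i]
    proof eventually_elim
      case (elim w)
      then have "\<bar>G (fst i) (snd i) w\<bar> * \<bar>step_prob t (fst i) (snd i) w\<bar> \<le> c * 1"
        using step_prob_bounds by (intro mult_mono) auto
      then show ?case by (simp add: abs_mult)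
    qed
    then show "integrable M (?g i)" by (rule bounded_integrable_AE[rotated]) measurable
  qed
  have "expectation (\<lambda>w. G (st t w) (par t w) w) = expectation (\<lambda>w. \<Sum>i\<in>?I. ?f i w)"
  proof (rule integral_cong_AE[OF GM])
    show "AE w in M. G (st t w) (par t w) w = (\<Sum>i\<in>?I. ?f i w)"
      using par_in_params_AE[of t] AE_space
    proof eventually_elim
      case (elim w)
      have "(\<Sum>i\<in>?I. ?f i w) = (\<Sum>i\<in>?I. if i = (st t w, par t w) then G (st t w) (par t w) w else 0)"
        by (intro sum.cong) auto
      then show ?case using elim st_in fin by simp
    qed
  qed (use int in \<open>auto intro!: borel_measurable_sum\<close>)
  also have "\<dots> = (\<Sum>i\<in>?I. expectation (?f i))" by (rule Bochner_Integration.integral_sum[OF int(1)])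
  also have "\<dots> = (\<Sum>i\<in>?I. expectation (?g i))"
  proof (rule sum.cong[OF refl])
    fix i assume "i \<in> ?I"
    then have i: "fst i \<in> S" "snd i \<in> all_params" by auto
    show "expectation (?f i) = expectation (?g i)" by (rule expectation_step[OF i meas[OF i] bound[OF i]])
  qed
  also have "\<dots> = expectation (\<lambda>w. \<Sum>i\<in>?I. ?g i w)"
    by (rule Bochner_Integration.integral_sum[OF int(2), symmetric])
  finally show ?thesis by (simp add: sum.cartesian_product split_beta)
qed

lemma st_fun_meas_M: "(\<lambda>w. g (st t w)) \<in> borel_measurable M" for g :: "'s \<Rightarrow> real"
  by (rule measurable_count_space_borel[OF st_meas_M])

lemma expectation_next_state:
  assumes Z: "Z \<in> borel_measurable (F t)" "AE w in M. \<bar>Z w\<bar> \<le> c"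
  shows "expectation (\<lambda>w. Z w * g (st t w)) = expectation (\<lambda>w. Z w * (\<Sum>s\<in>S. pmf (kern t w) s * g s))"
proof -
  obtain d where d: "\<And>s. s \<in> S \<Longrightarrow> \<bar>g s\<bar> \<le> d" by (rule finite_state_bound[of g]) blast
  note [measurable] = M_meas[OF Z(1)] st_fun_meas_M
  have "expectation (\<lambda>w. Z w * g (st t w)) =
      expectation (\<lambda>w. \<Sum>s\<in>S. \<Sum>x\<in>all_params. Z w * g s * step_prob t s x w)"
  proof (rule expectation_state_param[where G = "\<lambda>s x w. Z w * g s" and c = "c * d"])
    show "AE w in M. \<bar>Z w * g s\<bar> \<le> c * d" if s: "s \<in> S" for s
      using Z(2)
    proof eventually_elim
      case (elim w)
      then have "\<bar>Z w\<bar> * \<bar>g s\<bar> \<le> c * d" using d[OF s] by (intro mult_mono) auto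
      then show ?case by (simp add: abs_mult)
    qed
  qed (use Z(1) in measurable)
  also have "\<dots> = expectation (\<lambda>w. Z w * (\<Sum>s\<in>S. pmf (kern t w) s * g s))"
    by (intro Bochner_Integration.integral_cong refl)
      (simp add: sum_step_prob_x mult_ac flip: sum_distrib_left)
  finally show ?thesis .
qed

lemma expectation_state:
  assumes s: "s \<in> S" and Z: "Z \<in> borel_measurable (F t)" "AE w in M. \<bar>Z w\<bar> \<le> c"
  shows "expectation (\<lambda>w. Z w * of_bool (st t w = s)) = expectation (\<lambda>w. Z w * pmf (kern t w) s)"
proof -
  have "(\<Sum>y\<in>S. p y * of_bool (y = s)) = p s" for p :: "'s \<Rightarrow> real"
  proof -
    have "(\<Sum>y\<in>S. p y * of_bool (y = s)) = (\<Sum>y\<in>S. if y = s then p s else 0)" by (intro sum.cong) auto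
    then show ?thesis using s states by simp
  qed
  then show ?thesis using expectation_next_state[OF Z, of "\<lambda>y. of_bool (y = s)"] by simp
qed

lemma expectation_next:
  assumes t: "1 \<le> t" and Z: "Z \<in> borel_measurable (F t)" "AE w in M. \<bar>Z w\<bar> \<le> c"
  shows "expectation (\<lambda>w. Z w * g (st t w)) = expectation (\<lambda>w. Z w * step_mean g (st (t - 1) w))"
  unfolding expectation_next_state[OF Z] using t by (simp add: kern_def step_mean_def)

lemma st_fun_meas: "u < t \<Longrightarrow> (\<lambda>w. g (st u w)) \<in> borel_measurable (F t)"
  by (rule measurable_count_space_borel[OF st_meas])

text \<open>The off-by-one matters: the count at \<open>Suc t\<close> involves
  \<open>sh (u - 1)\<close> with u <= t only, so it is known before the step at
  \<open>t\<close>.\<close>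

lemma count_S_meas_Suc:
  "(\<lambda>w. count_S (sh_seq w) (Suc t) s) \<in> F t \<rightarrow>\<^sub>M count_space UNIV"
  unfolding count_S_def by (rule measurable_card_Collect) (auto intro!: measurable_eq_const[OF sh_meas])

text \<open>The weight of \<open>hitting_lyapunov\<close> times exp(- count) shrinks in mean by the
  factor \<open>r\<close> per step: away from \<open>s0\<close> through the weight, at
  \<open>s0\<close> through the factor exp(-1) of the visit. As v >= 1, the exponential moment
  decays with it.\<close>

lemma visit_laplace_bound:
  assumes s0: "s0 \<in> S"
  obtains C r where "0 < r" "r < 1" "0 < C"
    "\<And>t. 1 \<le> t \<Longrightarrow> expectation (\<lambda>w. exp (- real (count_S (sh_seq w) t s0))) \<le> C * r ^ t"
proof -
  obtain v r where r: "0 < r" "r < 1" and v1: "\<And>y. y \<in> S \<Longrightarrow> 1 \<le> v y"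
    and off: "\<And>y. y \<in> S \<Longrightarrow> y \<noteq> s0 \<Longrightarrow> step_mean v y \<le> r * v y"
    and at: "exp (- 1) * step_mean v s0 \<le> r * v s0"
    by (rule hitting_lyapunov[OF s0]) blast
  obtain c where c: "\<And>s. s \<in> S \<Longrightarrow> \<bar>v s\<bar> \<le> c" by (rule finite_state_bound[of v]) blast
  have c1: "1 \<le> c" using c[OF s0] v1[OF s0] by linarith
  define Y where "Y t w = exp (- real (count_S (sh_seq w) t s0))" for t w
  have Yb: "0 \<le> Y t w" "Y t w \<le> 1" for t w by (auto simp: Y_def)
  have YF: "Y (Suc t) \<in> borel_measurable (F t)" for t
    unfolding Y_def[abs_def] by (rule measurable_count_space_borel[OF count_S_meas_Suc])
  have YM[measurable]: "Y t \<in> borel_measurable M" for t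
    unfolding Y_def[abs_def]
    by (rule M_meas[OF measurable_count_space_borel[OF count_S_meas[OF order_refl]]])
  note [measurable] = st_fun_meas_M
  have int: "integrable M (\<lambda>w. Y t w * v (st k w))" for t k
  proof (rule bounded_integrable_AE[of _ c])
    show "AE w in M. \<bar>Y t w * v (st k w)\<bar> \<le> c"
    proof (rule AE_I2)
      fix w assume "w \<in> space M"
      then have "\<bar>Y t w\<bar> * \<bar>v (st k w)\<bar> \<le> 1 * c" using Yb[of t w] c[OF st_in] by (intro mult_mono) auto
      then show "\<bar>Y t w * v (st k w)\<bar> \<le> c" by (simp add: abs_mult)
    qed
  qed measurable
  have bound: "expectation (\<lambda>w. Y t w * v (st (t - 1) w)) \<le> c / r * r ^ t" if "1 \<le> t" for t
    using that
  proof (induction t rule: dec_induct)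
    case base
    have "expectation (\<lambda>w. Y 1 w * v (st (1 - 1) w)) \<le> expectation (\<lambda>w. c)"
    proof (rule integral_mono[OF int])
      fix w assume "w \<in> space M"
      then have "Y 1 w * v (st (1 - 1) w) \<le> 1 * c"
        using Yb[of 1 w] c[OF st_in, of w 0] v1[OF st_in, of w 0] by (intro mult_mono) auto
      then show "Y 1 w * v (st (1 - 1) w) \<le> c" by simp
    qed simp
    then show ?case using r by (simp add: prob_space)
  next
    case (step t)
    have "expectation (\<lambda>w. Y (Suc t) w * v (st (Suc t - 1) w)) =
        expectation (\<lambda>w. Y (Suc t) w * step_mean v (st (t - 1) w))"
      using expectation_next[OF step(1) YF, of 1] Yb by simp
    also have "\<dots> \<le> expectation (\<lambda>w. r * (Y t w * v (st (t - 1) w)))"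
    proof (rule integral_mono_AE)
      obtain c' where c': "\<And>s. s \<in> S \<Longrightarrow> \<bar>step_mean v s\<bar> \<le> c'" by (rule finite_state_bound[of "step_mean v"]) blast
      show "integrable M (\<lambda>w. Y (Suc t) w * step_mean v (st (t - 1) w))"
      proof (rule bounded_integrable_AE[of _ c'])
        show "AE w in M. \<bar>Y (Suc t) w * step_mean v (st (t - 1) w)\<bar> \<le> c'"
        proof (rule AE_I2)
          fix w assume "w \<in> space M"
          then have "\<bar>Y (Suc t) w\<bar> * \<bar>step_mean v (st (t - 1) w)\<bar> \<le> 1 * c'"
            using Yb[of "Suc t" w] c'[OF st_in] by (intro mult_mono) auto
          then show "\<bar>Y (Suc t) w * step_mean v (st (t - 1) w)\<bar> \<le> c'" by (simp add: abs_mult)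
        qed
      qed measurable
      show "integrable M (\<lambda>w. r * (Y t w * v (st (t - 1) w)))" using int by simp
      show "AE w in M. Y (Suc t) w * step_mean v (st (t - 1) w) \<le> r * (Y t w * v (st (t - 1) w))"
        using estimates_exact_AE AE_space
      proof eventually_elim
        case (elim w)
        have s: "st (t - 1) w \<in> S" and sh: "sh (t - 1) w = st (t - 1) w" using elim st_in by auto
        have "count_S (sh_seq w) (Suc t) s0 = count_S (sh_seq w) t s0 + of_bool (st (t - 1) w = s0)"
          unfolding count_S_def card_Collect_upt_Suc[OF step(1)] sh ..
        then have Y: "Y (Suc t) w = Y t w * (if st (t - 1) w = s0 then exp (- 1) else 1)"
          by (simp add: Y_def exp_diff exp_minus divide_inverse)
        have "(if st (t - 1) w = s0 then exp (- 1) else 1) * step_mean v (st (t - 1) w) \<le> r * v (st (t - 1) w)"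
          using off[OF s] at by auto
        from mult_left_mono[OF this Yb(1)[of t w]] show ?case unfolding Y by (simp add: mult_ac)
      qed
    qed
    also have "\<dots> = r * expectation (\<lambda>w. Y t w * v (st (t - 1) w))" by simp
    also have "\<dots> \<le> r * (c / r * r ^ t)" using step.IH r by (intro mult_left_mono) auto
    finally show ?case by (simp add: mult_ac)
  qed
  show thesis
  proof (rule that[of r "c / r"])
    show "0 < r" "r < 1" "0 < c / r" using r c1 by auto
    fix t :: nat assume t: "1 \<le> t"
    have "expectation (\<lambda>w. Y t w) \<le> expectation (\<lambda>w. Y t w * v (st (t - 1) w))"
    proof (rule integral_mono[OF _ int])
      show "integrable M (\<lambda>w. Y t w)" by (rule bounded_integrable_AE[of _ 1]) (use Yb in auto)
      fix w assume "w \<in> space M"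
      then have "Y t w * 1 \<le> Y t w * v (st (t - 1) w)" using v1[OF st_in] Yb by (intro mult_left_mono) auto
      then show "Y t w \<le> Y t w * v (st (t - 1) w)" by simp
    qed
    with bound[OF t] show "expectation (\<lambda>w. exp (- real (count_S (sh_seq w) t s0))) \<le> c / r * r ^ t"
      unfolding Y_def by linarith
  qed
qed

section \<open>Transitions and parameter draws as adapted trials\<close>

lemma prob_eq_expectation_AE:
  assumes "H \<in> sets M" "Measurable.pred M R" "Measurable.pred M R'" "AE w in M. R w \<longleftrightarrow> R' w"
  shows "prob {w \<in> H. R w} = expectation (\<lambda>w. indicator H w * of_bool (R' w))"
proof -
  note [measurable] = assms(1-3)
  have "prob {w \<in> H. R w} = (LINT w:H|M. of_bool (R w))"
    by (rule set_integral_of_bool[symmetric]) measurable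
  also have "\<dots> = expectation (\<lambda>w. indicator H w * of_bool (R' w))"
    unfolding set_lebesgue_integral_def
    by (rule integral_cong_AE) (use assms(4) in \<open>auto simp: of_bool_def elim!: eventually_mono\<close>)
  finally show ?thesis .
qed

text \<open>Whether a trial takes place is known before the step. The step law speaks of hidden
  states, so the estimated ones are exchanged for them first and restored at the end.\<close>

lemma transition_trials:
  assumes s: "s \<in> S" "s' \<in> S"
  shows "adapted_trials M F (\<lambda>u w. sh (u - 1) w = s) (\<lambda>u w. sh u w = s') (pmf (P s) s')"
proof (unfold_locales, rule F_sub, rule filtration)
  fix t :: nat assume t: "1 \<le> t"
  show "Measurable.pred (F (Suc t)) (\<lambda>w. sh (t - 1) w = s)"
    by (rule measurable_eq_const[OF sh_meas]) simp
  show "Measurable.pred (F (Suc t)) (\<lambda>w. sh t w = s')"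
    by (rule measurable_eq_const[OF sh_meas]) simp
  fix H assume H: "H \<in> sets (F t)"
  then have HM: "H \<in> sets M" by (rule F_sets)
  let ?Z = "\<lambda>w. indicator H w * of_bool (st (t - 1) w = s) :: real"
  have pst: "Measurable.pred (F t) (\<lambda>w. st (t - 1) w = s)"
    using t by (intro measurable_eq_const[OF st_meas]) simp
  have Z: "?Z \<in> borel_measurable (F t)" using H pst unfolding of_bool_def by measurable
  have "prob {w \<in> H. sh (t - 1) w = s \<and> sh t w = s'} =
      expectation (\<lambda>w. indicator H w * of_bool (st (t - 1) w = s \<and> st t w = s'))"
    by (rule prob_eq_expectation_AE[OF HM]; measurable?) (use estimates_exact_AE in \<open>auto elim!: eventually_mono\<close>)
  also have "\<dots> = expectation (\<lambda>w. ?Z w * of_bool (st t w = s'))"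
    by (intro Bochner_Integration.integral_cong) (auto simp: indicator_def)
  also have "\<dots> = expectation (\<lambda>w. ?Z w * pmf (kern t w) s')"
    by (rule expectation_state[OF s(2) Z, of 1]) (auto simp: indicator_def)
  also have "\<dots> = expectation (\<lambda>w. pmf (P s) s' * ?Z w)"
    using t by (intro Bochner_Integration.integral_cong) (auto simp: kern_def)
  also have "\<dots> = pmf (P s) s' * expectation ?Z" by (rule integral_mult_right_zero)
  also have "expectation ?Z = prob {w \<in> H. sh (t - 1) w = s}"
    by (rule prob_eq_expectation_AE[OF HM, symmetric]; measurable?) (use estimates_exact_AE in \<open>auto elim!: eventually_mono\<close>)
  finally show "prob {w \<in> H. sh (t - 1) w = s \<and> sh t w = s'} = pmf (P s) s' * prob {w \<in> H. sh (t - 1) w = s}" .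
qed (simp_all add: pmf_le_1)

lemma arm_pred[measurable]: "Measurable.pred M (\<lambda>w. arm t w = b)"
  using measurable_eq_const[OF M_meas[OF arm_meas[OF order_refl]]] .

text \<open>The trial is decided in the same step as its outcome, since it requires the new state.
  The conditional law is a product of a state factor and a parameter factor, so the latter splits
  off.\<close>

lemma param_trials:
  assumes bs: "b \<in> B" "s \<in> S" and x: "x \<in> \<Theta> b s"
  shows "adapted_trials M F (\<lambda>u w. arm u w = b \<and> sh u w = s) (\<lambda>u w. xh u w = x) (pmf (Q b s) x)"
proof (unfold_locales, rule F_sub, rule filtration)
  fix t :: nat assume t: "1 \<le> t"
  show "Measurable.pred (F (Suc t)) (\<lambda>w. arm t w = b \<and> sh t w = s)"
    by (intro pred_intros_logic measurable_eq_const[OF sh_meas] measurable_eq_const[OF arm_meas]) auto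
  have [measurable]: "xh t \<in> borel_measurable (F (Suc t))" by (rule adapted)
  show "Measurable.pred (F (Suc t)) (\<lambda>w. xh t w = x)" by measurable
  fix H assume H: "H \<in> sets (F t)"
  then have HM: "H \<in> sets M" by (rule F_sets)
  let ?Z = "\<lambda>w. indicator H w * of_bool (arm t w = b) :: real"
  have par: "Measurable.pred (F t) (\<lambda>w. arm t w = b)"
    by (intro measurable_eq_const[OF arm_meas]) simp
  have Z: "?Z \<in> borel_measurable (F t)" using H par unfolding of_bool_def by measurable
  have Zb: "AE w in M. \<bar>?Z w\<bar> \<le> 1" by (auto simp: indicator_def)
  have "prob {w \<in> H. (arm t w = b \<and> sh t w = s) \<and> xh t w = x} =
      expectation (\<lambda>w. indicator H w * of_bool (arm t w = b \<and> st t w = s \<and> par t w = x))"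
    by (rule prob_eq_expectation_AE[OF HM]; measurable?) (use estimates_exact_AE in \<open>auto elim!: eventually_mono\<close>)
  also have "\<dots> = expectation (\<lambda>w. ?Z w * of_bool (st t w = s \<and> par t w = x))"
    by (intro Bochner_Integration.integral_cong) (auto simp: indicator_def)
  also have "\<dots> = expectation (\<lambda>w. ?Z w * step_prob t s x w)"
    by (rule expectation_step[OF bs(2) in_params[OF bs x] Z Zb])
  also have "\<dots> = expectation (\<lambda>w. pmf (Q b s) x * (?Z w * pmf (kern t w) s))"
    by (intro Bochner_Integration.integral_cong) (auto simp: step_prob_def)
  also have "\<dots> = pmf (Q b s) x * expectation (\<lambda>w. ?Z w * pmf (kern t w) s)" by (rule integral_mult_right_zero)
  also have "expectation (\<lambda>w. ?Z w * pmf (kern t w) s) = expectation (\<lambda>w. ?Z w * of_bool (st t w = s))"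
    by (rule expectation_state[OF bs(2) Z Zb, symmetric])
  also have "\<dots> = expectation (\<lambda>w. indicator H w * of_bool (arm t w = b \<and> st t w = s))"
    by (intro Bochner_Integration.integral_cong) (auto simp: indicator_def)
  also have "\<dots> = prob {w \<in> H. arm t w = b \<and> sh t w = s}"
    by (rule prob_eq_expectation_AE[OF HM, symmetric]; measurable?) (use estimates_exact_AE in \<open>auto elim!: eventually_mono\<close>)
  finally show "prob {w \<in> H. (arm t w = b \<and> sh t w = s) \<and> xh t w = x} =
      pmf (Q b s) x * prob {w \<in> H. arm t w = b \<and> sh t w = s}" .
qed (simp_all add: pmf_le_1)

end

section \<open>Failure of the estimates\<close>

context tuned_run
begin

lemma prob_UN_le:
  assumes "finite I" "\<And>i. i \<in> I \<Longrightarrow> X i \<in> sets M"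
  shows "prob (\<Union>i\<in>I. X i) \<le> (\<Sum>i\<in>I. prob (X i))"
  using assms by (intro finite_measure_subadditive_finite) auto

text \<open>The accuracy \<delta> stays fixed, so linearly many visits suffice. Too few visits are
  exponentially unlikely by the Laplace bound, and so is a deviation \<delta> after that many; such
  decay beats every power of \<open>u\<close>.\<close>

lemma transition_failure_at:
  assumes \<delta>: "0 < \<delta>" and s: "s \<in> S"
  shows "\<exists>E. (\<forall>u. E u \<in> sets M) \<and> (\<forall>p. summable (\<lambda>u. (real u + 1) powr p * prob (E u))) \<and>
    (\<forall>u. \<forall>w\<in>space M - E u. 0 < count_S (sh_seq w) u s \<and>
      (\<forall>s'\<in>S. \<bar>est_P S (sh_seq w) u s s' - pmf (P s) s'\<bar> \<le> \<delta>))"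
proof -
  obtain r C where r: "0 < r" "r < 1" and C: "0 < C" and lap:
    "\<And>t. 1 \<le> t \<Longrightarrow> expectation (\<lambda>w. exp (- real (count_S (sh_seq w) t s))) \<le> C * r ^ t"
    by (rule visit_laplace_bound[OF s]) blast
  \<comment> \<open>Half of the decay rate of the Laplace bound: Markov's inequality costs the
    factor exp(\<kappa> u), which leaves sqrt(r)^u.\<close>
  define \<kappa> where "\<kappa> = - ln r / 2"
  have \<kappa>: "0 < \<kappa>" using r by (simp add: \<kappa>_def)
  define r1 where "r1 = exp (ln r / 2)"
  have r1: "0 < r1" "r1 < 1" "exp \<kappa> * r = r1"
  proof -
    show "0 < r1" "r1 < 1" using r by (auto simp: r1_def)
    have "exp \<kappa> * exp (ln r) = r1" unfolding exp_add[symmetric] \<kappa>_def r1_def by (simp add: field_simps)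
    then show "exp \<kappa> * r = r1" using r by simp
  qed
  define r2 where "r2 = exp (- 2 * \<delta>\<^sup>2 * \<kappa>)"
  have r2: "0 < r2" "r2 < 1" using \<delta> \<kappa> by (auto simp: r2_def)
  let ?N = "\<lambda>u w. count_S (sh_seq w) u s"
  let ?K = "\<lambda>u s' w. count_SS (sh_seq w) u s s'"
  define D where "D u = {w \<in> space M. real (?N u w) \<le> \<kappa> * real u}" for u
  define G where "G u s' = {w \<in> space M. \<kappa> * real u \<le> real (?N u w) \<and>
      \<delta> * real (?N u w) \<le> \<bar>real (?K u s' w) - pmf (P s) s' * real (?N u w)\<bar>}" for u s'
  define E where "E u = (if u = 0 then space M else D u \<union> (\<Union>s'\<in>S. G u s'))" for u
  have NM[measurable]: "?N u \<in> M \<rightarrow>\<^sub>M count_space UNIV" for u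
    by (rule M_meas[OF count_S_meas[OF order_refl]])
  have D: "D u \<in> sets M" for u unfolding D_def by measurable
  have G: "G u s' \<in> sets M \<and> (1 \<le> u \<longrightarrow> prob (G u s') \<le> 2 * r2 ^ u)" if s': "s' \<in> S" for u s'
  proof -
    interpret T: adapted_trials M F "\<lambda>u w. sh (u - 1) w = s" "\<lambda>u w. sh u w = s'" "pmf (P s) s'"
      by (rule transition_trials[OF s s'])
    have eq: "T.trials u w = ?N u w" "T.successes u w = ?K u s' w" for u w
      by (simp_all only: T.trials_def T.successes_def count_S_def count_SS_def)
    have "G u s' \<in> sets M"
      using T.deviation_event[of "\<kappa> * real u" u \<delta>] unfolding eq G_def .
    moreover have "prob (G u s') \<le> 2 * r2 ^ u" if "1 \<le> u"
      using T.deviation_bound[OF that less_imp_le[OF \<delta>], of "\<kappa> * real u"]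
      unfolding eq G_def r2_def exp_of_nat_mult[symmetric] by (simp add: mult_ac)
    ultimately show ?thesis by blast
  qed
  have E: "E u \<in> sets M" for u
  proof -
    have "(\<Union>s'\<in>S. G u s') \<in> sets M" using G states by (intro sets.finite_UN) blast+
    then show ?thesis unfolding E_def using D by (simp add: sets.Un)
  qed
  define c where "c = C + 2 * card S + 1"
  have PD: "prob (D u) \<le> C * r1 ^ u" if u: "1 \<le> u" for u
  proof -
    let ?Y = "\<lambda>w. exp (- real (?N u w))"
    have "D u = {w \<in> space M. exp (- (\<kappa> * real u)) \<le> ?Y w}" by (simp add: D_def)
    also have "prob \<dots> \<le> expectation ?Y / exp (- (\<kappa> * real u))"
      by (rule integral_Markov_inequality_measure[of _ _ "{}"])
        (auto intro!: bounded_integrable_AE[where c = 1])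
    also have "\<dots> \<le> C * r ^ u / exp (- (\<kappa> * real u))" using lap[OF u] by (intro divide_right_mono) auto
    also have "\<dots> = C * (exp \<kappa> * r) ^ u" by (simp add: power_mult_distrib exp_minus exp_of_nat_mult[symmetric] field_simps)
    finally show ?thesis using r1 by simp
  qed
  have PE: "prob (E u) \<le> (C + 1) * r1 ^ u + 2 * card S * r2 ^ u" for u
  proof (cases "u = 0")
    case True
    have "prob (E u) \<le> 1" by simp
    also have "1 \<le> (C + 1) * r1 ^ u + 2 * card S * r2 ^ u" using True C by simp
    finally show ?thesis .
  next
    case False
    then have u: "1 \<le> u" by simp
    have "prob (E u) \<le> prob (D u) + prob (\<Union>s'\<in>S. G u s')"
    proof -
      have "(\<Union>s'\<in>S. G u s') \<in> sets M" using G states by (intro sets.finite_UN) blast+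
      then show ?thesis unfolding E_def using False D by (simp add: measure_Un_le)
    qed
    also have "\<dots> \<le> C * r1 ^ u + (\<Sum>s'\<in>S. 2 * r2 ^ u)"
    proof (intro add_mono PD[OF u])
      have "prob (\<Union>s'\<in>S. G u s') \<le> (\<Sum>s'\<in>S. prob (G u s'))"
        using G by (intro prob_UN_le states) blast
      also have "\<dots> \<le> (\<Sum>s'\<in>S. 2 * r2 ^ u)" using G u by (intro sum_mono) blast
      finally show "prob (\<Union>s'\<in>S. G u s') \<le> (\<Sum>s'\<in>S. 2 * r2 ^ u)" .
    qed
    also have "\<dots> \<le> (C + 1) * r1 ^ u + 2 * card S * r2 ^ u" using r1 by (simp add: algebra_simps)
    finally show ?thesis .
  qed
  have "summable (\<lambda>u. (real u + 1) powr p * prob (E u))" for p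
  proof (rule summable_comparison_test)
    show "summable (\<lambda>u. (C + 1) * ((real u + 1) powr p * r1 ^ u) + 2 * card S * ((real u + 1) powr p * r2 ^ u))"
      by (intro summable_add summable_mult summable_powr_geometric r1 r2)
    have "(real u + 1) powr p * prob (E u) \<le>
        (real u + 1) powr p * ((C + 1) * r1 ^ u + 2 * card S * r2 ^ u)" for u
      by (rule mult_left_mono[OF PE]) simp
    then show "\<exists>N. \<forall>u\<ge>N. norm ((real u + 1) powr p * prob (E u)) \<le>
        (C + 1) * ((real u + 1) powr p * r1 ^ u) + 2 * card S * ((real u + 1) powr p * r2 ^ u)"
      by (simp add: distrib_left mult_ac)
  qed
  moreover have "0 < ?N u w \<and> (\<forall>s'\<in>S. \<bar>est_P S (sh_seq w) u s s' - pmf (P s) s'\<bar> \<le> \<delta>)"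
    if w: "w \<in> space M - E u" for u w
  proof -
    have u: "u \<noteq> 0" and N: "\<kappa> * real u < real (?N u w)"
      and dev: "\<bar>real (?K u s' w) - pmf (P s) s' * real (?N u w)\<bar> < \<delta> * real (?N u w)" if "s' \<in> S" for s'
      using w that by (fastforce simp: E_def D_def G_def split: if_splits)+
    have "u \<noteq> 0" "\<kappa> * real u < real (?N u w)" using u[OF s] N[OF s] by auto
    then have N0: "0 < real (?N u w)" using \<kappa> by (meson less_le_trans mult_nonneg_nonneg not_le of_nat_0_le_iff less_imp_le)
    have "\<bar>est_P S (sh_seq w) u s s' - pmf (P s) s'\<bar> \<le> \<delta>" if s': "s' \<in> S" for s'
    proof -
      have "est_P S (sh_seq w) u s s' - pmf (P s) s' =
          (real (?K u s' w) - pmf (P s) s' * real (?N u w)) / real (?N u w)"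
        using N0 by (simp add: est_P_def field_simps)
      then show ?thesis using dev[OF s'] N0 by (simp add: abs_divide divide_le_eq less_imp_le)
    qed
    then show ?thesis using N0 by simp
  qed
  ultimately show ?thesis using E by (intro exI[of _ E]) blast
qed

text \<open>The radius depends on the random count, so a union is taken over the at most
  \<open>u\<close> values of the count, each costing at most (u - 1)^(-\<alpha>). The additional
  factor \<open>u\<close> turns the exponent -\<alpha> into 1 - \<alpha>.\<close>

lemma plausible_failure:
  "\<exists>E K. (\<forall>u. E u \<in> sets M) \<and> (\<forall>u. prob (E u) \<le> K * (real u + 1) powr (1 - \<alpha>)) \<and>
    (\<forall>u. \<forall>w\<in>space M - E u. plausible \<alpha> S B \<Theta> (arm_seq w) (sh_seq w) (xh_seq w) u Q)"
proof -
  define I where "I = (SIGMA b:B. SIGMA s:S. \<Theta> b s)"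
  have I: "finite I" unfolding I_def using states arms finite_params by (intro finite_SigmaI) auto
  let ?N = "\<lambda>u b s w. count_BS (arm_seq w) (sh_seq w) u b s"
  let ?K = "\<lambda>u b s x w. count_BSX (arm_seq w) (sh_seq w) (xh_seq w) u b s x"
  define X where "X u b s = 4 * real (u - 1) powr \<alpha> * real (card (\<Theta> b s)) * real (card B) * real (card S)" for u b s
  \<comment> \<open>The radius before capping at 1, for a prescribed count \<open>n\<close>.\<close>
  define c where "c u b s n = sqrt (ln (X u b s) / (2 * real n))" for u b s and n :: nat
  \<comment> \<open>At least \<open>n\<close> trials rather than exactly \<open>n\<close>, as in
    \<open>deviation_bound\<close>; in the end \<open>n\<close> is the actual count.\<close>
  define G where "G u = (\<lambda>((b, s, x), n). {w \<in> space M. real n \<le> real (?N u b s w) \<and>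
      c u b s n * real (?N u b s w) \<le> \<bar>real (?K u b s x w) - pmf (Q b s) x * real (?N u b s w)\<bar>})" for u
  \<comment> \<open>Up to time 1 every radius is 1 and nothing can fail.\<close>
  define E where "E u = (if u \<le> 1 then {} else \<Union>i\<in>I \<times> {1..u}. G u i)" for u
  have X: "4 * real (u - 1) powr \<alpha> \<le> X u b s \<and> 1 \<le> X u b s" if u: "2 \<le> u" and bs: "b \<in> B" "s \<in> S" for u b s
  proof -
    have "1 \<le> real (u - 1) powr \<alpha>" using u \<alpha>_gt by (intro ge_one_powr_ge_zero) auto
    moreover have "4 * real (u - 1) powr \<alpha> * 1 * 1 * 1 \<le> X u b s"
      unfolding X_def using card_Theta_ge_1[OF bs] card_S_ge_1 card_B_ge_1 by (intro mult_mono) auto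
    ultimately show ?thesis by simp
  qed
  have G: "G u i \<in> sets M \<and> (2 \<le> u \<longrightarrow> prob (G u i) \<le> real (u - 1) powr (- \<alpha>))" if i: "i \<in> I \<times> {1..u}" for u i
  proof -
    obtain b s x n where i_eq: "i = ((b, s, x), n)" by (metis prod.exhaust)
    have bs: "b \<in> B" "s \<in> S" and x: "x \<in> \<Theta> b s" and n: "1 \<le> n" using i by (auto simp: i_eq I_def)
    interpret T: adapted_trials M F "\<lambda>u w. arm u w = b \<and> sh u w = s" "\<lambda>u w. xh u w = x" "pmf (Q b s) x"
      by (rule param_trials[OF bs x])
    have eq: "T.trials u w = ?N u b s w" "T.successes u w = ?K u b s x w" for u w
      by (simp_all only: T.trials_def T.successes_def count_BS_def count_BSX_def conj_assoc)
    have "G u i \<in> sets M"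
      using T.deviation_event[of "real n" u "c u b s n"] unfolding eq G_def i_eq prod.case .
    moreover have "prob (G u i) \<le> real (u - 1) powr (- \<alpha>)" if u: "2 \<le> u"
    proof -
      have L0: "0 \<le> ln (X u b s)" using X[OF u bs] by simp
      have "prob (G u i) \<le> 2 * exp (- 2 * (c u b s n)\<^sup>2 * real n)"
        using T.deviation_bound[of u "c u b s n" "real n"] u L0 unfolding eq G_def i_eq by (simp add: c_def)
      also have "- 2 * (c u b s n)\<^sup>2 * real n = - ln (X u b s)" using L0 n by (simp add: c_def)
      also have "2 * exp (- ln (X u b s)) = 2 / X u b s"
        using X[OF u bs] by (simp add: exp_minus inverse_eq_divide)
      also have "\<dots> \<le> 2 / (4 * real (u - 1) powr \<alpha>)"
        using X[OF u bs] u by (intro divide_left_mono mult_pos_pos) auto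
      also have "\<dots> \<le> real (u - 1) powr (- \<alpha>)"
      proof -
        have "2 / (4 * y) \<le> 1 / y" if "0 < y" for y :: real using that by (simp add: field_simps)
        from this[of "real (u - 1) powr \<alpha>"] show ?thesis using u unfolding powr_minus_divide by simp
      qed
      finally show ?thesis .
    qed
    ultimately show ?thesis by blast
  qed
  have E: "E u \<in> sets M" for u unfolding E_def using G I by (auto intro!: sets.finite_UN)
  \<comment> \<open>The power of 3 comes from u - 1 >= (u + 1) / 3 for u >= 2.\<close>
  define K where "K = real (card I) * 3 powr \<alpha>"
  have "prob (E u) \<le> K * (real u + 1) powr (1 - \<alpha>)" for u
  proof (cases "u \<le> 1")
    case True
    then show ?thesis by (simp add: E_def K_def)
  next
    case False
    then have u: "2 \<le> u" by simp
    have "prob (E u) \<le> (\<Sum>i\<in>I \<times> {1..u}. prob (G u i))"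
      unfolding E_def using False G I by (auto intro!: prob_UN_le)
    also have "\<dots> \<le> (\<Sum>i\<in>I \<times> {1..u}. real (u - 1) powr (- \<alpha>))" using G u by (intro sum_mono) blast
    also have "\<dots> = real (card I) * (real u * real (u - 1) powr (- \<alpha>))"
      by (simp add: card_cartesian_product)
    also have "\<dots> \<le> real (card I) * ((real u + 1) * ((real u + 1) / 3) powr (- \<alpha>))"
      using u \<alpha>_gt by (intro mult_left_mono mult_mono powr_mono2') auto
    also have "\<dots> = real (card I) * (3 powr \<alpha> * ((real u + 1) * (real u + 1) powr (- \<alpha>)))"
      by (simp add: powr_divide powr_minus field_simps)
    also have "(real u + 1) * (real u + 1) powr (- \<alpha>) = (real u + 1) powr (1 - \<alpha>)"
      using powr_add[of "real u + 1" 1 "- \<alpha>"] by simp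
    finally show ?thesis by (simp add: K_def)
  qed
  moreover have "plausible \<alpha> S B \<Theta> (arm_seq w) (sh_seq w) (xh_seq w) u Q"
    if w: "w \<in> space M - E u" for u w
    unfolding plausible_def
  proof (intro ballI conjI)
    fix b s assume bs: "b \<in> B" "s \<in> S"
    show "set_pmf (Q b s) \<subseteq> \<Theta> b s" by (rule param_law[OF bs])
    fix x assume x: "x \<in> \<Theta> b s"
    define N K' where "N = ?N u b s w" and "K' = ?K u b s x w"
    let ?e = "est_Q \<Theta> (arm_seq w) (sh_seq w) (xh_seq w) u b s x"
    let ?c = "conf_\<Theta> \<alpha> S B \<Theta> (arm_seq w) (sh_seq w) u b s"
    have KN: "K' \<le> N" unfolding K'_def N_def count_BS_def count_BSX_def by (intro card_mono) auto
    have N_le: "N \<le> u"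
    proof -
      have "N \<le> card {1..<u}" unfolding N_def count_BS_def by (intro card_mono) auto
      then show ?thesis by simp
    qed
    have "0 \<le> ?e \<and> ?e \<le> 1"
      using KN card_Theta_ge_1[OF bs] by (auto simp: est_Q_def N_def[symmetric] K'_def[symmetric])
    then have one: "\<bar>pmf (Q b s) x - ?e\<bar> \<le> 1" using pmf_le_1[of "Q b s" x] pmf_nonneg[of "Q b s" x] by linarith
    show "\<bar>pmf (Q b s) x - ?e\<bar> \<le> ?c"
    proof (cases "u \<le> 1 \<or> N = 0")
      case True
      then show ?thesis using one by (auto simp: conf_\<Theta>_def N_def)
    next
      case False
      then have N: "0 < real N" and u: "\<not> u \<le> 1" by auto
      have "((b, s, x), N) \<in> I \<times> {1..u}" using bs x N N_le by (auto simp: I_def)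
      then have "w \<notin> G u ((b, s, x), N)" using w u by (auto simp: E_def)
      then have "\<bar>real K' - pmf (Q b s) x * real N\<bar> < c u b s N * real N"
        using w by (auto simp: G_def N_def[symmetric] K'_def[symmetric])
      moreover have "pmf (Q b s) x - ?e = - ((real K' - pmf (Q b s) x * real N) / real N)"
        using N by (simp add: est_Q_def N_def[symmetric] K'_def[symmetric] field_simps)
      ultimately have "\<bar>pmf (Q b s) x - ?e\<bar> \<le> c u b s N"
        using N by (simp add: abs_divide divide_le_eq less_imp_le)
      with one show ?thesis using False u
        by (simp add: conf_\<Theta>_def N_def[symmetric] c_def X_def)
    qed
  qed
  ultimately show ?thesis using E by (intro exI[of _ E] exI[of _ K]) blast
qed

text \<open>Any value strictly between 0 and \<alpha> - 3 would do: failures of order u^(1 -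
  \<alpha>), weighted by round ends of order u^(1 + \<eta>), are summable when 2 + \<eta> - \<alpha>
  < -1.\<close>

definition \<eta> :: real where "\<eta> = (\<alpha> - 3) / 2"

text \<open>Positive counts exclude the uniform default row of \<open>est_P\<close>, which could
  charge impossible transitions.\<close>

definition estimates_good :: "real \<Rightarrow> nat \<Rightarrow> 'w \<Rightarrow> bool" where
  "estimates_good \<delta> u w \<longleftrightarrow>
     (\<forall>s\<in>S. 0 < count_S (sh_seq w) u s \<and>
       (\<forall>s'\<in>S. \<bar>est_P S (sh_seq w) u s s' - pmf (P s) s'\<bar> \<le> \<delta>)) \<and>
     plausible \<alpha> S B \<Theta> (arm_seq w) (sh_seq w) (xh_seq w) u Q"

text \<open>Up to a constant, the weight is the bound on the end of a round started at
  \<open>u\<close>.\<close>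

lemma failure_events:
  assumes \<delta>: "0 < \<delta>"
  obtains E where "\<And>u. E u \<in> sets M" "summable (\<lambda>u. (real u + 1) powr (1 + \<eta>) * prob (E u))"
    "\<And>u w. w \<in> space M - E u \<Longrightarrow> estimates_good \<delta> u w"
proof -
  have "\<forall>s\<in>S. \<exists>E. (\<forall>u. E u \<in> sets M) \<and> (\<forall>p. summable (\<lambda>u. (real u + 1) powr p * prob (E u))) \<and>
    (\<forall>u. \<forall>w\<in>space M - E u. 0 < count_S (sh_seq w) u s \<and>
      (\<forall>s'\<in>S. \<bar>est_P S (sh_seq w) u s s' - pmf (P s) s'\<bar> \<le> \<delta>))"
    using transition_failure_at[OF \<delta>] by (intro ballI)
  from bchoice[OF this] obtain EP where EP_all: "\<forall>s\<in>S. (\<forall>u. EP s u \<in> sets M) \<and>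
    (\<forall>p. summable (\<lambda>u. (real u + 1) powr p * prob (EP s u))) \<and>
    (\<forall>u. \<forall>w\<in>space M - EP s u. 0 < count_S (sh_seq w) u s \<and>
      (\<forall>s'\<in>S. \<bar>est_P S (sh_seq w) u s s' - pmf (P s) s'\<bar> \<le> \<delta>))"
    by (elim exE)
  have EP: "EP s u \<in> sets M" "summable (\<lambda>u. (real u + 1) powr p * prob (EP s u))"
    "w \<in> space M - EP s u \<Longrightarrow> 0 < count_S (sh_seq w) u s \<and>
      (\<forall>s'\<in>S. \<bar>est_P S (sh_seq w) u s s' - pmf (P s) s'\<bar> \<le> \<delta>)" if "s \<in> S" for s u p w
    using EP_all[rule_format, OF that] by blast+
  obtain EQ K where EQ_all: "(\<forall>u. EQ u \<in> sets M) \<and> (\<forall>u. prob (EQ u) \<le> K * (real u + 1) powr (1 - \<alpha>)) \<and>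
    (\<forall>u. \<forall>w\<in>space M - EQ u. plausible \<alpha> S B \<Theta> (arm_seq w) (sh_seq w) (xh_seq w) u Q)"
    using plausible_failure by (elim exE)
  have EQ: "EQ u \<in> sets M" "prob (EQ u) \<le> K * (real u + 1) powr (1 - \<alpha>)"
    "w \<in> space M - EQ u \<Longrightarrow> plausible \<alpha> S B \<Theta> (arm_seq w) (sh_seq w) (xh_seq w) u Q" for u w
    using EQ_all by blast+
  define E where "E u = EQ u \<union> (\<Union>s\<in>S. EP s u)" for u
  show thesis
  proof (rule that[of E])
    show "E u \<in> sets M" for u unfolding E_def using EQ EP states by (auto intro!: sets.finite_UN)
    show "estimates_good \<delta> u w" if "w \<in> space M - E u" for u w
      using EP(3)[of _ w u] EQ(3)[of w u] that by (auto simp: estimates_good_def E_def)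
    show "summable (\<lambda>u. (real u + 1) powr (1 + \<eta>) * prob (E u))"
    proof (rule summable_comparison_test)
      have "summable (\<lambda>u. real (Suc u) powr (2 + \<eta> - \<alpha>))"
        using \<alpha>_gt by (subst summable_Suc_iff[of "\<lambda>u. real u powr (2 + \<eta> - \<alpha>)"])
          (simp add: summable_real_powr_iff \<eta>_def field_simps)
      then have "summable (\<lambda>u. (real u + 1) powr (2 + \<eta> - \<alpha>))" by (simp add: add.commute)
      then show "summable (\<lambda>u. K * (real u + 1) powr (2 + \<eta> - \<alpha>) + (\<Sum>s\<in>S. (real u + 1) powr (1 + \<eta>) * prob (EP s u)))"
        by (intro summable_add summable_mult summable_sum EP)
      have "(real u + 1) powr (1 + \<eta>) * prob (E u) \<le>
          K * (real u + 1) powr (2 + \<eta> - \<alpha>) + (\<Sum>s\<in>S. (real u + 1) powr (1 + \<eta>) * prob (EP s u))" for u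
      proof -
        have "prob (E u) \<le> prob (EQ u) + prob (\<Union>s\<in>S. EP s u)"
          unfolding E_def using EQ EP states by (intro measure_Un_le) auto
        also have "\<dots> \<le> K * (real u + 1) powr (1 - \<alpha>) + (\<Sum>s\<in>S. prob (EP s u))"
          using EP states by (intro add_mono EQ prob_UN_le) auto
        finally have "(real u + 1) powr (1 + \<eta>) * prob (E u) \<le>
            (real u + 1) powr (1 + \<eta>) * (K * (real u + 1) powr (1 - \<alpha>) + (\<Sum>s\<in>S. prob (EP s u)))"
          by (intro mult_left_mono) auto
        also have "\<dots> = K * ((real u + 1) powr (1 + \<eta>) * (real u + 1) powr (1 - \<alpha>)) +
            (\<Sum>s\<in>S. (real u + 1) powr (1 + \<eta>) * prob (EP s u))"
          unfolding distrib_left sum_distrib_left by simp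
        also have "(real u + 1) powr (1 + \<eta>) * (real u + 1) powr (1 - \<alpha>) = (real u + 1) powr (2 + \<eta> - \<alpha>)"
          by (simp add: powr_add[symmetric] algebra_simps)
        finally show ?thesis .
      qed
      then show "\<exists>N. \<forall>u\<ge>N. norm ((real u + 1) powr (1 + \<eta>) * prob (E u)) \<le>
          K * (real u + 1) powr (2 + \<eta> - \<alpha>) + (\<Sum>s\<in>S. (real u + 1) powr (1 + \<eta>) * prob (EP s u))"
        by simp
    qed
  qed
qed

end

section \<open>Counting suboptimal steps\<close>

context tuned_run
begin

text \<open>Measured at the centre rather than at the action played: the centre is known before the
  step, and the cost of exploration is accounted for separately.\<close>

definition loss :: "nat \<Rightarrow> 'w \<Rightarrow> real" where
  "loss t w = best_reward (st (t - 1) w) - true_reward (st (t - 1) w) (arm t w) (center t w)"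

text \<open>A suboptimal choice of arm \<open>b\<close> without failure of an estimate is blamed on a possible next state
  \<open>s'\<close> for which the parameter law has been sampled too rarely.\<close>

definition blamed :: "real \<Rightarrow> 'b \<Rightarrow> 's \<Rightarrow> nat \<Rightarrow> 'w \<Rightarrow> bool" where
  "blamed L b s' t w \<longleftrightarrow> arm t w = b \<and> pmf (P (st (t - 1) w)) s' > 0 \<and>
     real (count_BS (arm_seq w) (sh_seq w) t b s') \<le> L"

text \<open>A radius above \<delta>/2 at the start of the round is above \<delta>/4 at
  \<open>t\<close>, and ln(..) / (2 n) > (\<delta>/4)^2 means n < 8 ln(..) / \<delta>^2.\<close>

definition count_limit :: "real \<Rightarrow> nat \<Rightarrow> real" where
  "count_limit \<delta> T = 8 * ln (4 * real T powr \<alpha> * real (C_\<Theta> S B \<Theta>) * real (card B) * real (card S)) / \<delta>\<^sup>2"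

lemma loss_bounds:
  assumes w: "w \<in> space M" and c: "center t w \<in> A"
  shows "0 \<le> loss t w" "loss t w \<le> rmax"
proof -
  show "0 \<le> loss t w" using true_reward_le_best[OF arm_in[OF w] c] by (simp add: loss_def)
  obtain b a where ba: "b \<in> B" "a \<in> A" "true_reward (st (t - 1) w) b a = best_reward (st (t - 1) w)"
    by (rule best_reward_attained)
  show "loss t w \<le> rmax"
    unfolding loss_def ba(3)[symmetric]
    by (rule true_reward_diff_le[OF st_in[OF w] st_in[OF w] ba(1) arm_in[OF w] ba(2) c])
qed

text \<open>Either the round started with a failure, or at its start a radius at the arm played
  exceeded \<delta>/2 for some possible next state, which is then blamed, or the choice is optimal
  and loses nothing.\<close>

lemma loss_le_AE:
  assumes stable: "optimal_pairs_stable S B A \<Theta> P Q \<delta>" and \<delta>: "0 < \<delta>"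
    and E: "\<And>u w. w \<in> space M - E u \<Longrightarrow> estimates_good \<delta> u w"
    and t: "1 \<le> t" "t \<le> T"
  shows "AE w in M. loss t w \<le> rmax *
    (of_bool (w \<in> E (rstart t w)) + (\<Sum>b\<in>B. \<Sum>s'\<in>S. of_bool (blamed (count_limit \<delta> T) b s' t w)))"
  using policy_choice center_in_AE estimates_exact_AE transition_pos_AE AE_space
proof eventually_elim
  case (elim w)
  note w = elim(5)
  have c: "center t w \<in> A" using elim(2) by blast
  have sh: "sh u w = st u w" for u using elim(3) by blast
  let ?s = "st (t - 1) w" and ?u = "rstart t w"
  have sum0: "0 \<le> (\<Sum>b\<in>B. \<Sum>s'\<in>S. of_bool (blamed (count_limit \<delta> T) b s' t w) :: real)"
    by (intro sum_nonneg) simp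
  consider "w \<in> E ?u" | b s' where "b \<in> B" "s' \<in> S" "blamed (count_limit \<delta> T) b s' t w" | "loss t w = 0"
  proof (cases "w \<in> E ?u")
    case True
    then show ?thesis by (rule that(1))
  next
    case False
    then have good: "estimates_good \<delta> ?u w" using w by (intro E) blast
    let ?conf = "conf_\<Theta> \<alpha> S B \<Theta> (arm_seq w) (sh_seq w)"
    show ?thesis
    proof (cases "\<forall>s'\<in>S. pmf (P ?s) s' > 0 \<longrightarrow> ?conf ?u (arm t w) s' \<le> \<delta> / 2")
      case True
      have prev: "prev t w = ?s" using t sh by (simp add: prev_def)
      have ch: "optimistic_choice \<alpha> S B A \<Theta> (arm_seq w) (sh_seq w) (xh_seq w) ?u ?s (choice t w)"
        using elim(1) st_in[OF w] unfolding choice_def prev unfolding rstart_def by (simp add: round_start_idem)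
      have "true_reward ?s (fst (choice t w)) (snd (choice t w)) = best_reward ?s"
      proof (rule optimistic_choice_optimal[OF stable less_imp_le[OF \<delta>] _ _ _ _ _ ch])
        show "sh u w \<in> S" for u by (rule sh_in[OF w])
        show "0 < count_S (sh_seq w) ?u s" if "s \<in> S" for s
          using good that by (simp add: estimates_good_def)
        show "\<bar>est_P S (sh_seq w) ?u s s' - pmf (P s) s'\<bar> \<le> \<delta>" if "s \<in> S" "s' \<in> S" for s s'
          using good that by (simp add: estimates_good_def)
        show "plausible \<alpha> S B \<Theta> (arm_seq w) (sh_seq w) (xh_seq w) ?u Q"
          using good by (simp add: estimates_good_def)
        show "?s \<in> S" by (rule st_in[OF w])
      next
        fix s s' assume "s \<in> S" "s' \<in> S" and p0: "pmf (P s) s' = 0"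
        \<comment> \<open>Impossible transitions are almost surely never made, hence never
          counted.\<close>
        have "\<not> (sh (v - 1) w = s \<and> sh v w = s')" if "v \<in> {1..<?u}" for v
        proof
          assume "sh (v - 1) w = s \<and> sh v w = s'"
          then have "pmf (P s) s' > 0" using elim(4)[rule_format, of v] that by (auto simp: sh)
          then show False using p0 by simp
        qed
        then have "count_SS (sh_seq w) ?u s s' = 0" unfolding count_SS_def card_eq_0_iff by blast
        then show "est_P S (sh_seq w) ?u s s' = 0"
          using good \<open>s \<in> S\<close> by (simp add: est_P_def estimates_good_def)
      next
        show "?conf ?u (fst (choice t w)) s' \<le> \<delta> / 2" if "s' \<in> S" "pmf (P ?s) s' > 0" for s'
          using True that by (simp add: arm_eq[OF w])
      qed
      then have "loss t w = 0" by (simp add: loss_def arm_eq[OF w] center_def)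
      then show ?thesis by (rule that(3))
    next
      case False
      then obtain s' where s': "s' \<in> S" "pmf (P ?s) s' > 0" "\<delta> / 2 < ?conf ?u (arm t w) s'" by force
      have b: "arm t w \<in> B" by (rule arm_in[OF w])
      have "real (count_BS (arm_seq w) (sh_seq w) t (arm t w) s')
          \<le> 2 * ln (4 * real T powr \<alpha> * real (C_\<Theta> S B \<Theta>) * real (card B) * real (card S)) / (\<delta> / 2)\<^sup>2"
        using s'(3) \<delta> \<alpha>_gt t card_Theta_ge_1[OF b s'(1)] card_Theta_le[OF b s'(1)] card_S_ge_1 card_B_ge_1
        unfolding rstart_def by (intro count_BS_le_of_conf_ge[OF _ _ b s'(1) t(2)]) auto
      also have "\<dots> = count_limit \<delta> T" by (simp add: count_limit_def power2_eq_square field_simps)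
      finally have "blamed (count_limit \<delta> T) (arm t w) s' t w" using s' by (simp add: blamed_def)
      with that(2)[OF b s'(1)] show ?thesis by blast
    qed
  qed
  then show ?case
  proof cases
    case 1
    have "loss t w \<le> rmax * 1" using loss_bounds[OF w c] by simp
    also have "\<dots> \<le> rmax * (of_bool (w \<in> E ?u) + (\<Sum>b\<in>B. \<Sum>s'\<in>S. of_bool (blamed (count_limit \<delta> T) b s' t w)))"
      using 1 sum0 by (intro mult_left_mono r_max_nonneg) simp
    finally show ?thesis .
  next
    case (2 b s')
    have "(1::real) \<le> (\<Sum>s'\<in>S. of_bool (blamed (count_limit \<delta> T) b s' t w))"
      using member_le_sum[of s' S "\<lambda>s'. of_bool (blamed (count_limit \<delta> T) b s' t w) :: real"] 2 states by simp
    also have "\<dots> \<le> (\<Sum>b\<in>B. \<Sum>s'\<in>S. of_bool (blamed (count_limit \<delta> T) b s' t w))"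
      using 2 arms by (intro member_le_sum sum_nonneg) auto
    finally have 1: "(1::real) \<le> \<dots>" .
    have "loss t w \<le> rmax * 1" using loss_bounds[OF w c] by simp
    also have "\<dots> \<le> rmax * (of_bool (w \<in> E ?u) + (\<Sum>b\<in>B. \<Sum>s'\<in>S. of_bool (blamed (count_limit \<delta> T) b s' t w)))"
      using 1 by (intro mult_left_mono r_max_nonneg) simp
    finally show ?thesis .
  next
    case 3
    then show ?thesis using sum0 r_max_nonneg by simp
  qed
qed

lemma blamed_meas: "1 \<le> t \<Longrightarrow> Measurable.pred (F t) (blamed L b s' t)"
proof -
  assume t: "1 \<le> t"
  have "(\<lambda>w. real (count_BS (arm_seq w) (sh_seq w) t b s')) \<in> borel_measurable (F t)"
    by (rule measurable_count_space_borel[OF count_BS_meas]) simp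
  moreover have "(\<lambda>w. pmf (P (st (t - 1) w)) s') \<in> borel_measurable (F t)"
    using t by (intro st_fun_meas) simp
  moreover have "Measurable.pred (F t) (\<lambda>w. arm t w = b)" by (intro measurable_eq_const[OF arm_meas]) simp
  ultimately show ?thesis unfolding blamed_def[abs_def] by (intro pred_intros_logic) simp_all
qed

text \<open>Each blamed step visits \<open>s'\<close> with probability at least \<open>1 / T_S\<close>, and such a visit raises the count
  that is bounded by \<open>L\<close>.\<close>

lemma sum_blamed_le:
  assumes s': "s' \<in> S" and L: "0 \<le> L"
  shows "(\<Sum>t=1..T. expectation (\<lambda>w. of_bool (blamed L b s' t w))) \<le> T_S S P * (L + 1)"
proof -
  have bM: "Measurable.pred M (blamed L b s' t)" if "1 \<le> t" for t
    by (rule M_meas[OF blamed_meas[OF that]])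
  have step: "expectation (\<lambda>w. of_bool (blamed L b s' t w)) \<le>
      T_S S P * expectation (\<lambda>w. of_bool (blamed L b s' t w \<and> st t w = s'))" if t: "1 \<le> t" for t
  proof -
    note [measurable] = bM[OF t]
    let ?Z = "\<lambda>w. of_bool (blamed L b s' t w) :: real"
    have Z: "?Z \<in> borel_measurable (F t)" using blamed_meas[OF t, of L b s'] unfolding of_bool_def by measurable
    have pM[measurable]: "(\<lambda>w. pmf (kern t w) s') \<in> borel_measurable M"
      using M_meas[OF kern_pmf_meas[of "\<lambda>x. x"]] .
    have ZM[measurable]: "?Z \<in> borel_measurable M" by (rule M_meas[OF Z])
    have "expectation ?Z \<le> expectation (\<lambda>w. T_S S P * (?Z w * pmf (kern t w) s'))"
    proof (rule integral_mono)
      show "integrable M ?Z" by (rule bounded_integrable_AE[of _ 1]) auto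
      show "integrable M (\<lambda>w. T_S S P * (?Z w * pmf (kern t w) s'))"
        by (intro integrable_mult_right bounded_integrable_AE[of _ 1]) (auto simp: pmf_le_1)
      fix w assume w: "w \<in> space M"
      show "?Z w \<le> T_S S P * (?Z w * pmf (kern t w) s')"
      proof (cases "blamed L b s' t w")
        case True
        then have "inverse (T_S S P) \<le> pmf (P (st (t - 1) w)) s'"
          using pmf_ge_inverse_T_S[OF st_in[OF w] s'] by (simp add: blamed_def)
        then have "T_S S P * inverse (T_S S P) \<le> T_S S P * pmf (P (st (t - 1) w)) s'"
          using T_S_pos by (intro mult_left_mono) auto
        then show ?thesis using True T_S_pos t by (simp add: kern_def)
      qed simp
    qed
    also have "\<dots> = T_S S P * expectation (\<lambda>w. ?Z w * of_bool (st t w = s'))"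
      using expectation_state[OF s' Z, of 1] by simp
    also have "(\<lambda>w. ?Z w * of_bool (st t w = s')) = (\<lambda>w. of_bool (blamed L b s' t w \<and> st t w = s'))" by auto
    finally show ?thesis .
  qed
  have intV: "integrable M (\<lambda>w. of_bool (blamed L b s' t w \<and> st t w = s') :: real)" if "t \<in> {1..T}" for t
  proof -
    have [measurable]: "Measurable.pred M (blamed L b s' t)" using that by (intro bM) simp
    show ?thesis by (rule bounded_integrable_AE[of _ 1]) auto
  qed
  have "(\<Sum>t=1..T. expectation (\<lambda>w. of_bool (blamed L b s' t w))) \<le>
      (\<Sum>t=1..T. T_S S P * expectation (\<lambda>w. of_bool (blamed L b s' t w \<and> st t w = s')))"
    by (intro sum_mono step) simp
  also have "\<dots> = T_S S P * expectation (\<lambda>w. \<Sum>t=1..T. of_bool (blamed L b s' t w \<and> st t w = s'))"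
    unfolding sum_distrib_left[symmetric] by (subst Bochner_Integration.integral_sum[OF intV]) simp_all
  also have "\<dots> \<le> T_S S P * expectation (\<lambda>w. L + 1)"
  proof (intro mult_left_mono integral_mono_AE)
    show "integrable M (\<lambda>w. \<Sum>t=1..T. of_bool (blamed L b s' t w \<and> st t w = s') :: real)"
      by (intro Bochner_Integration.integrable_sum intV)
    show "AE w in M. (\<Sum>t=1..T. of_bool (blamed L b s' t w \<and> st t w = s')) \<le> L + 1"
      using estimates_exact_AE
    proof eventually_elim
      case (elim w)
      define J where "J = {t \<in> {1..T}. blamed L b s' t w \<and> st t w = s'}"
      have J: "finite J" by (simp add: J_def)
      have "(\<Sum>t=1..T. of_bool (blamed L b s' t w \<and> st t w = s')) = real (card J)"
        unfolding J_def by (simp add: of_bool_def sum.If_cases Int_def)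
      also have "\<dots> \<le> L + 1"
      proof (cases "J = {}")
        case False
        \<comment> \<open>At the last such step all earlier ones are already counted, so there are
          at most \<open>L\<close> of them; the summand 1 is the last step itself.\<close>
        define m where "m = Max J"
        have m: "m \<in> J" "\<And>t. t \<in> J \<Longrightarrow> t \<le> m" using J False by (auto simp: m_def)
        have "J - {m} \<subseteq> {u \<in> {1..<m}. arm u w = b \<and> sh u w = s'}"
          using m(2) elim by (force simp: J_def blamed_def)
        then have "card (J - {m}) \<le> count_BS (arm_seq w) (sh_seq w) m b s'"
          unfolding count_BS_def by (intro card_mono) auto
        then have "real (card J) \<le> real (count_BS (arm_seq w) (sh_seq w) m b s') + 1"
          using J m(1) by simp
        moreover have "real (count_BS (arm_seq w) (sh_seq w) m b s') \<le> L"
          using m(1) by (simp add: J_def blamed_def)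
        ultimately show ?thesis by linarith
      qed (use L in simp)
      finally show ?case .
    qed
  qed (use T_S_pos in auto)
  finally show ?thesis by (simp add: prob_space)
qed

text \<open>A failure at \<open>u\<close> affects only times in a round started at \<open>u\<close>,
  all of which are at most \<open>len u\<close>. It is thus charged at most \<open>len u\<close>
  times, and exchanging the sums leaves the summable series.\<close>

lemma sum_failure_le:
  assumes E: "\<And>u. E u \<in> sets M" and summ: "summable (\<lambda>u. (real u + 1) powr (1 + \<eta>) * prob (E u))"
  shows "\<exists>c. \<forall>T. (\<Sum>t=1..T. prob {w \<in> space M. w \<in> E (rstart t w)}) \<le> c"
proof -
  have "0 < \<eta>" using \<alpha>_gt by (simp add: \<eta>_def)
  then obtain C where C: "0 < C" and len_all: "\<forall>B \<Theta> arm sh t. (\<forall>u. sh u \<in> S) \<longrightarrow>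
      real t \<le> C * (real (round_start \<alpha> S (B :: 'b set) (\<Theta> :: 'b \<Rightarrow> 's \<Rightarrow> (real^'n) set) arm sh t) + 1) powr (1 + \<eta>)"
    using round_length_bound[OF states, of \<alpha> \<eta>] \<alpha>_gt by auto
  define len where "len u = C * (real u + 1) powr (1 + \<eta>)" for u
  have len: "real t \<le> len (rstart t w)" if "w \<in> space M" for t w
    using len_all[rule_format, of "\<lambda>u. sh u w" t B \<Theta> "\<lambda>u. arm u w"] sh_in[OF that] unfolding len_def rstart_def by blast
  have len0: "0 \<le> len u" for u using C by (simp add: len_def)
  have each: "prob {w \<in> space M. w \<in> E (rstart t w)} \<le> (\<Sum>u\<le>T. if real t \<le> len u then prob (E u) else 0)"
    if t: "t \<in> {1..T}" for t T
  proof -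
    have "{w \<in> space M. w \<in> E (rstart t w)} \<subseteq> (\<Union>u\<in>{..T}. if real t \<le> len u then E u else {})"
    proof
      fix w assume w: "w \<in> {w \<in> space M. w \<in> E (rstart t w)}"
      then have "real t \<le> len (rstart t w)" using len by blast
      moreover have "rstart t w \<le> T" using rstart_le[of t w] t by simp
      ultimately show "w \<in> (\<Union>u\<in>{..T}. if real t \<le> len u then E u else {})" using w by auto
    qed
    then have "prob {w \<in> space M. w \<in> E (rstart t w)} \<le> prob (\<Union>u\<in>{..T}. if real t \<le> len u then E u else {})"
      using E by (intro finite_measure_mono) auto
    also have "\<dots> \<le> (\<Sum>u\<in>{..T}. prob (if real t \<le> len u then E u else {}))"
      using E by (intro prob_UN_le) auto
    also have "\<dots> = (\<Sum>u\<le>T. if real t \<le> len u then prob (E u) else 0)" by (intro sum.cong) auto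
    finally show ?thesis .
  qed
  have "(\<Sum>t=1..T. prob {w \<in> space M. w \<in> E (rstart t w)}) \<le> C * (\<Sum>u. (real u + 1) powr (1 + \<eta>) * prob (E u))" for T
  proof -
    have "(\<Sum>t=1..T. prob {w \<in> space M. w \<in> E (rstart t w)}) \<le>
        (\<Sum>t=1..T. \<Sum>u\<le>T. if real t \<le> len u then prob (E u) else 0)"
      by (intro sum_mono each)
    also have "\<dots> = (\<Sum>u\<le>T. \<Sum>t=1..T. if real t \<le> len u then prob (E u) else 0)" by (rule sum.swap)
    also have "\<dots> \<le> (\<Sum>u\<le>T. C * ((real u + 1) powr (1 + \<eta>) * prob (E u)))"
    proof (intro sum_mono)
      fix u
      have "{t \<in> {1..T}. real t \<le> len u} \<subseteq> {1..nat \<lfloor>len u\<rfloor>}" by (auto simp: le_nat_floor)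
      then have "card {t \<in> {1..T}. real t \<le> len u} \<le> card {1..nat \<lfloor>len u\<rfloor>}" by (intro card_mono) auto
      then have "real (card {t \<in> {1..T}. real t \<le> len u}) \<le> real (nat \<lfloor>len u\<rfloor>)" by simp
      also have "\<dots> \<le> len u" by (rule of_nat_floor[OF len0])
      finally have cd: "real (card {t \<in> {1..T}. real t \<le> len u}) \<le> len u" .
      have "(\<Sum>t=1..T. if real t \<le> len u then prob (E u) else 0) = real (card {t \<in> {1..T}. real t \<le> len u}) * prob (E u)"
        by (simp add: sum.If_cases Int_def)
      also have "\<dots> \<le> len u * prob (E u)" by (intro mult_right_mono cd) simp
      finally show "(\<Sum>t=1..T. if real t \<le> len u then prob (E u) else 0) \<le> C * ((real u + 1) powr (1 + \<eta>) * prob (E u))"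
        by (simp add: len_def mult_ac)
    qed
    also have "\<dots> = C * (\<Sum>u\<le>T. (real u + 1) powr (1 + \<eta>) * prob (E u))" by (rule sum_distrib_left[symmetric])
    also have "\<dots> \<le> C * (\<Sum>u. (real u + 1) powr (1 + \<eta>) * prob (E u))"
      using C by (intro mult_left_mono sum_le_suminf[OF summ]) auto
    finally show ?thesis .
  qed
  then show ?thesis by blast
qed

section \<open>Integrability and mean of the reward of a step\<close>

lemma reward_integrable: "integrable M (\<lambda>w. act t w \<bullet> par t w)"
proof -
  obtain K where K: "\<And>a x. a \<in> A \<Longrightarrow> x \<in> all_params \<Longrightarrow> \<bar>a \<bullet> x\<bar> \<le> K" using rewards_bounded by blast
  show ?thesis
    by (rule bounded_integrable_AE[of _ K]) (use act_in_AE[of t] par_in_params_AE[of t] K in \<open>auto elim: eventually_elim2\<close>)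
qed

lemma center_meas_M[measurable]: "center t \<in> borel_measurable M"
  by (rule M_meas[OF center_meas])

lemma center_reward_integrable: "integrable M (\<lambda>w. center t w \<bullet> par t w)"
proof -
  obtain K where K: "\<And>a x. a \<in> A \<Longrightarrow> x \<in> all_params \<Longrightarrow> \<bar>a \<bullet> x\<bar> \<le> K" using rewards_bounded by blast
  show ?thesis
  proof (rule bounded_integrable_AE[of _ K])
    show "AE w in M. \<bar>center t w \<bullet> par t w\<bar> \<le> K"
      using center_in_AE par_in_params_AE[of t] by eventually_elim (use K in blast)
  qed measurable
qed

text \<open>Arm and centre are known before the step, so averaging the new state and parameter over
  \<open>step_prob\<close> leaves the one-step reward.\<close>

lemma expectation_center_reward:
  assumes t: "1 \<le> t"
  shows "expectation (\<lambda>w. center t w \<bullet> par t w) =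
    expectation (\<lambda>w. true_reward (st (t - 1) w) (arm t w) (center t w))"
proof -
  obtain K where K: "\<And>a x. a \<in> A \<Longrightarrow> x \<in> all_params \<Longrightarrow> \<bar>a \<bullet> x\<bar> \<le> K" using rewards_bounded by blast
  note [measurable] = center_meas[of t]
  have "expectation (\<lambda>w. center t w \<bullet> par t w) =
      expectation (\<lambda>w. \<Sum>s\<in>S. \<Sum>x\<in>all_params. center t w \<bullet> x * step_prob t s x w)"
  proof (rule expectation_state_param[where G = "\<lambda>s x w. center t w \<bullet> x" and c = K])
    show "AE w in M. \<bar>center t w \<bullet> x\<bar> \<le> K" if "x \<in> all_params" for x
      using center_in_AE by eventually_elim (use K that in blast)
  qed measurable
  also have "\<dots> = expectation (\<lambda>w. true_reward (st (t - 1) w) (arm t w) (center t w))"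
  proof (rule Bochner_Integration.integral_cong[OF refl])
    fix w assume w: "w \<in> space M"
    have b: "arm t w \<in> B" by (rule arm_in[OF w])
    \<comment> \<open>Parameters outside the set of the arm and state have probability zero.\<close>
    have "(\<Sum>s\<in>S. \<Sum>x\<in>all_params. center t w \<bullet> x * step_prob t s x w) =
        (\<Sum>s\<in>S. \<Sum>x\<in>\<Theta> (arm t w) s. center t w \<bullet> x * step_prob t s x w)"
    proof (rule sum.cong[OF refl])
      fix s assume s: "s \<in> S"
      show "(\<Sum>x\<in>all_params. center t w \<bullet> x * step_prob t s x w) =
          (\<Sum>x\<in>\<Theta> (arm t w) s. center t w \<bullet> x * step_prob t s x w)"
      proof (rule sum.mono_neutral_right[OF finite_all_params])
        show "\<Theta> (arm t w) s \<subseteq> all_params" using in_params[OF b s] by blast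
        show "\<forall>x\<in>all_params - \<Theta> (arm t w) s. center t w \<bullet> x * step_prob t s x w = 0"
          using param_law[OF b s] by (auto simp: step_prob_def pmf_eq_0_set_pmf)
      qed
    qed
    also have "\<dots> = true_reward (st (t - 1) w) (arm t w) (center t w)"
      using t unfolding true_reward_def expected_reward_def
      by (auto simp: step_prob_def kern_def sum_distrib_left mult_ac intro!: sum.cong)
    finally show "(\<Sum>s\<in>S. \<Sum>x\<in>all_params. center t w \<bullet> x * step_prob t s x w) =
        true_reward (st (t - 1) w) (arm t w) (center t w)" .
  qed
  finally show ?thesis .
qed

end

section \<open>The regret bound\<close>

lemma optimal_pairs_stable_mono:
  assumes st: "optimal_pairs_stable S B A \<Theta> P Q \<delta>" and le: "\<delta>' \<le> \<delta>"
  shows "optimal_pairs_stable S B A \<Theta> P Q \<delta>'"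
  unfolding optimal_pairs_stable_def
proof (intro allI impI, elim conjE)
  fix P' Q'
  assume 1: "transition_matrix_on S P'" "\<forall>b\<in>B. \<forall>s\<in>S. set_pmf (Q' b s) \<subseteq> \<Theta> b s"
    and P': "\<forall>s\<in>S. \<forall>s'\<in>S. \<bar>pmf (P' s) s' - pmf (P s) s'\<bar> \<le> \<delta>'"
    and Q': "\<forall>b\<in>B. \<forall>s\<in>S. \<forall>x\<in>\<Theta> b s. \<bar>pmf (Q' b s) x - pmf (Q b s) x\<bar> \<le> \<delta>'"
  have "\<forall>s\<in>S. \<forall>s'\<in>S. \<bar>pmf (P' s) s' - pmf (P s) s'\<bar> \<le> \<delta>"
    by (intro ballI order_trans[OF _ le]) (use P' in blast)
  moreover have "\<forall>b\<in>B. \<forall>s\<in>S. \<forall>x\<in>\<Theta> b s. \<bar>pmf (Q' b s) x - pmf (Q b s) x\<bar> \<le> \<delta>"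
    by (intro ballI order_trans[OF _ le]) (use Q' in blast)
  ultimately show "\<forall>s\<in>S. optimal_pairs S B A \<Theta> P' Q' s = optimal_pairs S B A \<Theta> P Q s"
    using st 1 unfolding optimal_pairs_stable_def by blast
qed

text \<open>The supremum need not be attained, but every smaller nonnegative value is admissible,
  since stability passes to smaller radii.\<close>

lemma (in restless_bandit) stable_half_radius:
  assumes "0 < stability_radius S B A \<Theta> P Q"
  shows "optimal_pairs_stable S B A \<Theta> P Q (stability_radius S B A \<Theta> P Q / 2)"
proof -
  let ?D = "{\<delta>. 0 \<le> \<delta> \<and> \<delta> \<le> 1 \<and> optimal_pairs_stable S B A \<Theta> P Q \<delta>}"
  have "optimal_pairs_stable S B A \<Theta> P Q 0"
    unfolding optimal_pairs_stable_def
  proof (intro allI impI ballI, elim conjE)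
    fix P' Q' s assume s: "s \<in> S"
      and P': "\<forall>s\<in>S. \<forall>s'\<in>S. \<bar>pmf (P' s) s' - pmf (P s) s'\<bar> \<le> 0"
      and Q': "\<forall>b\<in>B. \<forall>s\<in>S. \<forall>x\<in>\<Theta> b s. \<bar>pmf (Q' b s) x - pmf (Q b s) x\<bar> \<le> 0"
    have "expected_reward S \<Theta> (\<lambda>s. pmf (P' s)) (\<lambda>b s. pmf (Q' b s)) s b a =
        expected_reward S \<Theta> (\<lambda>s. pmf (P s)) (\<lambda>b s. pmf (Q b s)) s b a" if "b \<in> B" for b a
      unfolding expected_reward_def using P' Q' s that by (intro sum.cong arg_cong2[where f = "(*)"]) auto
    then show "optimal_pairs S B A \<Theta> P' Q' s = optimal_pairs S B A \<Theta> P Q s"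
      unfolding optimal_pairs_def is_arg_max_linorder by auto
  qed
  then have "?D \<noteq> {}" by (auto intro!: exI[of _ 0])
  moreover have "bdd_above ?D" by (rule bdd_aboveI[of _ 1]) auto
  moreover have "stability_radius S B A \<Theta> P Q / 2 < Sup ?D"
    using assms unfolding stability_radius_def by simp
  ultimately obtain \<delta> where \<delta>: "\<delta> \<in> ?D" "stability_radius S B A \<Theta> P Q / 2 < \<delta>"
    by (subst (asm) less_cSup_iff) blast+
  show ?thesis by (rule optimal_pairs_stable_mono[of S B A \<Theta> P Q \<delta>]) (use \<delta> in auto)
qed

context tuned_run
begin

lemma true_reward_meas:
  assumes t: "1 \<le> t"
  shows "(\<lambda>w. true_reward (st (t - 1) w) (arm t w) (center t w)) \<in> borel_measurable M"
proof -
  have st': "st (t - 1) \<in> M \<rightarrow>\<^sub>M count_space S" by (rule st_meas_M)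
  have arm': "arm t \<in> M \<rightarrow>\<^sub>M count_space B" by (rule M_meas[OF arm_meas[OF order_refl]])
  show ?thesis
  proof (rule measurable_compose_countable'[OF _ st'])
    fix s
    show "(\<lambda>w. true_reward s (arm t w) (center t w)) \<in> borel_measurable M"
    proof (rule measurable_compose_countable'[OF _ arm'])
      show "(\<lambda>w. true_reward s b (center t w)) \<in> borel_measurable M" for b
        unfolding true_reward_def expected_reward_inner by measurable
    qed (use arms in \<open>auto intro: countable_finite\<close>)
  qed (use states in \<open>auto intro: countable_finite\<close>)
qed

lemma best_reward_integrable: "integrable M (\<lambda>w. best_reward (st t w))"
proof -
  obtain c where c: "\<And>s. s \<in> S \<Longrightarrow> \<bar>best_reward s\<bar> \<le> c" by (rule finite_state_bound[of best_reward]) blast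
  show ?thesis
    by (rule bounded_integrable_AE[of _ c])
      (auto intro!: AE_I2 c st_in st_fun_meas_M)
qed

lemma loss_integrable:
  assumes t: "1 \<le> t"
  shows "integrable M (loss t)"
proof (rule bounded_integrable_AE[of _ "rmax"])
  have [measurable]: "(\<lambda>w. best_reward (st (t - 1) w)) \<in> borel_measurable M"
    by (rule measurable_count_space_borel[OF st_meas_M])
  note [measurable] = true_reward_meas[OF t]
  show "loss t \<in> borel_measurable M" unfolding loss_def[abs_def] by measurable
  show "AE w in M. \<bar>loss t w\<bar> \<le> rmax"
    using center_in_AE AE_space by eventually_elim (use loss_bounds in fastforce)
qed

lemma expectation_loss:
  assumes t: "1 \<le> t"
  shows "expectation (loss t) =
    expectation (\<lambda>w. best_reward (st (t - 1) w)) - expectation (\<lambda>w. center t w \<bullet> par t w)"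
proof -
  have "integrable M (\<lambda>w. best_reward (st (t - 1) w) - loss t w)"
    by (intro Bochner_Integration.integrable_diff best_reward_integrable loss_integrable t)
  then have "integrable M (\<lambda>w. true_reward (st (t - 1) w) (arm t w) (center t w))" by (simp add: loss_def)
  then show ?thesis unfolding loss_def[abs_def] expectation_center_reward[OF t]
    by (intro Bochner_Integration.integral_diff best_reward_integrable)
qed

lemma expectation_loss_nonneg: "0 \<le> expectation (loss t)"
proof -
  have "AE w in M. 0 \<le> loss t w"
    using center_in_AE AE_space by eventually_elim (use loss_bounds in blast)
  then show ?thesis by (rule integral_nonneg_AE)
qed

lemma best_reward_average:
  "\<exists>c. \<forall>T. \<bar>real T * (\<Sum>s\<in>S. pmf \<mu> s * best_reward s) -
    (\<Sum>t=1..T. expectation (\<lambda>w. best_reward (st (t - 1) w)))\<bar> \<le> c"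
proof -
  let ?\<rho> = "\<Sum>s\<in>S. pmf \<mu> s * best_reward s"
  obtain h where h: "\<And>y. y \<in> S \<Longrightarrow> h y - step_mean h y = best_reward y - ?\<rho>"
    by (rule poisson_equation[OF stationary, of best_reward]) blast
  obtain c where c: "\<And>s. s \<in> S \<Longrightarrow> \<bar>h s\<bar> \<le> c" by (rule finite_state_bound[of h]) blast
  let ?H = "\<lambda>t. expectation (\<lambda>w. h (st t w))"
  have int: "integrable M (\<lambda>w. h (st t w))" for t
    by (rule bounded_integrable_AE[of _ c])
      (auto intro!: AE_I2 c st_in st_fun_meas_M)
  have Hb: "\<bar>?H t\<bar> \<le> c" for t
  proof -
    have "\<bar>?H t\<bar> \<le> expectation (\<lambda>w. \<bar>h (st t w)\<bar>)" by (rule integral_abs_bound)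
    also have "\<dots> \<le> expectation (\<lambda>w. c)"
      by (rule integral_mono) (use int c st_in in auto)
    finally show ?thesis by (simp add: prob_space)
  qed
  \<comment> \<open>By the Poisson equation the excess over the stationary mean is a difference of
    consecutive values of one bounded sequence, whatever the initial law.\<close>
  have step: "expectation (\<lambda>w. best_reward (st (t - 1) w)) = ?\<rho> + (?H (t - 1) - ?H t)" if t: "1 \<le> t" for t
  proof -
    have "expectation (\<lambda>w. best_reward (st (t - 1) w)) =
        expectation (\<lambda>w. ?\<rho> + (h (st (t - 1) w) - step_mean h (st (t - 1) w)))"
      by (intro Bochner_Integration.integral_cong refl) (use h st_in in auto)
    also have "\<dots> = ?\<rho> + (?H (t - 1) - expectation (\<lambda>w. step_mean h (st (t - 1) w)))"
    proof -
      obtain c' where c': "\<And>s. s \<in> S \<Longrightarrow> \<bar>step_mean h s\<bar> \<le> c'" by (rule finite_state_bound[of "step_mean h"]) blast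
      have "integrable M (\<lambda>w. step_mean h (st (t - 1) w))"
        by (rule bounded_integrable_AE[of _ c'])
          (auto intro!: AE_I2 c' st_in st_fun_meas_M)
      then show ?thesis using int[of "t - 1"] by (simp add: prob_space)
    qed
    also have "expectation (\<lambda>w. step_mean h (st (t - 1) w)) = ?H t"
      using expectation_next[OF t, of "\<lambda>_. 1" 1 h] by simp
    finally show ?thesis .
  qed
  have "(\<Sum>t=1..T. expectation (\<lambda>w. best_reward (st (t - 1) w))) = real T * ?\<rho> + (?H 0 - ?H T)" for T
  proof (induction T)
    case (Suc T)
    then show ?case using step[of "Suc T"] by (simp add: algebra_simps)
  qed simp
  then have "\<bar>real T * ?\<rho> - (\<Sum>t=1..T. expectation (\<lambda>w. best_reward (st (t - 1) w)))\<bar> \<le> 2 * c" for T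
    using Hb[of 0] Hb[of T] by simp
  then show ?thesis by blast
qed

lemma expectation_regret:
  "expectation (regret \<rho> act par T) = real T * \<rho> - (\<Sum>t=1..T. expectation (\<lambda>w. act t w \<bullet> par t w))"
proof -
  have "integrable M (\<lambda>w. \<Sum>t=1..T. act t w \<bullet> par t w)"
    by (intro Bochner_Integration.integrable_sum reward_integrable)
  then have "expectation (regret \<rho> act par T) = real T * \<rho> - expectation (\<lambda>w. \<Sum>t=1..T. act t w \<bullet> par t w)"
    unfolding regret_def[abs_def] by (simp add: prob_space)
  then show ?thesis by (simp add: Bochner_Integration.integral_sum[OF reward_integrable])
qed

text \<open>Two-sided, because the absolute value of the expected regret is to be bounded. The
  difference consists of the deviation from stationarity and the exploration errors.\<close>

lemma regret_loss_difference:
  "\<exists>c. \<forall>T. \<bar>expectation (regret (\<Sum>s\<in>S. pmf \<mu> s * best_reward s) act par T) - (\<Sum>t=1..T. expectation (loss t))\<bar> \<le> c"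
proof -
  let ?\<rho> = "\<Sum>s\<in>S. pmf \<mu> s * best_reward s"
  obtain c where c: "\<And>T. \<bar>real T * ?\<rho> - (\<Sum>t=1..T. expectation (\<lambda>w. best_reward (st (t - 1) w)))\<bar> \<le> c"
    using best_reward_average by blast
  let ?e = "\<lambda>t. \<epsilon> * real t powr (- \<alpha>\<^sub>\<epsilon>)"
  have summ: "summable ?e" using \<alpha>\<^sub>\<epsilon>_gt by (intro summable_mult) (simp add: summable_real_powr_iff)
  have d: "\<bar>expectation (\<lambda>w. center t w \<bullet> par t w) - expectation (\<lambda>w. act t w \<bullet> par t w)\<bar> \<le> ?e t" if t: "1 \<le> t" for t
  proof -
    have "\<bar>expectation (\<lambda>w. center t w \<bullet> par t w) - expectation (\<lambda>w. act t w \<bullet> par t w)\<bar> =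
        \<bar>expectation (\<lambda>w. center t w \<bullet> par t w - act t w \<bullet> par t w)\<bar>"
      using center_reward_integrable reward_integrable by simp
    also have "\<dots> \<le> expectation (\<lambda>w. \<bar>center t w \<bullet> par t w - act t w \<bullet> par t w\<bar>)" by (rule integral_abs_bound)
    also have "\<dots> \<le> expectation (\<lambda>w. ?e t)"
    proof (rule integral_mono_AE)
      show "integrable M (\<lambda>w. \<bar>center t w \<bullet> par t w - act t w \<bullet> par t w\<bar>)"
        using center_reward_integrable reward_integrable by simp
      show "AE w in M. \<bar>center t w \<bullet> par t w - act t w \<bullet> par t w\<bar> \<le> ?e t"
        using reward_error_AE[OF t] by eventually_elim (simp add: abs_minus_commute)
    qed simp
    finally show ?thesis by (simp add: prob_space)
  qed
  have "\<bar>expectation (regret ?\<rho> act par T) - (\<Sum>t=1..T. expectation (loss t))\<bar> \<le> c + suminf ?e" for T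
  proof -
    have "(\<Sum>t=1..T. expectation (loss t)) = (\<Sum>t=1..T. expectation (\<lambda>w. best_reward (st (t - 1) w))) -
        (\<Sum>t=1..T. expectation (\<lambda>w. center t w \<bullet> par t w))"
      unfolding sum_subtractf[symmetric] by (intro sum.cong refl expectation_loss) simp
    then have "expectation (regret ?\<rho> act par T) - (\<Sum>t=1..T. expectation (loss t)) =
        (real T * ?\<rho> - (\<Sum>t=1..T. expectation (\<lambda>w. best_reward (st (t - 1) w)))) +
        (\<Sum>t=1..T. expectation (\<lambda>w. center t w \<bullet> par t w) - expectation (\<lambda>w. act t w \<bullet> par t w))"
      by (simp add: expectation_regret sum_subtractf)
    moreover have "\<bar>\<Sum>t=1..T. expectation (\<lambda>w. center t w \<bullet> par t w) - expectation (\<lambda>w. act t w \<bullet> par t w)\<bar> \<le> (\<Sum>t=1..T. ?e t)"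
      by (rule order_trans[OF sum_abs sum_mono]) (use d in simp)
    moreover have "(\<Sum>t=1..T. ?e t) \<le> suminf ?e"
      by (rule sum_le_suminf[OF summ]) (use \<epsilon>_pos in auto)
    ultimately show ?thesis using c[of T] by linarith
  qed
  then show ?thesis by blast
qed

text \<open>Failed rounds cost the constant. Each pair of arm and state is blamed at most
  \<open>T_S S P * (count_limit \<delta> T + 1)\<close> times in expectation, each time for at most
  \<open>rmax\<close>.\<close>

lemma sum_loss_le:
  assumes stable: "optimal_pairs_stable S B A \<Theta> P Q \<delta>" and \<delta>: "0 < \<delta>"
  shows "\<exists>c. \<forall>T\<ge>1. (\<Sum>t=1..T. expectation (loss t)) \<le>
    c + rmax * (real (card B) * real (card S) * (T_S S P * (count_limit \<delta> T + 1)))"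
proof -
  obtain E where EM: "\<And>u. E u \<in> sets M" and Es: "summable (\<lambda>u. (real u + 1) powr (1 + \<eta>) * prob (E u))"
    and E: "\<And>u w. w \<in> space M - E u \<Longrightarrow> estimates_good \<delta> u w"
    by (rule failure_events[OF \<delta>]) blast
  let ?r = "rmax" and ?F = "\<lambda>t. {w \<in> space M. w \<in> E (rstart t w)}"
  obtain c where c: "\<And>T. (\<Sum>t=1..T. prob (?F t)) \<le> c"
    using sum_failure_le[OF EM Es] by blast
  have EE: "?F t \<in> sets M" for t
  proof -
    have [measurable]: "rstart t \<in> M \<rightarrow>\<^sub>M count_space UNIV" by (rule M_meas[OF rstart_meas])
    have "?F t = (\<Union>u\<in>{..t}. {w \<in> space M. rstart t w = u} \<inter> E u)"
      using rstart_le by auto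
    also have "\<dots> \<in> sets M" by (intro sets.finite_UN sets.Int EM) simp_all
    finally show ?thesis .
  qed
  have "(\<Sum>t=1..T. expectation (loss t)) \<le> ?r * c + ?r * (real (card B) * real (card S) * (T_S S P * (count_limit \<delta> T + 1)))"
    if T: "1 \<le> T" for T
  proof -
    let ?W = "\<lambda>b s' t w. of_bool (blamed (count_limit \<delta> T) b s' t w) :: real"
    have L: "0 \<le> count_limit \<delta> T"
    proof -
      have "1 * 1 * 1 * 1 * 1 \<le> 4 * real T powr \<alpha> * real (C_\<Theta> S B \<Theta>) * real (card B) * real (card S)"
        using T \<alpha>_gt C_\<Theta>_ge_1 card_B_ge_1 card_S_ge_1 by (intro mult_mono) (auto intro: ge_one_powr_ge_zero)
      then show ?thesis by (simp add: count_limit_def)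
    qed
    have intW: "integrable M (?W b s' t)" if "1 \<le> t" for b s' t
    proof -
      have [measurable]: "Measurable.pred M (blamed (count_limit \<delta> T) b s' t)"
        by (rule M_meas[OF blamed_meas[OF that]])
      show ?thesis by (rule bounded_integrable_AE[of _ 1]) auto
    qed
    have intE: "integrable M (\<lambda>w. indicator (?F t) w :: real)" for t
      by (rule bounded_integrable_AE[of _ 1]) (use EE in \<open>auto simp: indicator_def\<close>)
    have each: "expectation (loss t) \<le> ?r * (prob (?F t) +
        (\<Sum>b\<in>B. \<Sum>s'\<in>S. expectation (?W b s' t)))" if t: "t \<in> {1..T}" for t
    proof -
      have t1: "1 \<le> t" using t by simp
      have "expectation (loss t) \<le> expectation (\<lambda>w. ?r *
          (indicator (?F t) w + (\<Sum>b\<in>B. \<Sum>s'\<in>S. ?W b s' t w)))"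
      proof (rule integral_mono_AE[OF loss_integrable[OF t1]])
        show "integrable M (\<lambda>w. ?r *
          (indicator (?F t) w + (\<Sum>b\<in>B. \<Sum>s'\<in>S. ?W b s' t w)))"
          by (intro integrable_mult_right Bochner_Integration.integrable_add Bochner_Integration.integrable_sum intE intW t1)
        show "AE w in M. loss t w \<le> ?r *
          (indicator (?F t) w + (\<Sum>b\<in>B. \<Sum>s'\<in>S. ?W b s' t w))"
          using loss_le_AE[OF stable \<delta> E t1, where T = T] t AE_space
          by (auto simp: indicator_def elim: eventually_elim2)
      qed
      also have "\<dots> = ?r * (expectation (\<lambda>w. indicator (?F t) w) +
          (\<Sum>b\<in>B. \<Sum>s'\<in>S. expectation (?W b s' t)))"
        using intE[of t] intW[OF t1]
        by (simp add: Bochner_Integration.integral_add Bochner_Integration.integral_sum Bochner_Integration.integrable_sum)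
      also have "expectation (\<lambda>w. indicator (?F t) w) =
          prob (?F t)"
        using EE[of t] by (simp add: Int_absorb2)
      finally show ?thesis .
    qed
    have "(\<Sum>t=1..T. expectation (loss t)) \<le> (\<Sum>t=1..T. ?r * (prob (?F t) +
        (\<Sum>b\<in>B. \<Sum>s'\<in>S. expectation (?W b s' t))))"
      by (intro sum_mono each)
    also have "\<dots> = ?r * ((\<Sum>t=1..T. prob (?F t)) +
        (\<Sum>t=1..T. \<Sum>b\<in>B. \<Sum>s'\<in>S. expectation (?W b s' t)))"
      by (simp add: sum_distrib_left[symmetric] sum.distrib)
    also have "(\<Sum>t=1..T. \<Sum>b\<in>B. \<Sum>s'\<in>S. expectation (?W b s' t)) = (\<Sum>b\<in>B. \<Sum>s'\<in>S. \<Sum>t=1..T. expectation (?W b s' t))"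
      by (subst sum.swap) (intro sum.cong refl sum.swap)
    also have "?r * ((\<Sum>t=1..T. prob (?F t)) +
        (\<Sum>b\<in>B. \<Sum>s'\<in>S. \<Sum>t=1..T. expectation (?W b s' t))) \<le>
        ?r * (c + (\<Sum>b\<in>B. \<Sum>s'\<in>S. T_S S P * (count_limit \<delta> T + 1)))"
      by (intro mult_left_mono add_mono c sum_mono sum_blamed_le L r_max_nonneg)
    also have "\<dots> = ?r * c + ?r * (real (card B) * real (card S) * (T_S S P * (count_limit \<delta> T + 1)))"
      by (simp add: distrib_left)
    finally show ?thesis .
  qed
  then show ?thesis by blast
qed

text \<open>Here the claimed bound is zero, so the constants of the general argument cannot be absorbed.\<close>

lemma expectation_regret_trivial:
  assumes r: "rmax = 0"
  shows "expectation (regret (\<Sum>s\<in>S. pmf \<mu> s * best_reward s) act par T) = 0"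
proof -
  obtain a x where ax: "a \<in> A" "x \<in> all_params" using A_nonempty params_nonempty by blast
  define k where "k = a \<bullet> x"
  have k: "a' \<bullet> x' = k" if "a' \<in> A" "x' \<in> all_params" for a' x'
    using inner_diff_le_r_max[OF that(1) ax(1) that(2) ax(2)] inner_diff_le_r_max[OF ax(1) that(1) ax(2) that(2)]
    by (simp add: r k_def)
  have tr: "true_reward s b a' = k" if "s \<in> S" "b \<in> B" "a' \<in> A" for s b a'
    using true_reward_between[OF that(1,2), where a = a' and K = k] k[OF that(3)] by (intro antisym) auto
  have best: "best_reward s = k" if s: "s \<in> S" for s
  proof -
    obtain b a' where "b \<in> B" "a' \<in> A" "true_reward s b a' = best_reward s"
      by (rule best_reward_attained)
    then show ?thesis using tr[OF s] by simp
  qed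
  have "(\<Sum>s\<in>S. pmf \<mu> s * best_reward s) = (\<Sum>s\<in>S. pmf \<mu> s) * k"
    by (simp add: best sum_distrib_right)
  also have "(\<Sum>s\<in>S. pmf \<mu> s) = 1"
    using stationary states by (intro sum_pmf_eq_1) (auto simp: stationary_on_def)
  finally have \<rho>: "(\<Sum>s\<in>S. pmf \<mu> s * best_reward s) = k" by simp
  have "expectation (\<lambda>w. act t w \<bullet> par t w) = expectation (\<lambda>w. k)" for t
  proof (rule integral_cong_AE)
    show "AE w in M. act t w \<bullet> par t w = k"
      using act_in_AE[of t] par_in_params_AE[of t] by eventually_elim (rule k)
  qed measurable
  then show ?thesis unfolding expectation_regret \<rho> by (simp add: prob_space)
qed

lemma regret_bound:
  assumes opt: "optimal_policy S B A \<Theta> P Q \<mu> \<pi>_opt" and rad: "stability_radius S B A \<Theta> P Q > 0"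
  shows "\<forall>\<^sub>F T in sequentially.
     \<bar>expectation (regret (policy_value S \<Theta> P Q \<mu> \<pi>_opt) act par T)\<bar>
     \<le> 33 * (real (C_\<Theta> S B \<Theta>) * real (card B) * real (card S) * T_M S P * T_S S P * rmax
          * (ln (4 * real T powr \<alpha> * real (C_\<Theta> S B \<Theta>) * real (card B) * real (card S))
             / (stability_radius S B A \<Theta> P Q)\<^sup>2))"
proof -
  define \<Delta> where "\<Delta> = stability_radius S B A \<Theta> P Q"
  define r where "r = rmax"
  define Y where "Y = real (card B) * real (card S) * T_S S P * r"
  define X where "X = real (C_\<Theta> S B \<Theta>) * real (card B) * real (card S) * T_M S P * T_S S P * r"
  define l where "l T = ln (4 * real T powr \<alpha> * real (C_\<Theta> S B \<Theta>) * real (card B) * real (card S))" for T :: nat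
  have pos: "1 \<le> real (C_\<Theta> S B \<Theta>)" "1 \<le> real (card B)" "1 \<le> real (card S)" "1 \<le> T_M S P" "1 \<le> T_S S P"
    using C_\<Theta>_ge_1 card_B_ge_1 card_S_ge_1 T_M_ge_1 T_S_ge_1 by auto
  have r0: "0 \<le> r" using r_max_nonneg by (simp add: r_def)
  have \<Delta>: "0 < \<Delta>" using rad by (simp add: \<Delta>_def)
  have Y0: "0 \<le> Y" unfolding Y_def using pos r0 by (intro mult_nonneg_nonneg) auto
  have YX: "Y \<le> X"
  proof -
    \<comment> \<open>\<open>C_\<Theta>\<close> and \<open>T_M\<close> enter as factors that are at
      least 1.\<close>
    have "1 * 1 * Y \<le> real (C_\<Theta> S B \<Theta>) * T_M S P * Y" using pos Y0 by (intro mult_right_mono mult_mono) auto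
    then show ?thesis by (simp add: X_def Y_def mult_ac)
  qed
  have \<rho>: "policy_value S \<Theta> P Q \<mu> \<pi>_opt = (\<Sum>s\<in>S. pmf \<mu> s * best_reward s)"
    by (rule optimal_policy_value[OF opt])
  let ?R = "\<lambda>T. expectation (regret (policy_value S \<Theta> P Q \<mu> \<pi>_opt) act par T)"
  have main: "\<forall>\<^sub>F T in sequentially. \<bar>?R T\<bar> \<le> 33 * (X * (l T / \<Delta>\<^sup>2))"
  proof (cases "r = 0")
    case True
    then have "\<bar>?R T\<bar> \<le> 33 * (X * (l T / \<Delta>\<^sup>2))" for T
      using expectation_regret_trivial[of T] by (simp add: \<rho> r_def X_def)
    then show ?thesis by simp
  next
    case False
    then have rp: "0 < r" using r0 by simp
    have Xp: "0 < X" unfolding X_def using pos rp by (intro mult_pos_pos) auto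
    obtain c1 where c1: "\<And>T. \<bar>?R T - (\<Sum>t=1..T. expectation (loss t))\<bar> \<le> c1"
      using regret_loss_difference unfolding \<rho> by blast
    obtain c2 where c2: "\<And>T. 1 \<le> T \<Longrightarrow> (\<Sum>t=1..T. expectation (loss t)) \<le>
        c2 + r * (real (card B) * real (card S) * (T_S S P * (count_limit (\<Delta> / 2) T + 1)))"
      using sum_loss_le[OF stable_half_radius[OF rad]] rad unfolding \<Delta>_def r_def by auto
    \<comment> \<open>Once \<open>l T\<close> exceeds this value, all constants together are at most
      X l(T) / \<Delta>^2; as l(T) >= ln T, this happens eventually. The division needs X > 0, that
      is, a positive \<open>r\<close>.\<close>
    define Z where "Z = (\<bar>c1\<bar> + \<bar>c2\<bar> + X) * \<Delta>\<^sup>2 / X"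
    have "\<bar>?R T\<bar> \<le> 33 * (X * (l T / \<Delta>\<^sup>2))" if T: "1 \<le> T" "exp Z \<le> real T" for T
    proof -
      have "real T = 1 * real T powr 1 * 1 * 1 * 1" using T by simp
      also have "\<dots> \<le> 4 * real T powr \<alpha> * real (C_\<Theta> S B \<Theta>) * real (card B) * real (card S)"
        using pos T \<alpha>_gt by (intro mult_mono powr_mono) auto
      finally have "ln (real T) \<le> l T" unfolding l_def using T by (intro ln_mono) auto
      moreover have "Z \<le> ln (real T)" using T by (simp add: ln_ge_iff)
      ultimately have lZ: "Z \<le> l T" by linarith
      have "\<bar>c1\<bar> + \<bar>c2\<bar> + X = X * (Z / \<Delta>\<^sup>2)" using Xp \<Delta> by (simp add: Z_def)
      also have "\<dots> \<le> X * (l T / \<Delta>\<^sup>2)" using lZ Xp by (intro mult_left_mono divide_right_mono) auto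
      finally have c: "\<bar>c1\<bar> + \<bar>c2\<bar> + X \<le> X * (l T / \<Delta>\<^sup>2)" .
      have l0: "0 \<le> l T / \<Delta>\<^sup>2"
        using c Xp by (metis abs_ge_zero add_nonneg_nonneg less_imp_le order_trans zero_le_mult_iff not_le)
      \<comment> \<open>The 32 is \<open>count_limit\<close> at \<Delta>/2: 8 / (1/2)^2.\<close>
      have "r * (real (card B) * real (card S) * (T_S S P * (count_limit (\<Delta> / 2) T + 1))) = Y * (32 * (l T / \<Delta>\<^sup>2) + 1)"
        by (simp add: Y_def count_limit_def l_def power_divide mult_ac)
      also have "\<dots> \<le> X * (32 * (l T / \<Delta>\<^sup>2) + 1)" using YX l0 by (intro mult_right_mono) auto
      finally have "(\<Sum>t=1..T. expectation (loss t)) \<le> c2 + X * (32 * (l T / \<Delta>\<^sup>2) + 1)"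
        using c2[OF T(1)] by linarith
      \<comment> \<open>Needed for the lower side of the absolute value.\<close>
      moreover have "0 \<le> (\<Sum>t=1..T. expectation (loss t))" by (intro sum_nonneg expectation_loss_nonneg)
      moreover have "X * (32 * (l T / \<Delta>\<^sup>2) + 1) = 32 * (X * (l T / \<Delta>\<^sup>2)) + X" by (simp add: algebra_simps)
      ultimately show ?thesis using c1[of T] c by linarith
    qed
    moreover have "\<forall>\<^sub>F T in sequentially. 1 \<le> T \<and> exp Z \<le> real T"
      using eventually_ge_at_top[of 1] eventually_ge_at_top[of "nat \<lceil>exp Z\<rceil>"]
      by eventually_elim linarith
    ultimately show ?thesis by (auto elim: eventually_mono)
  qed
  then show ?thesis unfolding X_def r_def l_def \<Delta>_def .
qed

end

theorem theorem1:
  fixes \<alpha> \<epsilon> \<alpha>\<^sub>\<epsilon> :: real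
  assumes "\<alpha> > 3" and "\<epsilon> > 0" and "\<alpha>\<^sub>\<epsilon> > 1"
  shows "\<exists>K :: real.
    \<forall>(S :: 's set) (B :: 'b set) (A :: (real^'n) set) \<Theta> P Q \<mu> (M :: 'w measure)
      init sh_init F st par arm act sh xh pol \<pi>_opt.
      algorithm_run S B A \<Theta> P Q \<mu> M \<alpha> \<epsilon> \<alpha>\<^sub>\<epsilon> init sh_init F st par arm act sh xh pol \<longrightarrow>
      optimal_policy S B A \<Theta> P Q \<mu> \<pi>_opt \<longrightarrow>
      stability_radius S B A \<Theta> P Q > 0 \<longrightarrow>
      (\<forall>\<^sub>F T in sequentially.
         \<bar>prob_space.expectation M (regret (policy_value S \<Theta> P Q \<mu> \<pi>_opt) act par T)\<bar>
         \<le> K * (real (C_\<Theta> S B \<Theta>) * real (card B) * real (card S) * T_M S P * T_S S P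
                  * r_max S B A \<Theta>
                  * (ln (4 * real T powr \<alpha> * real (C_\<Theta> S B \<Theta>) * real (card B) * real (card S))
                     / (stability_radius S B A \<Theta> P Q)\<^sup>2)
              + real (C_\<Theta> S B \<Theta>) * (real (card B))\<^sup>2 * (real (card S))\<^sup>2 * T_M S P * T_S S P
                  * r_max S B A \<Theta>
                  * log 2 (real T / (real (card S) * real (card B)) + 1)))"
proof (intro exI[of _ 33] allI impI)
  fix S :: "'s set" and B :: "'b set" and A :: "(real^'n) set" and \<Theta> P Q \<mu> and M :: "'w measure"
    and init sh_init F st par arm act sh xh pol \<pi>_opt
  assume run: "algorithm_run S B A \<Theta> P Q \<mu> M \<alpha> \<epsilon> \<alpha>\<^sub>\<epsilon> init sh_init F st par arm act sh xh pol"
    and opt: "optimal_policy S B A \<Theta> P Q \<mu> \<pi>_opt" and rad: "stability_radius S B A \<Theta> P Q > 0"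
  interpret tuned_run S B A \<Theta> P Q \<mu> M \<alpha> \<epsilon> \<alpha>\<^sub>\<epsilon> init sh_init F st par arm act sh xh pol
    using run assms by (intro tuned_run.intro tuned_run_axioms.intro)
  let ?l = "\<lambda>T. real (C_\<Theta> S B \<Theta>) * real (card B) * real (card S) * T_M S P * T_S S P * r_max S B A \<Theta>
      * (ln (4 * real T powr \<alpha> * real (C_\<Theta> S B \<Theta>) * real (card B) * real (card S))
         / (stability_radius S B A \<Theta> P Q)\<^sup>2)"
    and ?X = "real (C_\<Theta> S B \<Theta>) * (real (card B))\<^sup>2 * (real (card S))\<^sup>2 * T_M S P * T_S S P * r_max S B A \<Theta>"
  show "\<forall>\<^sub>F T in sequentially. \<bar>expectation (regret (policy_value S \<Theta> P Q \<mu> \<pi>_opt) act par T)\<bar>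
     \<le> 33 * (?l T + ?X * log 2 (real T / (real (card S) * real (card B)) + 1))"
    using regret_bound[OF opt rad]
  proof eventually_elim
    case (elim T)
    \<comment> \<open>The second summand of the bound is nonnegative, so adding it preserves the
      inequality.\<close>
    have "0 \<le> real T / (real (card S) * real (card B))" by simp
    then have "0 \<le> log 2 (real T / (real (card S) * real (card B)) + 1)"
      by (subst zero_le_log_cancel_iff) linarith+
    moreover have "0 \<le> ?X"
      using T_M_ge_1 T_S_ge_1 r_max_nonneg by (intro mult_nonneg_nonneg) auto
    ultimately have "0 \<le> ?X * log 2 (real T / (real (card S) * real (card B)) + 1)" by (rule mult_nonneg_nonneg[rotated])
    with elim show ?case unfolding distrib_left by linarith
  qed
qed

end
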